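(* For a graph $G$ the following are equivalent: (i) $G\in\mathcal{G}_{\rm COM}$, i.e. $G$ is (isomorphic to) the tope graph of a complex of oriented matroids; (ii) $G$ is a partial cube and every antipodal subgraph of $G$ is gated (i.e. $G\in\mathrm{AG}$); (iii) $G\in\mathcal{F}(\mathcal{Q}^-)$, i.e. $G$ is a partial cube none of whose pc-minors is isomorphic to a member of $\mathcal{Q}^-$.
   Context: A graph is a partial cube if it is isomorphic to an isometric subgraph of a hypercube. In a partial cube the Djoković–Winkler relation $\Theta$ on edges is an equivalence relation; its classes $E_f$ are the $\Theta$-classes (they correspond to the coordinates of an isometric hypercube embedding). Removing the edges of $E_f$ leaves two convex subgraphs, the halfspaces $E_f^+$, $E_f^-$. A subgraph is convex if it contains every shortest path between any two of its vertices; $\mathrm{conv}(S)$ is the smallest convex subgraph containing $S$. A restriction of $G$ is a subgraph induced by an intersection of halfspaces of distinct $\Theta$-classes; the contraction $\pi_f(G)$ is obtained by contracting all edges of $E_f$. A pc-minor of $G$ is any graph obtained from $G$ by a sequence of restrictions and contractions. For a set $X$ of partial cubes, $\mathcal F(X)$ denotes the class of partial cubes having no pc-minor isomorphic to a member of $X$. For a subgraph $H$ and $x\in H$, a vertex $-_Hx\in H$ with $\mathrm{conv}(x,-_Hx)=H$ is the antipode of $x$ in $H$; $H$ is antipodal if every vertex of $H$ has an antipode in $H$. A subgraph $H$ of $G$ is gated if for each vertex $x$ of $G$ there is $x'\in H$ such that for every $y\in H$ some shortest $x$–$y$ path passes through $x'$. $\mathrm{AG}$ is the class of partial cubes all of whose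 antipodal subgraphs are gated. The family $\mathcal Q^-$: for $n\ge 4$, let $v$ be a vertex of the hypercube $Q_n$ and $-v$ its antipodal vertex; $Q_n^-:=Q_n-\{-v\}$; $Q_n^{-*}$ is obtained from $Q_n^-$ by deleting exactly one neighbor of $v$; $Q_n^{--}(m)$ ($1\le m\le n$) is obtained from $Q_n^-$ by deleting $v$ and $m$ neighbors of $v$. $\mathcal{Q}^-=\{Q_n^{-*},Q_n^{--}(m)\mid n\ge 4,\ 1\le m\le n\}$. Sign vectors: $E$ a finite nonempty set, $\emptyset\neq\mathcal L\subseteq\{+,-,0\}^E$. For $X,Y$: $S(X,Y)=\{e: X_eY_e=-\}$; $(X\circ Y)_e=X_e$ if $X_e\ne 0$, else $Y_e$; $(-X)_e=-X_e$. (FS): $X\circ -Y\in\mathcal L$ for all $X,Y\in\mathcal L$. (SE): for all $X,Y\in\mathcal L$ and $e\in S(X,Y)$ there is $Z\in\mathcal L$ with $Z_e=0$ and $Z_f=(X\circ Y)_f$ for all $f\in E\setminus S(X,Y)$. $(E,\mathcal L)$ is a COM (complex of oriented matroids) if it satisfies (FS) and (SE). It is simple if for each $e$, $\{X_e: X\in\mathcal L\}=\{+,-,0\}$, and for each $e\ne f$ there are $X,Y\in\mathcal L$ with $\{X_eX_f,Y_eY_f\}=\{+,-\}$. The topes are $\mathcal T=\mathcal L\cap\{+,-\}^E$; the tope graph of a simple system is the subgraph of the hypercube on $\{+,-\}^E$ induced by $\mathcal T$; the tope graph of a non-simple system is that of its simplification (delete coordinates violating the first simplicity condition and all but one coordinate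 from each class of mutually parallel coordinates). $\mathcal G_{\rm COM}$ is the class of graphs isomorphic to tope graphs of COMs. *)

theory Defs
  imports Main
begin

type_synonym 'a graph = "'a set \<times> ('a \<times> 'a) set"

definition is_graph :: "'a graph \<Rightarrow> bool" where
  "is_graph G \<longleftrightarrow> snd G \<subseteq> fst G \<times> fst G \<and> sym (snd G) \<and> (\<forall>x. (x, x) \<notin> snd G)"

definition iso :: "'a graph \<Rightarrow> 'b graph \<Rightarrow> bool" where
  "iso G H \<longleftrightarrow> (\<exists>f. bij_betw f (fst G) (fst H) \<and>
     (\<forall>x\<in>fst G. \<forall>y\<in>fst G. (x, y) \<in> snd G \<longleftrightarrow> (f x, f y) \<in> snd H))"

definition induced :: "'a graph \<Rightarrow> 'a set \<Rightarrow> 'a graph" where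
  "induced G W = (fst G \<inter> W, {(x, y). (x, y) \<in> snd G \<and> x \<in> W \<and> y \<in> W})"

definition is_walk :: "'a graph \<Rightarrow> 'a list \<Rightarrow> 'a \<Rightarrow> 'a \<Rightarrow> bool" where
  "is_walk G ps x y \<longleftrightarrow> ps \<noteq> [] \<and> hd ps = x \<and> last ps = y \<and> set ps \<subseteq> fst G \<and>
     (\<forall>i. Suc i < length ps \<longrightarrow> (ps ! i, ps ! Suc i) \<in> snd G)"

definition reach :: "'a graph \<Rightarrow> 'a \<Rightarrow> 'a \<Rightarrow> bool" where
  "reach G x y \<longleftrightarrow> (\<exists>ps. is_walk G ps x y)"

text \<open>Graph distance (number of edges of a shortest walk); meaningful when y is reachable from x.\<close>
definition dist :: "'a graph \<Rightarrow> 'a \<Rightarrow> 'a \<Rightarrow> nat" where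
  "dist G x y = (LEAST k. \<exists>ps. is_walk G ps x y \<and> length ps = Suc k)"

definition shortest_path :: "'a graph \<Rightarrow> 'a list \<Rightarrow> 'a \<Rightarrow> 'a \<Rightarrow> bool" where
  "shortest_path G ps x y \<longleftrightarrow> is_walk G ps x y \<and> length ps = Suc (dist G x y)"

definition component :: "'a graph \<Rightarrow> 'a \<Rightarrow> 'a set" where
  "component G x = {y \<in> fst G. reach G x y}"

definition hypercube :: "nat \<Rightarrow> nat set graph" where
  "hypercube n = (Pow {0..<n},
     {(x, y). x \<in> Pow {0..<n} \<and> y \<in> Pow {0..<n} \<and> card ((x - y) \<union> (y - x)) = 1})"

definition isometric :: "'a graph \<Rightarrow> 'a set \<Rightarrow> bool" where
  "isometric G S \<longleftrightarrow> S \<subseteq> fst G \<and> (\<forall>x\<in>S. \<forall>y\<in>S.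
     reach (induced G S) x y \<and> dist (induced G S) x y = dist G x y)"

definition partial_cube :: "'a graph \<Rightarrow> bool" where
  "partial_cube G \<longleftrightarrow> (\<exists>n S. isometric (hypercube n) S \<and> iso G (induced (hypercube n) S))"

definition theta :: "'a graph \<Rightarrow> 'a \<times> 'a \<Rightarrow> 'a \<times> 'a \<Rightarrow> bool" where
  "theta G e f = (case e of (x, y) \<Rightarrow> case f of (u, v) \<Rightarrow>
     dist G x u + dist G y v \<noteq> dist G x v + dist G y u)"

definition theta_class :: "'a graph \<Rightarrow> ('a \<times> 'a) set \<Rightarrow> bool" where
  "theta_class G C \<longleftrightarrow> (\<exists>e\<in>snd G. C = {f \<in> snd G. theta G e f})"

definition halfspace :: "'a graph \<Rightarrow> ('a \<times> 'a) set \<Rightarrow> 'a set \<Rightarrow> bool" where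
  "halfspace G C W \<longleftrightarrow> (\<exists>x\<in>fst G. W = component (fst G, snd G - C) x)"

text \<open>Contraction of the edges of C. Vertices of minors are represented as (disjoint)
  sets of original vertices; contracting merges each connected component of the
  graph (V, C) into a single vertex, namely the union of its members.\<close>
definition cunion :: "'a set graph \<Rightarrow> ('a set \<times> 'a set) set \<Rightarrow> 'a set \<Rightarrow> 'a set" where
  "cunion G C x = \<Union> (component (fst G, C) x)"

definition contract :: "'a set graph \<Rightarrow> ('a set \<times> 'a set) set \<Rightarrow> 'a set graph" where
  "contract G C = (cunion G C ` fst G,
     {(cunion G C x, cunion G C y) | x y. (x, y) \<in> snd G \<and> cunion G C x \<noteq> cunion G C y})"

definition lift :: "'a graph \<Rightarrow> 'a set graph" where
  "lift G = ((\<lambda>x. {x}) ` fst G, {({x}, {y}) | x y. (x, y) \<in> snd G})"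

inductive_set pc_minors :: "'a graph \<Rightarrow> 'a set graph set" for G :: "'a graph" where
  base: "lift G \<in> pc_minors G"
| restr: "H \<in> pc_minors G \<Longrightarrow> (\<forall>C\<in>\<C>. theta_class H C \<and> halfspace H C (h C)) \<Longrightarrow>
          induced H (fst H \<inter> \<Inter> (h ` \<C>)) \<in> pc_minors G"
| contr: "H \<in> pc_minors G \<Longrightarrow> theta_class H C \<Longrightarrow> contract H C \<in> pc_minors G"

definition convex :: "'a graph \<Rightarrow> 'a set \<Rightarrow> bool" where
  "convex G W \<longleftrightarrow> W \<subseteq> fst G \<and>
     (\<forall>x\<in>W. \<forall>y\<in>W. \<forall>ps. shortest_path G ps x y \<longrightarrow> set ps \<subseteq> W)"

definition conv :: "'a graph \<Rightarrow> 'a set \<Rightarrow> 'a set" where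
  "conv G S = \<Inter> {W. convex G W \<and> S \<subseteq> W}"

text \<open>Subgraphs with conv(x,-x) = H are convex, hence induced; we represent them by vertex sets.\<close>
definition antipodal :: "'a graph \<Rightarrow> 'a set \<Rightarrow> bool" where
  "antipodal G W \<longleftrightarrow> W \<subseteq> fst G \<and> W \<noteq> {} \<and> (\<forall>x\<in>W. \<exists>y\<in>W. conv G {x, y} = W)"

definition gated :: "'a graph \<Rightarrow> 'a set \<Rightarrow> bool" where
  "gated G W \<longleftrightarrow> W \<subseteq> fst G \<and> (\<forall>x\<in>fst G. \<exists>x'\<in>W. \<forall>y\<in>W.
     \<exists>ps. shortest_path G ps x y \<and> x' \<in> set ps)"

definition AG :: "'a graph \<Rightarrow> bool" where
  "AG G \<longleftrightarrow> partial_cube G \<and> (\<forall>W. antipodal G W \<longrightarrow> gated G W)"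

definition in_Qminus :: "nat set graph \<Rightarrow> bool" where
  "in_Qminus H \<longleftrightarrow> (\<exists>n\<ge>4. \<exists>v\<subseteq>{0..<n}.
     let a = {0..<n} - v; N = (\<lambda>i. (v - {i}) \<union> ({i} - v)) in
       (\<exists>i<n. H = induced (hypercube n) (Pow {0..<n} - {a, N i}))
     \<or> (\<exists>M\<subseteq>{0..<n}. 1 \<le> card M \<and> H = induced (hypercube n) (Pow {0..<n} - {a, v} - N ` M)))"

definition F_Qminus :: "'a graph \<Rightarrow> bool" where
  "F_Qminus G \<longleftrightarrow> partial_cube G \<and> \<not> (\<exists>H\<in>pc_minors G. \<exists>Q. in_Qminus Q \<and> iso H Q)"

datatype sign = Pos | Neg | Zer

fun sneg :: "sign \<Rightarrow> sign" where
  "sneg Pos = Neg" | "sneg Neg = Pos" | "sneg Zer = Zer"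

fun sprod :: "sign \<Rightarrow> sign \<Rightarrow> sign" where
  "sprod Zer _ = Zer" | "sprod _ Zer = Zer"
| "sprod Pos Pos = Pos" | "sprod Neg Neg = Pos"
| "sprod Pos Neg = Neg" | "sprod Neg Pos = Neg"

definition signvecs :: "'e set \<Rightarrow> ('e \<Rightarrow> sign) set" where
  "signvecs E = {X. \<forall>e. e \<notin> E \<longrightarrow> X e = Zer}"

definition scomp :: "('e \<Rightarrow> sign) \<Rightarrow> ('e \<Rightarrow> sign) \<Rightarrow> ('e \<Rightarrow> sign)" where
  "scomp X Y = (\<lambda>e. if X e \<noteq> Zer then X e else Y e)"

definition sneg_vec :: "('e \<Rightarrow> sign) \<Rightarrow> ('e \<Rightarrow> sign)" where
  "sneg_vec X = (\<lambda>e. sneg (X e))"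

definition sep :: "('e \<Rightarrow> sign) \<Rightarrow> ('e \<Rightarrow> sign) \<Rightarrow> 'e set" where
  "sep X Y = {e. sprod (X e) (Y e) = Neg}"

definition COM :: "'e set \<Rightarrow> ('e \<Rightarrow> sign) set \<Rightarrow> bool" where
  "COM E L \<longleftrightarrow> finite E \<and> E \<noteq> {} \<and> L \<noteq> {} \<and> L \<subseteq> signvecs E \<and>
     (\<forall>X\<in>L. \<forall>Y\<in>L. scomp X (sneg_vec Y) \<in> L) \<and>
     (\<forall>X\<in>L. \<forall>Y\<in>L. \<forall>e\<in>sep X Y. \<exists>Z\<in>L. Z e = Zer \<and>
        (\<forall>f\<in>E - sep X Y. Z f = scomp X Y f))"

definition full_coord :: "('e \<Rightarrow> sign) set \<Rightarrow> 'e \<Rightarrow> bool" where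
  "full_coord L e \<longleftrightarrow> {X e | X. X \<in> L} = {Pos, Neg, Zer}"

definition distinguished :: "('e \<Rightarrow> sign) set \<Rightarrow> 'e \<Rightarrow> 'e \<Rightarrow> bool" where
  "distinguished L e f \<longleftrightarrow> (\<exists>X\<in>L. \<exists>Y\<in>L. {sprod (X e) (X f), sprod (Y e) (Y f)} = {Pos, Neg})"

definition simple :: "'e set \<Rightarrow> ('e \<Rightarrow> sign) set \<Rightarrow> bool" where
  "simple E L \<longleftrightarrow> (\<forall>e\<in>E. full_coord L e) \<and> (\<forall>e\<in>E. \<forall>f\<in>E. e \<noteq> f \<longrightarrow> distinguished L e f)"

text \<open>E' is a choice of coordinates for the simplification of (E, L): coordinates violating
  the first simplicity condition are deleted, and exactly one coordinate is kept from each
  class of mutually parallel coordinates (those violating the second condition).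
  For a simple system necessarily E' = E.\<close>
definition simplification_coords :: "'e set \<Rightarrow> ('e \<Rightarrow> sign) set \<Rightarrow> 'e set \<Rightarrow> bool" where
  "simplification_coords E L E' \<longleftrightarrow> E' \<subseteq> {e \<in> E. full_coord L e} \<and>
     (\<forall>e\<in>E. full_coord L e \<longrightarrow> (\<exists>f\<in>E'. e = f \<or> \<not> distinguished L e f)) \<and>
     (\<forall>e\<in>E'. \<forall>f\<in>E'. e \<noteq> f \<longrightarrow> distinguished L e f)"

definition restrict_vec :: "'e set \<Rightarrow> ('e \<Rightarrow> sign) \<Rightarrow> ('e \<Rightarrow> sign)" where
  "restrict_vec E' X = (\<lambda>e. if e \<in> E' then X e else Zer)"

definition tope_graph :: "'e set \<Rightarrow> ('e \<Rightarrow> sign) set \<Rightarrow> ('e \<Rightarrow> sign) graph" where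
  "tope_graph E' L =
     (let T = {restrict_vec E' X | X. X \<in> L \<and> (\<forall>e\<in>E'. X e \<noteq> Zer)} in
      (T, {(X, Y). X \<in> T \<and> Y \<in> T \<and> card {e \<in> E'. X e \<noteq> Y e} = 1}))"

definition G_COM :: "'a graph \<Rightarrow> bool" where
  "G_COM G \<longleftrightarrow> (\<exists>(E :: nat set) L E'. COM E L \<and> simplification_coords E L E' \<and>
     iso G (tope_graph E' L))"

end

theory Submission
  imports Defs
begin

text \<open>
  Embed a partial cube isometrically in a hypercube. Its antipodal subgraphs are then the faces closed
  under the antipodal map, and such a face \<open>X\<close> is gated iff \<open>X \<odot> t\<close> is a tope for every tope \<open>t\<close>.

  In a COM every antipodal face is a covector, hence gated. Conversely, if all antipodal faces are gated,
  they form a set of sign vectors that satisfies (FS) trivially; (SE) is proved by induction on the number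
  of coordinates, by passing to the zone of the coordinate to be eliminated and using that antipodal faces
  lift through deletions of a COM. Since deletions of COMs are COMs, the class with gated antipodal
  subgraphs is closed under contraction, and it contains no member of \<open>\<Q>\<^sup>-\<close>.

  Finally, in a minor-minimal partial cube with a non-gated antipodal face, the face is a cube minus two
  antipodal vertices, exactly one coordinate separates it from the rest, and minimality determines the rest
  up to some neighbours of one missing vertex; these are the graphs in \<open>\<Q>\<^sup>-\<close>.
\<close>

section \<open>Covectors and deletion in COMs\<close>

text \<open>The obstacle is a circle. To lift an antipodal face of a deletion to a covector of the
  whole system, one needs to know already that the face above it is a COM; and the COM property is
  what is being proved. So \<open>ag_system_del\<close> takes the COM property of systems with fewer
  coordinates as a hypothesis, and closure under contraction becomes unconditional only after
  \<open>ag_system_com\<close>. The induction is fed by the fact that the face of a nonzero vector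
  has fewer coordinates than the system; the zero vector, whose face is everything, is treated
  separately there.

  Two languages are used. Sign vectors serve the COM half, where reflections of faces and gates are
  compositions. Finite sets serve the graph half, where a restriction is an intersection with a
  convex family and a contraction removes one element from every set. \<open>sv\<close> and
  \<open>pos\<close> translate between them; contracting a Theta class of the graph is the same as
  deleting a coordinate of the sign vectors.\<close>

notation scomp (infixr "\<odot>" 70)
notation sneg_vec ("\<ominus>_" [81] 80)

lemma sneg_sneg [simp]: "sneg (sneg s) = s"
  by (cases s) auto

lemma sneg_eq_Zer [simp]: "sneg s = Zer \<longleftrightarrow> s = Zer"
  by (cases s) auto

lemma sneg_fixed [simp]: "sneg s = s \<longleftrightarrow> s = Zer"  "s = sneg s \<longleftrightarrow> s = Zer"
  by (cases s; simp)+

lemma sign_neq_iff: "s \<noteq> Zer \<Longrightarrow> t \<noteq> Zer \<Longrightarrow> s \<noteq> t \<longleftrightarrow> s = sneg t"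
  by (cases s; cases t) auto

lemma sep_iff: "e \<in> sep X Y \<longleftrightarrow> X e \<noteq> Zer \<and> Y e \<noteq> Zer \<and> X e \<noteq> Y e"
  unfolding sep_def by (cases "X e"; cases "Y e") auto

lemma scomp_apply: "(X \<odot> Y) e = (if X e \<noteq> Zer then X e else Y e)"
  by (simp add: scomp_def)

lemma sneg_vec_apply [simp]: "(\<ominus> X) e = sneg (X e)"
  by (simp add: sneg_vec_def)

lemma sneg_vec_sneg_vec [simp]: "\<ominus> (\<ominus> X) = X"
  by (auto simp: fun_eq_iff)

text \<open>Two applications of (FS) give closure under composition; \<open>com_scomp\<close> and
  \<open>cov_scomp_tope\<close> rest on this identity.\<close>

lemma scomp_neg_neg: "X \<odot> \<ominus> (X \<odot> \<ominus> Y) = X \<odot> Y"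
  by (auto simp: fun_eq_iff scomp_apply)

definition full :: "'e set \<Rightarrow> ('e \<Rightarrow> sign) set" where
  "full E = {X. \<forall>e. X e = Zer \<longleftrightarrow> e \<notin> E}"

text \<open>\<open>COM\<close> without its two nonemptiness conditions, so that the induction on
  \<open>card E\<close> and restriction to an arbitrary subset, possibly empty, stay within the
  notion.\<close>

definition com :: "'e set \<Rightarrow> ('e \<Rightarrow> sign) set \<Rightarrow> bool" where
  "com E L \<longleftrightarrow> finite E \<and> L \<subseteq> signvecs E \<and>
     (\<forall>X\<in>L. \<forall>Y\<in>L. X \<odot> \<ominus> Y \<in> L) \<and>
     (\<forall>X\<in>L. \<forall>Y\<in>L. \<forall>e\<in>sep X Y. \<exists>Z\<in>L. Z e = Zer \<and>
        (\<forall>f\<in>E - sep X Y. Z f = (X \<odot> Y) f))"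

text \<open>Faces are given by sign vectors \<open>X\<close>; \<open>antipodal_face\<close> says that the face is nonempty and closed
  under the antipodal map \<open>t \<mapsto> X \<odot> \<ominus> t\<close>. A face \<open>X\<close> lies in \<open>cov T\<close> iff it is antipodal and gated,
  since \<open>X \<odot> t\<close> is the only possible gate of \<open>t\<close>.\<close>

definition face :: "('e \<Rightarrow> sign) set \<Rightarrow> ('e \<Rightarrow> sign) \<Rightarrow> ('e \<Rightarrow> sign) set" where
  "face T X = {t \<in> T. \<forall>e. X e \<noteq> Zer \<longrightarrow> t e = X e}"

definition antipodal_face :: "('e \<Rightarrow> sign) set \<Rightarrow> ('e \<Rightarrow> sign) \<Rightarrow> bool" where
  "antipodal_face T X \<longleftrightarrow> face T X \<noteq> {} \<and> (\<forall>t\<in>face T X. X \<odot> \<ominus> t \<in> T)"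

definition cov :: "('e \<Rightarrow> sign) set \<Rightarrow> ('e \<Rightarrow> sign) set" where
  "cov T = {X. \<forall>t\<in>T. X \<odot> \<ominus> t \<in> T}"

text \<open>The last condition replaces isometry. Unlike isometry it survives the passage to the zone of an
  element \<open>e\<close>, where distinct coordinates may become parallel.\<close>

definition ag_system :: "'e set \<Rightarrow> ('e \<Rightarrow> sign) set \<Rightarrow> bool" where
  "ag_system E T \<longleftrightarrow> finite E \<and> T \<noteq> {} \<and> T \<subseteq> full E \<and>
     (\<forall>X. antipodal_face T X \<longrightarrow> X \<in> cov T) \<and>
     (\<forall>x\<in>T. \<forall>y\<in>T. \<forall>e. x e \<noteq> y e \<longrightarrow>
        (\<exists>X\<in>cov T. X e = Zer \<and> (\<forall>h. x h = y h \<longrightarrow> X h = x h)))"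

lemma fullD: "x \<in> full E \<Longrightarrow> x e = Zer \<longleftrightarrow> e \<notin> E"
  by (simp add: full_def)

lemma faceI: "t \<in> T \<Longrightarrow> (\<And>e. X e \<noteq> Zer \<Longrightarrow> t e = X e) \<Longrightarrow> t \<in> face T X"
  by (simp add: face_def)

lemma faceD: "t \<in> face T X \<Longrightarrow> t \<in> T" "t \<in> face T X \<Longrightarrow> X e \<noteq> Zer \<Longrightarrow> t e = X e"
  by (simp_all add: face_def)

lemma com_scomp: "com E L \<Longrightarrow> X \<in> L \<Longrightarrow> Y \<in> L \<Longrightarrow> X \<odot> Y \<in> L"
  unfolding com_def by (metis scomp_neg_neg)

lemma com_elim:
  assumes "com E L" "X \<in> L" "Y \<in> L" "e \<in> sep X Y"
  obtains Z where "Z \<in> L" "Z e = Zer" "\<And>f. f \<in> E \<Longrightarrow> f \<notin> sep X Y \<Longrightarrow> Z f = (X \<odot> Y) f"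
  using assms unfolding com_def by (metis DiffI)

lemma covD: "X \<in> cov T \<Longrightarrow> t \<in> T \<Longrightarrow> X \<odot> \<ominus> t \<in> T"
  by (simp add: cov_def)

lemma cov_scomp_tope: "X \<in> cov T \<Longrightarrow> t \<in> T \<Longrightarrow> X \<odot> t \<in> T"
  unfolding cov_def by (metis (mono_tags, lifting) mem_Collect_eq scomp_neg_neg)

text \<open>Take \<open>Y \<in> L\<close> above \<open>X\<close> of minimal support. If \<open>Y \<noteq> X\<close>, then \<open>Y' = X \<odot> \<ominus> Y\<close> is again an antipodal
  face, so \<open>Y' \<in> L\<close> by induction, and eliminating between \<open>Y\<close> and \<open>Y'\<close> gives a smaller support.\<close>

lemma antipodal_face_mem_com:
  assumes L: "com E L" and X: "antipodal_face (L \<inter> full E) X"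
  shows "X \<in> L"
  using X
proof (induction "card {e \<in> E. X e = Zer}" arbitrary: X rule: less_induct)
  case less
  let ?T = "L \<inter> full E"
  have fin: "finite E" and LE: "L \<subseteq> signvecs E" using L by (auto simp: com_def)
  have neg: "X \<odot> \<ominus> t \<in> ?T" if "t \<in> face ?T X" for t
    using less.prems that by (simp add: antipodal_face_def)
  obtain t where t: "t \<in> face ?T X" using less.prems by (auto simp: antipodal_face_def)
  define C where "C = {Y \<in> L. \<forall>e. X e \<noteq> Zer \<longrightarrow> Y e = X e}"
  have "t \<in> C" using t by (auto simp: C_def face_def)
  then obtain Y where Y: "Y \<in> C" and
    Ymin: "\<And>V. V \<in> C \<Longrightarrow> card {e. Y e \<noteq> Zer} \<le> card {e. V e \<noteq> Zer}"
    using ex_has_least_nat[of "\<lambda>Y. Y \<in> C" t "\<lambda>V. card {e. V e \<noteq> Zer}"] by blast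
  have YL: "Y \<in> L" and YX: "\<And>e. X e \<noteq> Zer \<Longrightarrow> Y e = X e" using Y by (auto simp: C_def)
  have supp: "{e. V e \<noteq> Zer} \<subseteq> E" if "V \<in> L" for V
    using that LE by (auto simp: signvecs_def)
  show ?case
  proof (cases "\<exists>e. Y e \<noteq> Zer \<and> X e = Zer")
    case False
    then have "Y = X" using YX by (metis ext)
    then show ?thesis using YL by simp
  next
    case True
    then obtain e where e: "Y e \<noteq> Zer" "X e = Zer" by blast
    define Y' where "Y' = X \<odot> \<ominus> Y"
    have Yt: "Y \<odot> s \<in> face ?T X" if "s \<in> ?T" for s
    proof (rule faceI)
      have "Y \<odot> s \<in> L" using com_scomp[OF L YL] that by simp
      moreover have "Y \<odot> s \<in> full E"
        using that supp[OF YL] by (auto simp: full_def scomp_apply)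
      ultimately show "Y \<odot> s \<in> ?T" by simp
    qed (auto simp: scomp_apply YX)
    have Ymt: "Y \<odot> \<ominus> s \<in> face ?T X" if "s \<in> ?T" for s
    proof (rule faceI)
      have "Y \<odot> \<ominus> s \<in> L" using L YL that unfolding com_def by blast
      moreover have "Y \<odot> \<ominus> s \<in> full E"
        using that supp[OF YL] by (auto simp: full_def scomp_apply)
      ultimately show "Y \<odot> \<ominus> s \<in> ?T" by simp
    qed (auto simp: scomp_apply YX)
    have "antipodal_face ?T Y'"
      unfolding antipodal_face_def
    proof (intro conjI ballI)
      have tT: "t \<in> ?T" using t faceD(1) by metis
      have "X \<odot> \<ominus> (Y \<odot> t) \<in> face ?T Y'"
        by (rule faceI[OF neg[OF Yt[OF tT]]]) (auto simp: Y'_def scomp_apply split: if_splits)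
      then show "face ?T Y' \<noteq> {}" by blast
    next
      fix u assume u: "u \<in> face ?T Y'"
      then have uT: "u \<in> ?T" using faceD(1) by metis
      have "u \<in> face ?T X"
        by (rule faceI[OF uT]) (use u in \<open>auto simp: face_def Y'_def scomp_apply\<close>)
      then have "X \<odot> \<ominus> u \<in> ?T" by (rule neg)
      \<comment> \<open>The reflection in \<open>X\<close> carries the face of \<open>Y\<close> to
        that of \<open>Y'\<close>, so conjugating the antipodal map of \<open>Y\<close> by it gives
        the antipodal map of \<open>Y'\<close>.\<close>
      then have "X \<odot> \<ominus> (Y \<odot> \<ominus> (X \<odot> \<ominus> u)) \<in> ?T" using neg Ymt by blast
      moreover have "X \<odot> \<ominus> (Y \<odot> \<ominus> (X \<odot> \<ominus> u)) = Y' \<odot> \<ominus> u"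
        using YX by (auto simp: fun_eq_iff scomp_apply Y'_def)
      ultimately show "Y' \<odot> \<ominus> u \<in> ?T" by simp
    qed
    moreover have "card {e \<in> E. Y' e = Zer} < card {e \<in> E. X e = Zer}"
    proof (rule psubset_card_mono)
      have "e \<in> E" using e supp[OF YL] by blast
      then show "{e \<in> E. Y' e = Zer} \<subset> {e \<in> E. X e = Zer}"
        using e by (auto simp: Y'_def scomp_apply split: if_splits)
    qed (use fin in simp)
    ultimately have Y'L: "Y' \<in> L" using less.hyps by blast
    have sepY: "h \<in> sep Y Y' \<longleftrightarrow> Y h \<noteq> Zer \<and> X h = Zer" for h
      using YX by (auto simp: sep_iff Y'_def scomp_apply)
    then obtain V where V: "V \<in> L" "V e = Zer" "\<And>f. f \<in> E \<Longrightarrow> f \<notin> sep Y Y' \<Longrightarrow> V f = (Y \<odot> Y') f"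
      using com_elim[OF L YL Y'L, of e] e by blast
    have VC: "V \<in> C"
      unfolding C_def
    proof (intro CollectI conjI allI impI)
      fix h assume h: "X h \<noteq> Zer"
      then have "h \<in> E" "h \<notin> sep Y Y'" using sepY YX supp[OF YL] by auto
      then show "V h = X h" using V(3) h YX by (simp add: scomp_apply)
    qed (use V in simp)
    have "{e. V e \<noteq> Zer} \<subset> {e. Y e \<noteq> Zer}"
    proof
      show "{e. V e \<noteq> Zer} \<subseteq> {e. Y e \<noteq> Zer}"
      proof
        fix h assume h: "h \<in> {e. V e \<noteq> Zer}"
        then have hE: "h \<in> E" using supp[OF V(1)] by blast
        show "h \<in> {e. Y e \<noteq> Zer}"
        proof (rule ccontr)
          assume "\<not> ?thesis"
          then have y: "Y h = Zer" by simp
          then have "X h = Zer" using YX by metis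
          then have "Y' h = Zer" using y by (simp add: Y'_def scomp_apply)
          then have "V h = Zer" using V(3)[of h] y hE by (simp add: sepY scomp_apply)
          then show False using h by simp
        qed
      qed
    qed (use V(2) e in auto)
    then have "card {e. V e \<noteq> Zer} < card {e. Y e \<noteq> Zer}"
      using supp[OF YL] fin by (meson finite_subset psubset_card_mono)
    then show ?thesis using Ymin[OF VC] by simp
  qed
qed

lemma restrict_vec_apply: "restrict_vec F X e = (if e \<in> F then X e else Zer)"
  by (simp add: restrict_vec_def)

lemma restrict_vec_scomp: "restrict_vec F (X \<odot> Y) = restrict_vec F X \<odot> restrict_vec F Y"
  by (auto simp: fun_eq_iff restrict_vec_apply scomp_apply)

lemma restrict_vec_neg: "restrict_vec F (\<ominus> X) = \<ominus> restrict_vec F X"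
  by (auto simp: fun_eq_iff restrict_vec_apply)

text \<open>Any preimages in \<open>L\<close> serve: within \<open>F\<close> the separated
  coordinates do not change, and outside \<open>F\<close> nothing is asked.\<close>

lemma com_restrict:
  assumes "com E L" "F \<subseteq> E"
  shows "com F (restrict_vec F ` L)"
  unfolding com_def
proof (intro conjI ballI)
  show "finite F" using assms finite_subset by (auto simp: com_def)
  show "restrict_vec F ` L \<subseteq> signvecs F" by (auto simp: signvecs_def restrict_vec_apply)
next
  fix X Y assume "X \<in> restrict_vec F ` L" "Y \<in> restrict_vec F ` L"
  then obtain X' Y' where XY: "X' \<in> L" "X = restrict_vec F X'" "Y' \<in> L" "Y = restrict_vec F Y'" by blast
  then have "X \<odot> \<ominus> Y = restrict_vec F (X' \<odot> \<ominus> Y')" by (simp add: restrict_vec_scomp restrict_vec_neg)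
  moreover have "X' \<odot> \<ominus> Y' \<in> L" using XY assms(1) by (auto simp: com_def)
  ultimately show "X \<odot> \<ominus> Y \<in> restrict_vec F ` L" by blast
next
  fix X Y e assume "X \<in> restrict_vec F ` L" "Y \<in> restrict_vec F ` L" and e: "e \<in> sep X Y"
  then obtain X' Y' where XY: "X' \<in> L" "X = restrict_vec F X'" "Y' \<in> L" "Y = restrict_vec F Y'" by blast
  have eF: "e \<in> F" and e': "e \<in> sep X' Y'"
    using e XY by (auto simp: sep_iff restrict_vec_apply split: if_splits)
  then obtain Z where Z: "Z \<in> L" "Z e = Zer" "\<And>f. f \<in> E \<Longrightarrow> f \<notin> sep X' Y' \<Longrightarrow> Z f = (X' \<odot> Y') f"
    using com_elim[OF assms(1) XY(1,3)] by blast
  show "\<exists>Z\<in>restrict_vec F ` L. Z e = Zer \<and> (\<forall>f\<in>F - sep X Y. Z f = (X \<odot> Y) f)"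
  proof (intro bexI[of _ "restrict_vec F Z"] conjI ballI)
    fix f assume f: "f \<in> F - sep X Y"
    then have "f \<in> E" "f \<notin> sep X' Y'" using assms(2) XY by (auto simp: sep_iff restrict_vec_apply)
    then show "restrict_vec F Z f = (X \<odot> Y) f" using Z f XY by (simp add: scomp_apply restrict_vec_apply)
  qed (use Z in \<open>auto simp: restrict_vec_apply\<close>)
qed

section \<open>Systems with gated antipodal faces\<close>

lemma ag_systemD:
  assumes "ag_system E T"
  shows ag_finite: "finite E" and ag_nonempty: "T \<noteq> {}" and ag_full: "T \<subseteq> full E"
    and ag_antipodal_cov: "antipodal_face T X \<Longrightarrow> X \<in> cov T"
    and ag_eliminate: "x \<in> T \<Longrightarrow> y \<in> T \<Longrightarrow> x e \<noteq> y e \<Longrightarrow>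
      (\<exists>X\<in>cov T. X e = Zer \<and> (\<forall>h. x h = y h \<longrightarrow> X h = x h))"
  using assms unfolding ag_system_def by blast+

lemma ag_Zer_iff: "ag_system E T \<Longrightarrow> t \<in> T \<Longrightarrow> t e = Zer \<longleftrightarrow> e \<notin> E"
  using ag_full fullD by (metis subsetD)

lemma cov_signvecs: "T \<noteq> {} \<Longrightarrow> T \<subseteq> full E \<Longrightarrow> cov T \<subseteq> signvecs E"
proof
  fix X assume T: "T \<noteq> {}" "T \<subseteq> full E" and X: "X \<in> cov T"
  then obtain t where "t \<in> T" by blast
  then have "X \<odot> \<ominus> t \<in> full E" using X T covD by blast
  then have "(X \<odot> \<ominus> t) e = Zer" if "e \<notin> E" for e using that by (simp add: full_def)
  then have "X e = Zer" if "e \<notin> E" for e using that by (metis scomp_apply)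
  then show "X \<in> signvecs E" by (simp add: signvecs_def)
qed

text \<open>\<open>X \<odot> \<ominus> (Y \<odot> t)\<close> reassociates to
  \<open>(X \<odot> \<ominus> Y) \<odot> \<ominus> t\<close>, and \<open>Y \<odot> t\<close> is a
  tope.\<close>

lemma cov_comp_neg: "X \<in> cov T \<Longrightarrow> Y \<in> cov T \<Longrightarrow> X \<odot> \<ominus> Y \<in> cov T"
proof (unfold cov_def, safe)
  fix t assume X: "\<forall>t\<in>T. X \<odot> \<ominus> t \<in> T" and Y: "\<forall>t\<in>T. Y \<odot> \<ominus> t \<in> T" and t: "t \<in> T"
  have "X \<odot> \<ominus> (Y \<odot> t) \<in> T" using X Y t cov_scomp_tope[of Y T t] by (simp add: cov_def)
  moreover have "X \<odot> \<ominus> (Y \<odot> t) = (X \<odot> \<ominus> Y) \<odot> \<ominus> t" by (auto simp: fun_eq_iff scomp_apply)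
  ultimately show "(X \<odot> \<ominus> Y) \<odot> \<ominus> t \<in> T" by simp
qed

lemma cov_Int_full: "T \<noteq> {} \<Longrightarrow> T \<subseteq> full E \<Longrightarrow> cov T \<inter> full E = T"
proof (intro equalityI subsetI)
  fix X assume T: "T \<noteq> {}" "T \<subseteq> full E" and X: "X \<in> cov T \<inter> full E"
  then obtain t where t: "t \<in> T" by blast
  then have "X \<odot> \<ominus> t \<in> T" using X covD by blast
  moreover have "X h = Zer \<longleftrightarrow> t h = Zer" for h
    using X t T fullD by (metis IntD2 subsetD)
  then have "(X \<odot> \<ominus> t) h = X h" for h by (metis scomp_apply sneg.simps(3) sneg_vec_apply)
  then have "X \<odot> \<ominus> t = X" by blast
  ultimately show "X \<in> T" by simp
next
  fix X assume T: "T \<noteq> {}" "T \<subseteq> full E" and X: "X \<in> T"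
  have "X \<odot> \<ominus> t = X" if "t \<in> T" for t
  proof -
    have "X h = Zer \<longleftrightarrow> t h = Zer" for h using X T that fullD by (metis subsetD)
    then have "(X \<odot> \<ominus> t) h = X h" for h by (metis scomp_apply sneg.simps(3) sneg_vec_apply)
    then show ?thesis by blast
  qed
  then show "X \<in> cov T \<inter> full E" using X T by (auto simp: cov_def)
qed

lemma cov_antipodal_face: "X \<in> cov T \<Longrightarrow> T \<noteq> {} \<Longrightarrow> antipodal_face T X"
proof -
  assume X: "X \<in> cov T" and "T \<noteq> {}"
  then obtain t where "t \<in> T" by blast
  then have "X \<odot> t \<in> face T X" using cov_scomp_tope[OF X] by (auto simp: face_def scomp_apply)
  then show ?thesis using X by (auto simp: antipodal_face_def cov_def face_def)
qed

lemma face_restrict_eq: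
  assumes "ag_system E T" "t \<in> face T X" "F = {e \<in> E. X e = Zer}"
  shows "X \<odot> restrict_vec F t = t"
proof
  fix h
  have "t h = Zer \<longleftrightarrow> h \<notin> E" using assms ag_Zer_iff faceD(1) by metis
  then show "(X \<odot> restrict_vec F t) h = t h"
    using faceD(2)[OF assms(2), of h] assms(3) by (auto simp: scomp_apply restrict_vec_apply)
qed

text \<open>Faces of a face are faces: on the system that the zeros of \<open>X\<close> carry, the
  vector \<open>Z\<close> cuts out what \<open>X \<odot> Z\<close> cuts out of \<open>T\<close>, and
  the two antipodal maps agree.\<close>

lemma antipodal_face_scomp:
  assumes T: "ag_system E T" and F: "F = {e \<in> E. X e = Zer}"
    and Z: "antipodal_face (restrict_vec F ` face T X) Z"
  shows "antipodal_face T (X \<odot> Z)"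
proof -
  let ?r = "restrict_vec F"
  let ?T1 = "?r ` face T X"
  obtain t where t: "t \<in> face T X" "?r t \<in> face ?T1 Z"
  proof -
    obtain t' where "t' \<in> face ?T1 Z" using Z by (auto simp: antipodal_face_def)
    moreover from this obtain t where "t \<in> face T X" "t' = ?r t" using faceD(1) by blast
    ultimately show ?thesis using that by blast
  qed
  have Z0: "e \<in> F" if "Z e \<noteq> Zer" for e
    using faceD(2)[OF t(2) that] that by (auto simp: restrict_vec_apply split: if_splits)
  show ?thesis
    unfolding antipodal_face_def
  proof (intro conjI ballI)
    have "t \<in> face T (X \<odot> Z)"
      using t Z0 by (auto simp: face_def scomp_apply restrict_vec_apply split: if_splits)
    then show "face T (X \<odot> Z) \<noteq> {}" by blast
  next
    fix u assume u: "u \<in> face T (X \<odot> Z)"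
    then have uX: "u \<in> face T X" by (auto simp: face_def scomp_apply split: if_splits)
    have "?r u \<in> face ?T1 Z"
    proof (rule faceI)
      fix e assume e: "Z e \<noteq> Zer"
      then have "X e = Zer" using Z0 F by blast
      then show "?r u e = Z e" using faceD(2)[OF u, of e] e Z0 by (simp add: scomp_apply restrict_vec_apply)
    qed (use uX in blast)
    then have "Z \<odot> \<ominus> (?r u) \<in> ?T1" using Z by (auto simp: antipodal_face_def)
    then obtain s where s: "s \<in> face T X" "Z \<odot> \<ominus> (?r u) = ?r s" by blast
    have "s = X \<odot> (Z \<odot> \<ominus> (?r u))" using face_restrict_eq[OF T s(1) F] s(2) by simp
    also have "\<dots> = X \<odot> Z \<odot> \<ominus> (X \<odot> ?r u)" by (auto simp: fun_eq_iff scomp_apply)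
    also have "\<dots> = X \<odot> Z \<odot> \<ominus> u" using face_restrict_eq[OF T uX F] by simp
    finally have "s = (X \<odot> Z) \<odot> \<ominus> u" by (auto simp: fun_eq_iff scomp_apply)
    then show "(X \<odot> Z) \<odot> \<ominus> u \<in> T" using s faceD(1) by metis
  qed
qed

text \<open>Covectors above \<open>X\<close> restrict to covectors of the face
  (\<open>restr\<close>). Those needed are available: an antipodal \<open>Z\<close> comes from the
  covector \<open>X \<odot> Z\<close>, and a covector that keeps the common values of two members of
  the face is automatically above \<open>X\<close>.\<close>

lemma ag_system_face:
  assumes T: "ag_system E T" and F: "F = {e \<in> E. X e = Zer}" and ne: "face T X \<noteq> {}"
  shows "ag_system F (restrict_vec F ` face T X)"
proof -
  let ?r = "restrict_vec F"
  let ?T1 = "?r ` face T X"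
  have restr: "?r Z \<in> cov ?T1" if Z: "Z \<in> cov T" "\<And>h. X h \<noteq> Zer \<Longrightarrow> Z h = X h" for Z
  proof (unfold cov_def, safe)
    fix t assume t: "t \<in> face T X"
    then have "Z \<odot> \<ominus> t \<in> T" using Z covD faceD(1) by metis
    then have "Z \<odot> \<ominus> t \<in> face T X" using Z(2) by (auto simp: face_def scomp_apply)
    then show "?r Z \<odot> \<ominus> ?r t \<in> ?T1" by (metis image_eqI restrict_vec_neg restrict_vec_scomp)
  qed
  show ?thesis
    unfolding ag_system_def
  proof (intro conjI allI impI ballI)
    show "finite F" using ag_finite[OF T] F by simp
    show "?T1 \<noteq> {}" using ne by simp
    show "?T1 \<subseteq> full F"
      using ag_full[OF T] F by (auto simp: full_def restrict_vec_apply face_def)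
  next
    fix Z assume Z: "antipodal_face ?T1 Z"
    have XZ: "X \<odot> Z \<in> cov T" using antipodal_face_scomp[OF T F Z] ag_antipodal_cov[OF T] by blast
    have "Z e = Zer" if "e \<notin> F" for e
    proof -
      obtain t where "t \<in> face ?T1 Z" using Z by (auto simp: antipodal_face_def)
      moreover from this obtain s where "t = ?r s" using faceD(1) by blast
      ultimately show ?thesis using faceD(2) that by (metis restrict_vec_apply)
    qed
    then have "?r (X \<odot> Z) = Z"
      using F by (auto simp: fun_eq_iff scomp_apply restrict_vec_apply)
    then show "Z \<in> cov ?T1" using restr[OF XZ] by (metis scomp_apply)
  next
    fix x y e assume "x \<in> ?T1" "y \<in> ?T1" and e: "x e \<noteq> y e"
    then obtain x' y' where x': "x' \<in> face T X" "x = ?r x'" and y': "y' \<in> face T X" "y = ?r y'" by blast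
    have "x' e \<noteq> y' e" using e x' y' by (auto simp: restrict_vec_apply split: if_splits)
    then obtain Z where Z: "Z \<in> cov T" "Z e = Zer" "\<And>h. x' h = y' h \<Longrightarrow> Z h = x' h"
      using ag_eliminate[OF T, of x' y' e] x' y' faceD(1) by metis
    have "?r Z \<in> cov ?T1" using restr[OF Z(1)] Z(3) x' y' faceD(2) by metis
    moreover have "?r Z e = Zer" using Z by (simp add: restrict_vec_apply)
    moreover have "?r Z h = x h" if "x h = y h" for h
      using that Z x' y' by (auto simp: restrict_vec_apply split: if_splits)
    ultimately show "\<exists>X\<in>cov ?T1. X e = Zer \<and> (\<forall>h. x h = y h \<longrightarrow> X h = x h)" by blast
  qed
qed

text \<open>Restricted to \<open>A\<close>, the topes of the face are closed under negation, so the
  zero vector is an antipodal face of a COM and hence one of its covectors. A preimage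
  \<open>Y\<close> of it is a covector of the face, and \<open>X \<odot> Y\<close> is the wanted
  covector of \<open>T\<close>. Both the lifting through deletions and the proof of (SE) use
  this.\<close>

lemma cov_lift:
  assumes T: "ag_system E T" and F: "F = {e \<in> E. X e = Zer}" and ne: "face T X \<noteq> {}"
    and com: "com F (cov (restrict_vec F ` face T X))" and AF: "A \<subseteq> F"
    and sym: "\<And>t. t \<in> face T X \<Longrightarrow> \<exists>s\<in>face T X. \<forall>h\<in>A. s h = sneg (t h)"
  obtains Z where "Z \<in> cov T" "\<And>h. X h \<noteq> Zer \<Longrightarrow> Z h = X h" "\<And>h. h \<in> A \<Longrightarrow> Z h = Zer"
proof -
  let ?r = "restrict_vec F" and ?a = "restrict_vec A" and ?O = "\<lambda>_. Zer"
  let ?T1 = "?r ` face T X"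
  note T1 = ag_system_face[OF T F ne]
  have comA: "com A (?a ` cov ?T1)" by (rule com_restrict[OF com AF])
  have ar: "?a (?r t) = ?a t" for t using AF by (auto simp: fun_eq_iff restrict_vec_apply)
  \<comment> \<open>A covector that is nonzero on all of \<open>A\<close> can be completed by any
    tope of the face without changing it on \<open>A\<close>.\<close>
  have topes: "?a ` cov ?T1 \<inter> full A = ?a ` face T X"
  proof (intro equalityI subsetI)
    fix Y assume Y: "Y \<in> ?a ` cov ?T1 \<inter> full A"
    then obtain Y' where Y': "Y' \<in> cov ?T1" "Y = ?a Y'" by blast
    obtain t where t: "t \<in> face T X" using ne by blast
    then have "Y' \<odot> ?r t \<in> ?T1" using cov_scomp_tope[OF Y'(1)] by blast
    moreover have "?a (Y' \<odot> ?r t) = Y"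
      using Y Y'(2) by (auto simp: full_def fun_eq_iff restrict_vec_apply scomp_apply)
    ultimately show "Y \<in> ?a ` face T X" using ar by force
  next
    fix Y assume "Y \<in> ?a ` face T X"
    then obtain t where t: "t \<in> face T X" "Y = ?a t" by blast
    have "?r t \<in> cov ?T1" using cov_Int_full[OF ag_nonempty[OF T1] ag_full[OF T1]] t by blast
    moreover have "Y \<in> full A"
      using t ag_Zer_iff[OF T faceD(1)] AF F by (auto simp: full_def restrict_vec_apply)
    ultimately show "Y \<in> ?a ` cov ?T1 \<inter> full A" using t ar by (metis IntI image_eqI)
  qed
  have "antipodal_face (?a ` cov ?T1 \<inter> full A) ?O"
    unfolding topes antipodal_face_def
  proof (intro conjI ballI)
    show "face (?a ` face T X) ?O \<noteq> {}" using ne by (auto simp: face_def)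
    fix t assume "t \<in> face (?a ` face T X) ?O"
    then obtain t' where t': "t' \<in> face T X" "t = ?a t'" by (auto simp: face_def)
    then obtain s where s: "s \<in> face T X" "\<And>h. h \<in> A \<Longrightarrow> s h = sneg (t' h)" using sym by blast
    have "?O \<odot> \<ominus> t = ?a s" using s t' by (auto simp: fun_eq_iff scomp_apply restrict_vec_apply)
    then show "?O \<odot> \<ominus> t \<in> ?a ` face T X" using s by blast
  qed
  then have "?O \<in> ?a ` cov ?T1" by (rule antipodal_face_mem_com[OF comA])
  then obtain Y where Y: "Y \<in> cov ?T1" "?a Y = ?O" by (metis imageE)
  have "antipodal_face T (X \<odot> Y)"
    using antipodal_face_scomp[OF T F] cov_antipodal_face[OF Y(1)] ne by blast
  then have c: "X \<odot> Y \<in> cov T" using ag_antipodal_cov[OF T] by blast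
  have "(X \<odot> Y) h = Zer" if "h \<in> A" for h
    using that Y(2) AF F by (auto simp: fun_eq_iff scomp_apply restrict_vec_apply split: if_splits)
  then show ?thesis using that[OF c] by (simp add: scomp_apply)
qed

section \<open>Deletion of a coordinate\<close>

definition del :: "'e \<Rightarrow> ('e \<Rightarrow> sign) set \<Rightarrow> ('e \<Rightarrow> sign) set" where
  "del g T = (\<lambda>t. t(g := Zer)) ` T"

lemma cov_del: "X \<in> cov T \<Longrightarrow> X(g := Zer) \<in> cov (del g T)"
proof (unfold cov_def del_def, safe)
  fix t assume "\<forall>t\<in>T. X \<odot> \<ominus> t \<in> T" "t \<in> T"
  moreover have "X(g := Zer) \<odot> \<ominus> t(g := Zer) = (X \<odot> \<ominus> t)(g := Zer)"
    by (auto simp: fun_eq_iff scomp_apply)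
  ultimately show "X(g := Zer) \<odot> \<ominus> t(g := Zer) \<in> (\<lambda>t. t(g := Zer)) ` T" by auto
qed

text \<open>An antipodal face \<open>X\<close> of the deletion is symmetric in its free coordinates
  other than \<open>g\<close>. If \<open>X\<close> is nonzero, the face above it has fewer
  coordinates, so it is a COM by \<open>IH\<close>, and \<open>cov_lift\<close> with
  \<open>A = F - {g}\<close> yields a covector that becomes \<open>X\<close> once \<open>g\<close>
  is erased.\<close>

lemma ag_system_del:
  fixes E :: "'e set"
  assumes T: "ag_system E T"
    and IH: "\<And>(F :: 'e set) U. card F < card E \<Longrightarrow> ag_system F U \<Longrightarrow> com F (cov U)"
  shows "ag_system (E - {g}) (del g T)"
  unfolding ag_system_def
proof (intro conjI allI impI ballI)
  show "finite (E - {g})" using ag_finite[OF T] by simp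
  show "del g T \<noteq> {}" using ag_nonempty[OF T] by (simp add: del_def)
  show dfull: "del g T \<subseteq> full (E - {g})" using ag_full[OF T] by (fastforce simp: del_def full_def)
next
  fix X assume X: "antipodal_face (del g T) X"
  have Xg: "X g = Zer"
    using X by (auto simp: antipodal_face_def face_def del_def)
  show "X \<in> cov (del g T)"
  proof (cases "\<exists>e. X e \<noteq> Zer")
    \<comment> \<open>The face of the zero vector is the whole system, which \<open>IH\<close> does
      not reach; but for it being antipodal and being a covector are the same.\<close>
    case False
    then have "face (del g T) X = del g T" by (auto simp: face_def)
    then show ?thesis using X by (auto simp: antipodal_face_def cov_def)
  next
    case True
    then obtain e where e: "X e \<noteq> Zer" by blast
    define F where "F = {e \<in> E. X e = Zer}"
    obtain t0 where t0: "t0 \<in> T" "t0(g := Zer) \<in> face (del g T) X"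
      using X by (auto simp: antipodal_face_def face_def del_def)
    have up: "t \<in> face T X \<longleftrightarrow> t \<in> T \<and> t(g := Zer) \<in> face (del g T) X" for t
      using Xg by (auto simp: face_def del_def)
    have ne: "face T X \<noteq> {}" using t0 up by blast
    have "t0 e \<noteq> Zer" using t0(2) e by (auto simp: face_def split: if_splits)
    then have "e \<in> E" using ag_Zer_iff[OF T t0(1)] by blast
    then have "card F < card E"
      using e ag_finite[OF T] by (intro psubset_card_mono) (auto simp: F_def)
    then have com: "com F (cov (restrict_vec F ` face T X))"
      using IH ag_system_face[OF T F_def ne] by blast
    have sym: "\<exists>s\<in>face T X. \<forall>h\<in>F - {g}. s h = sneg (t h)" if t: "t \<in> face T X" for t
    proof -
      have "X \<odot> \<ominus> t(g := Zer) \<in> del g T" using t up X by (auto simp: antipodal_face_def)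
      then obtain s where s: "s \<in> T" "X \<odot> \<ominus> t(g := Zer) = s(g := Zer)" by (auto simp: del_def)
      have sh: "h \<noteq> g \<Longrightarrow> s h = (if X h \<noteq> Zer then X h else sneg (t h))" for h
        using fun_cong[OF s(2), of h] by (simp add: scomp_apply split: if_splits)
      have "s \<in> face T X" using s(1) sh Xg by (intro faceI) (metis, metis)
      then show ?thesis using sh by (intro bexI[of _ s]) (auto simp: F_def)
    qed
    obtain Z where Z: "Z \<in> cov T" "\<And>h. X h \<noteq> Zer \<Longrightarrow> Z h = X h" "\<And>h. h \<in> F - {g} \<Longrightarrow> Z h = Zer"
      using cov_lift[OF T F_def ne com _ sym] by blast
    have "Z h = Zer" if "h \<notin> E" for h
      using cov_signvecs[OF ag_nonempty[OF T] ag_full[OF T]] Z(1) that by (auto simp: signvecs_def)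
    then have "Z(g := Zer) = X" using Z(2,3) Xg by (force simp: fun_eq_iff F_def)
    then show ?thesis using cov_del[OF Z(1), of g] by simp
  qed
next
  fix x y e assume "x \<in> del g T" "y \<in> del g T" and e: "x e \<noteq> y e"
  then obtain x' y' where x': "x' \<in> T" "x = x'(g := Zer)" and y': "y' \<in> T" "y = y'(g := Zer)"
    by (auto simp: del_def)
  have "x' e \<noteq> y' e" "e \<noteq> g" using e x' y' by (auto split: if_splits)
  then obtain Z where Z: "Z \<in> cov T" "Z e = Zer" "\<And>h. x' h = y' h \<Longrightarrow> Z h = x' h"
    using ag_eliminate[OF T x'(1) y'(1)] by metis
  then show "\<exists>X\<in>cov (del g T). X e = Zer \<and> (\<forall>h. x h = y h \<longrightarrow> X h = x h)"
    using cov_del[OF Z(1), of g] x' y' by (intro bexI[of _ "Z(g := Zer)"]) auto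
qed

section \<open>Zones\<close>

text \<open>The points are the edges of \<open>T\<close> in direction \<open>e\<close>; for a COM
  these are the topes of the system of covectors that vanish at \<open>e\<close>.\<close>

definition zone :: "'e \<Rightarrow> ('e \<Rightarrow> sign) set \<Rightarrow> ('e \<Rightarrow> sign) set" where
  "zone e T = {z. z e = Zer \<and> z(e := Pos) \<in> T \<and> z(e := Neg) \<in> T}"

lemma zoneD: "z \<in> zone e T \<Longrightarrow> s \<noteq> Zer \<Longrightarrow> z(e := s) \<in> T" "z \<in> zone e T \<Longrightarrow> z e = Zer"
  by (cases s; simp add: zone_def)+

lemma zoneI: "t \<in> T \<Longrightarrow> t e \<noteq> Zer \<Longrightarrow> t(e := sneg (t e)) \<in> T \<Longrightarrow> t(e := Zer) \<in> zone e T"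
  by (cases "t e") (auto simp: zone_def fun_upd_idem)

lemma zoneI': "z e = Zer \<Longrightarrow> (\<And>s. s \<noteq> Zer \<Longrightarrow> z(e := s) \<in> T) \<Longrightarrow> z \<in> zone e T"
  by (auto simp: zone_def)

lemma zone_Zer_iff:
  assumes "ag_system E T" "z \<in> zone e T"
  shows "z h = Zer \<longleftrightarrow> h \<notin> E - {e}"
  using ag_Zer_iff[OF assms(1) zoneD(1)[OF assms(2), of Pos], of h] zoneD(2)[OF assms(2)]
  by (auto split: if_splits)

lemma zone_in_E:
  assumes "ag_system E T" "z \<in> zone e T"
  shows "e \<in> E"
  using ag_Zer_iff[OF assms(1) zoneD(1)[OF assms(2), of Pos], of e] by auto

lemma cov_scomp_zone:
  assumes X: "X \<in> cov T" "X e = Zer" and z: "z \<in> zone e T"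
  shows "X \<odot> z \<in> zone e T" "X \<odot> \<ominus> z \<in> zone e T"
proof -
  show "X \<odot> z \<in> zone e T"
  proof (rule zoneI')
    fix s assume "s \<noteq> Zer"
    then have "X \<odot> z(e := s) \<in> T" using cov_scomp_tope[OF X(1)] zoneD(1)[OF z] by blast
    moreover have "(X \<odot> z)(e := s) = X \<odot> z(e := s)" using X(2) by (auto simp: fun_eq_iff scomp_apply)
    ultimately show "(X \<odot> z)(e := s) \<in> T" by simp
  qed (simp add: scomp_apply X(2) zoneD(2)[OF z])
  show "X \<odot> \<ominus> z \<in> zone e T"
  proof (rule zoneI')
    fix s assume "s \<noteq> Zer"
    then have "X \<odot> \<ominus> z(e := sneg s) \<in> T" using covD[OF X(1)] zoneD(1)[OF z] by auto
    moreover have "(X \<odot> \<ominus> z)(e := s) = X \<odot> \<ominus> z(e := sneg s)"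
      using X(2) by (auto simp: fun_eq_iff scomp_apply)
    ultimately show "(X \<odot> \<ominus> z)(e := s) \<in> T" by simp
  qed (simp add: scomp_apply X(2) zoneD(2)[OF z])
qed

text \<open>The two lifts of the ends of an edge of the deletion may disagree at \<open>g\<close>.
  Eliminating \<open>e\<close> between them gives a covector with the right values elsewhere, and
  composing it with any point of the zone settles the value at \<open>g\<close>.\<close>

lemma zone_del:
  assumes T: "ag_system E T" and ne: "zone e T \<noteq> {}" and ge: "g \<noteq> e"
  shows "zone e (del g T) = del g (zone e T)"
proof (intro equalityI subsetI)
  fix w assume w: "w \<in> zone e (del g T)"
  obtain x where x: "x \<in> T" "w(e := Pos) = x(g := Zer)"
    using zoneD(1)[OF w, of Pos] by (auto simp: del_def)
  obtain y where y: "y \<in> T" "w(e := Neg) = y(g := Zer)"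
    using zoneD(1)[OF w, of Neg] by (auto simp: del_def)
  have xe: "x e = Pos" "y e = Neg"
    using fun_cong[OF x(2), of e] fun_cong[OF y(2), of e] ge by auto
  have xh: "x h = w h" "y h = w h" if "h \<noteq> e" "h \<noteq> g" for h
    using fun_cong[OF x(2), of h] fun_cong[OF y(2), of h] that by auto
  have wg: "w g = Zer" using fun_cong[OF x(2), of g] ge by auto
  obtain X where X: "X \<in> cov T" "X e = Zer" "\<And>h. x h = y h \<Longrightarrow> X h = x h"
    using ag_eliminate[OF T x(1) y(1), of e] xe by auto
  obtain z where z: "z \<in> zone e T" using ne by blast
  have "(X \<odot> z)(g := Zer) = w"
  proof
    fix h
    consider "h = g" | "h = e" "h \<noteq> g" | "h \<noteq> g" "h \<noteq> e" by blast
    then show "((X \<odot> z)(g := Zer)) h = w h"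
    proof cases
      case 3
      then have "X h = w h" "w h = Zer \<longleftrightarrow> h \<notin> E"
        using X(3)[of h] xh[of h] ag_Zer_iff[OF T x(1), of h] by auto
      then show ?thesis using 3 zone_Zer_iff[OF T z, of h] by (cases "h \<in> E") (simp_all add: scomp_apply)
    qed (use wg X(2) zoneD(2)[OF z] zoneD(2)[OF w] in \<open>simp_all add: scomp_apply\<close>)
  qed
  then show "w \<in> del g (zone e T)"
    using cov_scomp_zone(1)[OF X(1,2) z] unfolding del_def by blast
next
  fix w assume "w \<in> del g (zone e T)"
  then obtain z where z: "z \<in> zone e T" "w = z(g := Zer)" by (auto simp: del_def)
  show "w \<in> zone e (del g T)"
  proof (rule zoneI')
    fix s assume "s \<noteq> Zer"
    then have "z(e := s) \<in> T" using zoneD(1)[OF z(1)] by blast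
    moreover have "w(e := s) = (z(e := s))(g := Zer)" using z(2) ge by (simp add: fun_upd_twist)
    ultimately show "w(e := s) \<in> del g T" by (simp add: del_def)
  qed (use z zoneD(2)[OF z(1)] ge in simp)
qed

text \<open>If \<open>x \<in> T\<close> but \<open>\<ominus> x \<notin> T\<close>, the induction hypothesis for the deletions shows that every neighbour
  of \<open>\<ominus> x\<close> in a direction \<open>g \<noteq> e\<close> is in \<open>T\<close>. Flipping \<open>\<ominus> x\<close> on larger and larger sets \<open>K\<close> stays in
  \<open>T\<close>: otherwise the face spanned by \<open>K\<close> misses exactly two antipodal vertices, hence is gated, and the
  gate of \<open>x\<close> is one of them. With \<open>K = E - {e}\<close> this puts \<open>x\<close> into the zone.\<close>

lemma zone_symmetric_imp_symmetric:
  fixes E :: "'e set"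
  assumes IH: "\<And>(F :: 'e set) U. card F < n \<Longrightarrow> ag_system F U \<Longrightarrow> com F (cov U)"
  shows "ag_system E T \<Longrightarrow> card E \<le> n \<Longrightarrow> zone e T \<noteq> {} \<Longrightarrow>
    (\<And>z. z \<in> zone e T \<Longrightarrow> \<ominus> z \<in> zone e T) \<Longrightarrow> x \<in> T \<Longrightarrow> \<ominus> x \<in> T"
proof (induction "card E" arbitrary: E T x rule: less_induct)
  case less
  note T = less.prems(1) and sym = less.prems(4) and x = less.prems(5)
  obtain z where z: "z \<in> zone e T" using less.prems(3) by blast
  have eE: "e \<in> E" by (rule zone_in_E[OF T z])
  have finE: "finite E" by (rule ag_finite[OF T])
  have x0: "t h = Zer \<longleftrightarrow> h \<notin> E" if "t \<in> T" for t h using ag_Zer_iff[OF T that] .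
  show ?case
  proof (rule ccontr)
    assume nx: "\<ominus> x \<notin> T"
    define m where "m K = (\<lambda>h. if h \<in> K then x h else sneg (x h))" for K
    have m_single: "m {g} \<in> T" if g: "g \<in> E - {e}" for g
    proof -
      have cg: "card (E - {g}) < card E" using g finE by (intro card_Diff1_less) auto
      \<comment> \<open>The bound \<open>n\<close> stays fixed while the inner induction removes
        coordinates, so \<open>IH\<close> still covers every system with fewer coordinates than the
        current one.\<close>
      have ag: "ag_system (E - {g}) (del g T)"
        using IH less.prems(2) by (intro ag_system_del[OF T]) auto
      have zd: "zone e (del g T) = del g (zone e T)" using zone_del[OF T less.prems(3)] g by blast
      have zs: "\<ominus> w \<in> zone e (del g T)" if "w \<in> zone e (del g T)" for w
      proof -
        obtain v where v: "v \<in> zone e T" "w = v(g := Zer)" using \<open>w \<in> _\<close> zd by (auto simp: del_def)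
        then have "\<ominus> w = (\<ominus> v)(g := Zer)" by (auto simp: fun_eq_iff)
        then show ?thesis using sym[OF v(1)] zd by (simp add: del_def)
      qed
      have "\<ominus> x(g := Zer) \<in> del g T"
        using less.hyps[OF cg ag _ _ zs] cg less.prems(2,3) zd x by (simp add: del_def)
      then obtain s where s: "s \<in> T" "\<ominus> x(g := Zer) = s(g := Zer)" by (auto simp: del_def)
      have sh: "h \<noteq> g \<Longrightarrow> s h = sneg (x h)" for h using fun_cong[OF s(2), of h] by simp
      have "s g \<noteq> sneg (x g)"
      proof
        assume "s g = sneg (x g)"
        then have "s = \<ominus> x" using sh by (metis ext sneg_vec_apply)
        then show False using s nx by simp
      qed
      then have "s g = x g" using x0[OF s(1), of g] x0[OF x, of g] g sign_neq_iff[of "s g" "x g"] by blast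
      then have "s = m {g}" using sh by (auto simp: m_def fun_eq_iff)
      then show ?thesis using s by simp
    qed
    have mK: "m K \<in> T" if "finite K" "K \<subseteq> E - {e}" "K \<noteq> {}" for K
      using that
    proof (induction K rule: finite_psubset_induct)
      case (psubset K)
      show ?case
      proof (rule ccontr)
        assume nK: "m K \<notin> T"
        define X where "X = (\<lambda>h. if h \<in> K then Zer else sneg (x h))"
        obtain k where k: "k \<in> K" using psubset.prems(2) by blast
        have "antipodal_face T X"
          unfolding antipodal_face_def
        proof (intro conjI ballI)
          have "m {k} \<in> face T X"
            by (rule faceI[OF m_single]) (use k psubset.prems in \<open>auto simp: m_def X_def\<close>)
          then show "face T X \<noteq> {}" by blast
        next
          fix u assume u: "u \<in> face T X"
          then have uT: "u \<in> T" by (rule faceD)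
          define J where "J = {h \<in> K. u h = x h}"
          have uJ: "u h = m J h" for h
          proof (cases "h \<in> K")
            case True
            then have "u h = x h \<or> u h = sneg (x h)"
              using x0[OF x, of h] x0[OF uT, of h] sign_neq_iff[of "u h" "x h"] psubset.prems True by blast
            then show ?thesis using True by (auto simp: m_def J_def)
          next
            case False
            then show ?thesis
              using faceD(2)[OF u, of h] x0[OF x, of h] x0[OF uT, of h]
              by (cases "h \<in> E") (auto simp: m_def J_def X_def)
          qed
          then have uJ': "u = m J" by blast
          \<comment> \<open>\<open>J = {}\<close> would give \<open>\<ominus> x\<close> and
            \<open>J = K\<close> would give \<open>m K\<close>: these are the two missing vertices
            of the face.\<close>
          have "J \<noteq> {}" using uJ' uT nx by (auto simp: m_def sneg_vec_def)
          moreover have "J \<noteq> K" using uJ' uT nK by blast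
          moreover have "J \<subseteq> K" by (auto simp: J_def)
          ultimately have "m (K - J) \<in> T" using psubset.prems by (intro psubset.IH) auto
          moreover have "X \<odot> \<ominus> u = m (K - J)"
            using x0[OF x] uJ' \<open>J \<subseteq> K\<close> by (auto simp: fun_eq_iff m_def X_def scomp_apply)
          ultimately show "X \<odot> \<ominus> u \<in> T" by simp
        qed
        then have "X \<odot> x \<in> T" using ag_antipodal_cov[OF T] cov_scomp_tope x by blast
        moreover have "X \<odot> x = m K" by (auto simp: fun_eq_iff m_def X_def scomp_apply)
        ultimately show False using nK by simp
      qed
    qed
    show False
    proof (cases "E - {e} = {}")
      case True
      have "(\<ominus> x) h = (z(e := sneg (x e))) h" for h
        using True zone_Zer_iff[OF T z, of h] x0[OF x, of h] by auto
      then have "\<ominus> x = z(e := sneg (x e))" by blast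
      then show False using nx zoneD(1)[OF z, of "sneg (x e)"] x0[OF x, of e] eE by simp
    next
      case False
      have "m (E - {e}) h = (x(e := sneg (x e))) h" for h
        using x0[OF x, of h] by (auto simp: m_def)
      then have "m (E - {e}) = x(e := sneg (x e))" by blast
      then have "x(e := Zer) \<in> zone e T"
        using mK[of "E - {e}"] finE False x0[OF x, of e] eE by (intro zoneI[OF x]) auto
      then have w: "\<ominus> x(e := Zer) \<in> zone e T" by (rule sym)
      have "(\<ominus> x(e := Zer))(e := sneg (x e)) = \<ominus> x" by (auto simp: fun_eq_iff)
      then show False using zoneD(1)[OF w, of "sneg (x e)"] x0[OF x, of e] eE nx by auto
    qed
  qed
qed

text \<open>Cut \<open>T\<close> down to the face of \<open>X\<close>. Antipodality of
  \<open>X\<close> in the zone says that the zone of this smaller system is closed under negation;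
  by \<open>zone_symmetric_imp_symmetric\<close> so is the system itself, that is, \<open>X\<close>
  is antipodal in \<open>T\<close>. As \<open>X\<close> may be zero, only
  \<open>card F \<le> card E\<close> is available.\<close>

lemma zone_antipodal_face_cov:
  fixes E :: "'e set"
  assumes IH: "\<And>(F :: 'e set) U. card F < card E \<Longrightarrow> ag_system F U \<Longrightarrow> com F (cov U)"
    and T: "ag_system E T" and X: "antipodal_face (zone e T) X"
  shows "X \<in> cov T" "X e = Zer"
proof -
  obtain z where z: "z \<in> face (zone e T) X" using X by (auto simp: antipodal_face_def)
  then have zz: "z \<in> zone e T" by (rule faceD)
  show Xe: "X e = Zer" using faceD(2)[OF z, of e] zoneD(2)[OF zz] by auto
  define F where "F = {h \<in> E. X h = Zer}"
  let ?r = "restrict_vec F"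
  let ?T1 = "?r ` face T X"
  have eF: "e \<in> F" using zone_in_E[OF T zz] Xe by (simp add: F_def)
  have up: "y(e := s) \<in> face T X" if "y \<in> face (zone e T) X" "s \<noteq> Zer" for y s
    using that zoneD(1)[of y e T s] Xe by (auto simp: face_def)
  have ne: "face T X \<noteq> {}" using up[OF z, of Pos] by blast
  note T1 = ag_system_face[OF T F_def ne]
  have cF: "card F \<le> card E" using ag_finite[OF T] by (auto intro: card_mono simp: F_def)
  have ru: "?r (y(e := s)) = (?r y)(e := s)" for y s
    using eF by (auto simp: fun_eq_iff restrict_vec_apply)
  have down: "?r y \<in> zone e ?T1" if "y \<in> face (zone e T) X" for y
  proof (rule zoneI')
    show "?r y e = Zer" using zoneD(2)[OF faceD(1)[OF that]] by (simp add: restrict_vec_apply)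
  qed (use up[OF that] ru in \<open>metis image_eqI\<close>)
  have zsym: "\<ominus> w \<in> zone e ?T1" if w: "w \<in> zone e ?T1" for w
  proof -
    have wF: "w h = Zer" if "h \<notin> F" for h
      using zone_Zer_iff[OF T1 w, of h] that by blast
    have "X \<odot> w \<in> zone e T"
    proof (rule zoneI')
      fix s assume "s \<noteq> Zer"
      then obtain t where t: "t \<in> face T X" "w(e := s) = ?r t" using zoneD(1)[OF w] by blast
      have "(X \<odot> w)(e := s) = X \<odot> w(e := s)" using Xe by (auto simp: fun_eq_iff scomp_apply)
      also have "\<dots> = X \<odot> ?r t" using t(2) by simp
      also have "\<dots> = t" by (rule face_restrict_eq[OF T t(1) F_def])
      finally show "(X \<odot> w)(e := s) \<in> T" using faceD(1)[OF t(1)] by simp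
    qed (use Xe zoneD(2)[OF w] in \<open>simp add: scomp_apply\<close>)
    then have "X \<odot> w \<in> face (zone e T) X" by (auto simp: face_def scomp_apply)
    then have "X \<odot> \<ominus> (X \<odot> w) \<in> zone e T" using X by (simp add: antipodal_face_def)
    then have "X \<odot> \<ominus> (X \<odot> w) \<in> face (zone e T) X" by (auto simp: face_def scomp_apply)
    then have "?r (X \<odot> \<ominus> (X \<odot> w)) \<in> zone e ?T1" by (rule down)
    moreover have "?r (X \<odot> \<ominus> (X \<odot> w)) = \<ominus> w"
      using wF by (auto simp: fun_eq_iff scomp_apply restrict_vec_apply F_def)
    ultimately show ?thesis by simp
  qed
  have "antipodal_face T X"
    unfolding antipodal_face_def
  proof (intro conjI ballI)
    fix t assume t: "t \<in> face T X"
    have "\<ominus> ?r t \<in> ?T1"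
      using zone_symmetric_imp_symmetric[OF IH T1 cF _ zsym] down[OF z] t by blast
    then obtain s where s: "s \<in> face T X" "\<ominus> ?r t = ?r s" by blast
    have "s = X \<odot> \<ominus> ?r t" using face_restrict_eq[OF T s(1) F_def] s(2) by simp
    also have "\<dots> = X \<odot> \<ominus> (X \<odot> ?r t)" by (auto simp: fun_eq_iff scomp_apply)
    also have "\<dots> = X \<odot> \<ominus> t" using face_restrict_eq[OF T t F_def] by simp
    finally show "X \<odot> \<ominus> t \<in> T" using faceD(1)[OF s(1)] by simp
  qed (rule ne)
  then show "X \<in> cov T" by (rule ag_antipodal_cov[OF T])
qed

lemma psubset_CollectI: "(\<And>h. P h \<Longrightarrow> Q h) \<Longrightarrow> Q k \<Longrightarrow> \<not> P k \<Longrightarrow> {h. P h} \<subset> {h. Q h}"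
  by blast

text \<open>For \<open>p\<close> and \<open>q\<close> in the face on different sides of \<open>e\<close>, the gap forces \<open>p\<close> and \<open>q\<close> to have no common
  deviation from \<open>x\<close> or no common deviation from \<open>y\<close>. So each \<open>q\<close> on the side of the antipode \<open>a\<close> of \<open>p\<close>
  lies between \<open>x\<close> and \<open>a\<close> or between \<open>a\<close> and \<open>y\<close>. If \<open>a\<close> is missing, a closest pair \<open>q1\<close>, \<open>q2\<close> of the
  two kinds spans a gated face, and the gate of \<open>p\<close> in it is neither \<open>q1\<close> nor \<open>q2\<close>.\<close>

lemma zone_gap_antipodal:
  assumes T: "ag_system E T" and x: "x \<in> zone e T" and y: "y \<in> zone e T"
    and gap: "\<And>z. z \<in> zone e T \<Longrightarrow> (\<And>h. x h = y h \<Longrightarrow> z h = x h) \<Longrightarrow> z = x \<or> z = y"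
    and X: "X = (\<lambda>h. if x h = y h then x h else Zer)"
  shows "antipodal_face T X"
proof -
  have eE: "e \<in> E" by (rule zone_in_E[OF T x])
  have X0: "X h = Zer \<longleftrightarrow> x h \<noteq> y h \<or> h \<notin> E - {e}" for h
    using zone_Zer_iff[OF T x, of h] by (auto simp: X)
  have Xe: "X e = Zer" using X0 by blast
  have D: "x h \<noteq> Zer" "y h \<noteq> Zer" "h \<in> E" "h \<noteq> e" if "x h \<noteq> y h" for h
    using that zone_Zer_iff[OF T x, of h] zone_Zer_iff[OF T y, of h] by auto
  have p0: "p h = Zer \<longleftrightarrow> h \<notin> E" if "p \<in> face T X" for p h
    using ag_Zer_iff[OF T faceD(1)[OF that]] .
  have two: "p h = x h \<or> p h = y h" if "p \<in> face T X" "x h \<noteq> y h" for p h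
    using D[OF that(2)] p0[OF that(1), of h] that(2)
      sign_neq_iff[of "p h" "x h"] sign_neq_iff[of "y h" "x h"] by auto
  have fixed: "p h = x h" if "p \<in> face T X" "x h = y h" "h \<noteq> e" for p h
    using that faceD(2)[OF that(1), of h] X0[of h] p0[OF that(1), of h] zone_Zer_iff[OF T x, of h]
    by (auto simp: X)
  have dich: "(\<forall>h. x h \<noteq> y h \<longrightarrow> p h = x h \<or> q h = x h) \<or> (\<forall>h. x h \<noteq> y h \<longrightarrow> p h = y h \<or> q h = y h)"
    if p: "p \<in> face T X" and q: "q \<in> face T X" and pq: "p e \<noteq> q e" for p q
  proof -
    \<comment> \<open>\<open>Z \<odot> x\<close> and \<open>Z \<odot> y\<close> are zone points
      between \<open>x\<close> and \<open>y\<close>, so each is \<open>x\<close> or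
      \<open>y\<close>. Hence on the coordinates where \<open>x\<close> and \<open>y\<close> differ,
      \<open>Z\<close> is zero throughout, or equals \<open>x\<close> throughout, or equals
      \<open>y\<close> throughout.\<close>
    obtain Z where Z: "Z \<in> cov T" "Z e = Zer" "\<And>h. p h = q h \<Longrightarrow> Z h = p h"
      using ag_eliminate[OF T faceD(1)[OF p] faceD(1)[OF q] pq] by blast
    have Zf: "Z h = x h" if "x h = y h" for h
      using that Z(2) Z(3)[of h] fixed[OF p that] fixed[OF q that] zoneD(2)[OF x]
      by (cases "h = e") auto
    have Zx: "Z \<odot> x = x \<or> Z \<odot> x = y"
      using gap[OF cov_scomp_zone(1)[OF Z(1,2) x]] Zf by (simp add: scomp_apply)
    have Zy: "Z \<odot> y = x \<or> Z \<odot> y = y"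
      using gap[OF cov_scomp_zone(1)[OF Z(1,2) y]] Zf by (simp add: scomp_apply)
    show ?thesis
    proof (cases "\<exists>h. x h \<noteq> y h \<and> Z h \<noteq> Zer")
      case False
      then have "p h \<noteq> q h" if "x h \<noteq> y h" for h
        using Z(3)[of h] that p0[OF p, of h] D(3)[OF that] by auto
      then show ?thesis using two[OF p] two[OF q] by metis
    next
      case True
      then obtain k where k: "x k \<noteq> y k" "Z k \<noteq> Zer" by blast
      then have "(Z \<odot> x) k = (Z \<odot> y) k" by (simp add: scomp_apply)
      then have eq: "Z \<odot> x = Z \<odot> y" using Zx Zy k by metis
      have nz: "Z h \<noteq> Zer" if "x h \<noteq> y h" for h
        using fun_cong[OF eq, of h] that by (auto simp: scomp_apply)
      from Zx show ?thesis
      proof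
        assume w: "Z \<odot> x = x"
        have "p h = x h \<or> q h = x h" if "x h \<noteq> y h" for h
          using two[OF p that] two[OF q that] Z(3)[of h] nz[OF that] fun_cong[OF w, of h]
          by (auto simp: scomp_apply)
        then show ?thesis by blast
      next
        assume w: "Z \<odot> x = y"
        have "p h = y h \<or> q h = y h" if "x h \<noteq> y h" for h
          using two[OF p that] two[OF q that] Z(3)[of h] nz[OF that] fun_cong[OF w, of h]
          by (auto simp: scomp_apply)
        then show ?thesis by blast
      qed
    qed
  qed
  show ?thesis
    unfolding antipodal_face_def
  proof (intro conjI ballI)
    have "x(e := Pos) \<in> face T X"
      using zoneD(1)[OF x, of Pos] Xe by (auto simp: face_def X)
    then show "face T X \<noteq> {}" by blast
  next
    fix p assume p: "p \<in> face T X"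
    define a where "a = X \<odot> \<ominus> p"
    have ae: "a e = sneg (p e)" "a e \<noteq> Zer" "p e \<noteq> a e"
      using Xe p0[OF p, of e] eE by (auto simp: a_def scomp_apply)
    have ax: "a h = x h \<longleftrightarrow> p h = y h" "a h = y h \<longleftrightarrow> p h = x h" if "x h \<noteq> y h" for h
      using that X0[of h] D[OF that] p0[OF p, of h] sign_neq_iff[of "p h" "x h"]
        sign_neq_iff[of "x h" "y h"] sign_neq_iff[of "p h" "y h"]
      by (auto simp: a_def scomp_apply)
    show "X \<odot> \<ominus> p \<in> T"
    proof (rule ccontr)
      assume "X \<odot> \<ominus> p \<notin> T"
      then have aT: "a \<notin> T" by (simp add: a_def)
      define R where "R = {q \<in> face T X. q e = a e}"
      define below where "below q \<longleftrightarrow> (\<forall>h. x h \<noteq> y h \<longrightarrow> a h = x h \<longrightarrow> q h = x h)" for q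
      define above where "above q \<longleftrightarrow> (\<forall>h. x h \<noteq> y h \<longrightarrow> a h = y h \<longrightarrow> q h = y h)" for q
      have R: "q \<in> face T X" "q \<in> T" "q e = a e" if "q \<in> R" for q
        using that by (auto simp: R_def face_def)
      have ab: "below q \<or> above q" if "q \<in> R" for q
        using dich[OF p R(1)[OF that]] ae(3) R(3)[OF that] ax unfolding below_def above_def by metis
      have eq_a: "q = a" if q: "q \<in> R" "\<And>h. x h \<noteq> y h \<Longrightarrow> q h = a h" for q
      proof
        fix h show "q h = a h"
        proof (cases "x h \<noteq> y h \<or> h = e")
          case True then show ?thesis using q R(3) by blast
        next
          case False
          then show ?thesis using fixed[OF R(1)[OF q(1)], of h] fixed[OF p, of h] X0[of h] zone_Zer_iff[OF T x, of h]
            by (auto simp: a_def scomp_apply X)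
        qed
      qed
      have qa: "\<exists>h. x h \<noteq> y h \<and> q h \<noteq> a h" if "q \<in> R" for q
        using eq_a[OF that] aT R(2)[OF that] by blast
      define P where "P qq \<longleftrightarrow> fst qq \<in> R \<and> snd qq \<in> R \<and> below (fst qq) \<and> above (snd qq)" for qq
      define d where "d qq = card {h. fst qq h \<noteq> snd qq h}" for qq :: "('a \<Rightarrow> sign) \<times> ('a \<Rightarrow> sign)"
      have xR: "x(e := a e) \<in> R" "y(e := a e) \<in> R"
        using zoneD(1)[OF x ae(2)] zoneD(1)[OF y ae(2)] Xe by (auto simp: R_def face_def X)
      have "P (x(e := a e), y(e := a e))"
        using xR D by (auto simp: P_def below_def above_def)
      then obtain qq where qq: "P qq" and min: "\<And>rr. P rr \<Longrightarrow> d qq \<le> d rr"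
        using ex_has_least_nat[of P _ d] by blast
      obtain q1 q2 where q12: "qq = (q1, q2)" by (cases qq)
      have q: "q1 \<in> R" "q2 \<in> R" "below q1" "above q2" using qq q12 by (auto simp: P_def)
      have fin: "finite {h. q1 h \<noteq> q2 h}"
      proof (rule finite_subset)
        show "{h. q1 h \<noteq> q2 h} \<subseteq> E" using p0[OF R(1)[OF q(1)]] p0[OF R(1)[OF q(2)]] by force
      qed (rule ag_finite[OF T])
      \<comment> \<open>Another vertex in between would be below or above by \<open>ab\<close>, and
        replacing \<open>q1\<close> or \<open>q2\<close> by it would give a closer pair.\<close>
      have btw: "r = q1 \<or> r = q2" if r: "r \<in> R" "\<And>h. q1 h = q2 h \<Longrightarrow> r h = q1 h" for r
      proof (rule ccontr)
        assume n: "\<not> (r = q1 \<or> r = q2)"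
        then obtain k l where kl: "r k \<noteq> q1 k" "r l \<noteq> q2 l" by (metis ext)
        have two': "r h = q1 h \<or> r h = q2 h" for h
        proof (cases "x h = y h")
          case True
          then show ?thesis
            using fixed[OF R(1)[OF r(1)], of h] fixed[OF R(1)[OF q(1)], of h] R(3)[OF r(1)] R(3)[OF q(1)]
            by (cases "h = e") auto
        next
          case False
          then show ?thesis
            using two[OF R(1)[OF r(1)] False] two[OF R(1)[OF q(1)] False] two[OF R(1)[OF q(2)] False] r(2)[of h]
            by auto
        qed
        from ab[OF r(1)] show False
        proof
          assume "below r"
          then have "P (r, q2)" using q r by (simp add: P_def)
          then have "d (q1, q2) \<le> d (r, q2)" using min q12 by blast
          moreover have "{h. r h \<noteq> q2 h} \<subset> {h. q1 h \<noteq> q2 h}"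
          proof (rule psubset_CollectI)
            show "q1 h \<noteq> q2 h" if "r h \<noteq> q2 h" for h using r(2)[of h] that by metis
            show "q1 k \<noteq> q2 k" "\<not> r k \<noteq> q2 k" using kl(1) two'[of k] r(2)[of k] by metis+
          qed
          then have "d (r, q2) < d (q1, q2)" using psubset_card_mono[OF fin] by (simp add: d_def)
          ultimately show False by simp
        next
          assume "above r"
          then have "P (q1, r)" using q r by (simp add: P_def)
          then have "d (q1, q2) \<le> d (q1, r)" using min q12 by blast
          moreover have "{h. q1 h \<noteq> r h} \<subset> {h. q1 h \<noteq> q2 h}"
          proof (rule psubset_CollectI)
            show "q1 h \<noteq> q2 h" if "q1 h \<noteq> r h" for h using r(2)[of h] that by metis
            show "q1 l \<noteq> q2 l" "\<not> q1 l \<noteq> r l" using kl(2) two'[of l] r(2)[of l] by metis+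
          qed
          then have "d (q1, r) < d (q1, q2)" using psubset_card_mono[OF fin] by (simp add: d_def)
          ultimately show False by simp
        qed
      qed
      \<comment> \<open>\<open>q1\<close> leaves \<open>a\<close> at \<open>k\<close>, where
        \<open>p\<close> sides with \<open>q1\<close> against \<open>q2\<close>; \<open>q2\<close>
        leaves \<open>a\<close> at \<open>l\<close>, where \<open>p\<close> sides with
        \<open>q2\<close> against \<open>q1\<close>. A covector that vanishes at both coordinates
        therefore sends \<open>p\<close> to neither.\<close>
      obtain k where k: "x k \<noteq> y k" "q1 k \<noteq> a k" using qa[OF q(1)] by blast
      obtain l where l: "x l \<noteq> y l" "q2 l \<noteq> a l" using qa[OF q(2)] by blast
      have ak: "a h = x h \<or> a h = y h" if "x h \<noteq> y h" for h
        using ax[OF that] two[OF p that] by blast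
      have k': "a k = y k" "q1 k = x k" "q2 k = y k" "p k = x k"
        using k q(3,4) ak[OF k(1)] two[OF R(1)[OF q(1)] k(1)] ax[OF k(1)] unfolding below_def above_def by auto
      have l': "a l = x l" "q2 l = y l" "q1 l = x l" "p l = y l"
        using l q(3,4) ak[OF l(1)] two[OF R(1)[OF q(2)] l(1)] ax[OF l(1)] unfolding below_def above_def by auto
      have kq: "q1 k \<noteq> q2 k" using k' k by simp
      obtain Z where Z: "Z \<in> cov T" "Z k = Zer" "\<And>h. q1 h = q2 h \<Longrightarrow> Z h = q1 h"
        using ag_eliminate[OF T R(2)[OF q(1)] R(2)[OF q(2)] kq] by blast
      have ZR: "Z \<odot> s \<in> R" if s: "s \<in> face T X" for s
      proof -
        have "(Z \<odot> s) h = X h" if "X h \<noteq> Zer" for h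
          using Z(3)[of h] faceD(2)[OF R(1)[OF q(1)] that] faceD(2)[OF R(1)[OF q(2)] that] that
          by (simp add: scomp_apply)
        then have "Z \<odot> s \<in> face T X"
          using cov_scomp_tope[OF Z(1) faceD(1)[OF s]] by (simp add: face_def)
        moreover have "(Z \<odot> s) e = a e"
          using Z(3)[of e] R(3)[OF q(1)] R(3)[OF q(2)] ae(2) by (simp add: scomp_apply)
        ultimately show ?thesis by (simp add: R_def)
      qed
      have Zb: "(Z \<odot> s) h = q1 h" if "s \<in> face T X" "q1 h = q2 h" for s h
        using Z(3)[OF that(2)] p0[OF that(1), of h] p0[OF R(1)[OF q(1)], of h]
        by (auto simp: scomp_apply)
      have Zs: "Z \<odot> s = q1 \<or> Z \<odot> s = q2" if "s \<in> face T X" for s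
        using btw[OF ZR[OF that]] Zb[OF that] by blast
      have Zk: "(Z \<odot> s) k = s k" for s using Z(2) by (simp add: scomp_apply)
      \<comment> \<open>Fixing both \<open>q1\<close> and \<open>q2\<close> forces \<open>Z\<close>
        to vanish wherever they differ, in particular at \<open>l\<close>.\<close>
      have "Z \<odot> q1 = q1" "Z \<odot> q2 = q2"
        using Zs[OF R(1)[OF q(1)]] Zs[OF R(1)[OF q(2)]] Zk kq by metis+
      then have "Z l = Zer"
        using l' l(1) by (metis scomp_apply)
      then have "(Z \<odot> p) l = p l" by (simp add: scomp_apply)
      then show False using Zs[OF p] Zk[of p] k' l' k(1) l(1) by metis
    qed
  qed
qed

text \<open>If the zone has a point strictly between \<open>x\<close> and \<open>y\<close>, one of
  the two shorter intervals still changes at \<open>f\<close>, and induction applies to it.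
  Otherwise \<open>zone_gap_antipodal\<close> makes the face spanned by \<open>x\<close> and
  \<open>y\<close> antipodal, hence a covector.\<close>

lemma zone_eliminate:
  assumes T: "ag_system E T"
  shows "x \<in> zone e T \<Longrightarrow> y \<in> zone e T \<Longrightarrow> x f \<noteq> y f \<Longrightarrow>
    \<exists>X\<in>cov T. X e = Zer \<and> X f = Zer \<and> (\<forall>h. x h = y h \<longrightarrow> X h = x h)"
proof (induction "card {h. x h \<noteq> y h}" arbitrary: x y rule: less_induct)
  case less
  note x = less.prems(1) and y = less.prems(2)
  have sub: "{h. u h \<noteq> v h} \<subseteq> E" if "u \<in> zone e T" "v \<in> zone e T" for u v
    using zone_Zer_iff[OF T that(1)] zone_Zer_iff[OF T that(2)] by force
  have fin: "finite {h. x h \<noteq> y h}" using sub[OF x y] ag_finite[OF T] finite_subset by blast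
  show ?case
  proof (cases "\<exists>z\<in>zone e T. z \<noteq> x \<and> z \<noteq> y \<and> (\<forall>h. x h = y h \<longrightarrow> z h = x h)")
    case False
    define X where "X = (\<lambda>h. if x h = y h then x h else Zer)"
    have "antipodal_face T X"
      using zone_gap_antipodal[OF T x y _ X_def] False less.prems(3) by blast
    then have "X \<in> cov T" by (rule ag_antipodal_cov[OF T])
    then show ?thesis using less.prems(3) zoneD(2)[OF x] zoneD(2)[OF y] by (intro bexI[of _ X]) (auto simp: X_def)
  next
    case True
    then obtain z where z: "z \<in> zone e T" "z \<noteq> x" "z \<noteq> y" "\<And>h. x h = y h \<Longrightarrow> z h = x h" by blast
    have two: "z h = x h \<or> z h = y h" for h
      using z(4)[of h] zone_Zer_iff[OF T z(1), of h] zone_Zer_iff[OF T x, of h] zone_Zer_iff[OF T y, of h]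
      by (cases "z h"; cases "x h"; cases "y h") auto
    obtain k l where kl: "z k \<noteq> x k" "z l \<noteq> y l" using z(2,3) by (metis ext)
    show ?thesis
    proof (cases "z f = x f")
      case False
      have "{h. x h \<noteq> z h} \<subset> {h. x h \<noteq> y h}"
      proof (rule psubset_CollectI)
        show "x h \<noteq> y h" if "x h \<noteq> z h" for h using z(4)[of h] that by metis
        show "x l \<noteq> y l" "\<not> x l \<noteq> z l" using kl(2) two[of l] z(4)[of l] by metis+
      qed
      then have "card {h. x h \<noteq> z h} < card {h. x h \<noteq> y h}" by (rule psubset_card_mono[OF fin])
      then obtain X where X: "X \<in> cov T" "X e = Zer" "X f = Zer" "\<And>h. x h = z h \<Longrightarrow> X h = x h"
        using less.hyps[OF _ x z(1)] False by metis
      then show ?thesis using z(4) by metis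
    next
      case True
      have "{h. z h \<noteq> y h} \<subset> {h. x h \<noteq> y h}"
      proof (rule psubset_CollectI)
        show "x h \<noteq> y h" if "z h \<noteq> y h" for h using z(4)[of h] that by metis
        show "x k \<noteq> y k" "\<not> z k \<noteq> y k" using kl(1) two[of k] z(4)[of k] by metis+
      qed
      then have "card {h. z h \<noteq> y h} < card {h. x h \<noteq> y h}" by (rule psubset_card_mono[OF fin])
      then obtain X where X: "X \<in> cov T" "X e = Zer" "X f = Zer" "\<And>h. z h = y h \<Longrightarrow> X h = z h"
        using less.hyps[OF _ z(1) y] True less.prems(3) by metis
      then show ?thesis using z(4) by metis
    qed
  qed
qed

text \<open>The inclusion is the gain: a covector found in the zone, a system with one coordinate
  less, is at once a covector of \<open>T\<close> that vanishes at \<open>e\<close>.\<close>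

lemma ag_system_zone:
  fixes E :: "'e set"
  assumes IH: "\<And>(F :: 'e set) U. card F < card E \<Longrightarrow> ag_system F U \<Longrightarrow> com F (cov U)"
    and T: "ag_system E T" and ne: "zone e T \<noteq> {}"
  shows "ag_system (E - {e}) (zone e T)" and "cov (zone e T) \<subseteq> {X \<in> cov T. X e = Zer}"
proof -
  have sub: "X \<in> cov (zone e T)" if "X \<in> cov T" "X e = Zer" for X
    using cov_scomp_zone(2)[OF that] by (simp add: cov_def)
  show "ag_system (E - {e}) (zone e T)"
    unfolding ag_system_def
  proof (intro conjI allI impI ballI)
    show "finite (E - {e})" using ag_finite[OF T] by simp
    show "zone e T \<subseteq> full (E - {e})" using zone_Zer_iff[OF T] by (fastforce simp: full_def)
    show "X \<in> cov (zone e T)" if "antipodal_face (zone e T) X" for X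
      using zone_antipodal_face_cov[OF IH T that] sub by blast
    show "\<exists>X\<in>cov (zone e T). X f = Zer \<and> (\<forall>h. x h = y h \<longrightarrow> X h = x h)"
      if "x \<in> zone e T" "y \<in> zone e T" "x f \<noteq> y f" for x y f
      using zone_eliminate[OF T that] sub by metis
  qed (rule ne)
  show "cov (zone e T) \<subseteq> {X \<in> cov T. X e = Zer}"
    using cov_antipodal_face[OF _ ne] zone_antipodal_face_cov[OF IH T] by blast
qed

text \<open>\<open>np\<close> says that no other coordinate is parallel to \<open>e\<close>. Take a
  covector that eliminates \<open>e\<close> between \<open>x\<close> and \<open>y\<close> and has
  fewest zeros. If it also vanished at some \<open>f\<close>, compose it with \<open>u\<close> and
  \<open>v\<close> from \<open>np\<close> and eliminate \<open>e\<close> once more: the result is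
  nonzero at \<open>f\<close> and keeps all nonzero entries. So \<open>e\<close> is its only zero,
  and it is a point of the zone.\<close>

lemma zone_between:
  assumes T: "ag_system E T"
    and np: "\<forall>f\<in>E - {e}. \<exists>u\<in>T. \<exists>v\<in>T. u e \<noteq> v e \<and> u f = v f"
    and x: "x \<in> T" and y: "y \<in> T" and xy: "x e \<noteq> y e"
  obtains z where "z \<in> zone e T" "\<And>h. x h = y h \<Longrightarrow> z h = x h"
proof -
  define P where "P Z \<longleftrightarrow> Z \<in> cov T \<and> Z e = Zer \<and> (\<forall>h. x h = y h \<longrightarrow> Z h = x h)" for Z
  define d where "d Z = card {h \<in> E. Z h = Zer}" for Z :: "'a \<Rightarrow> sign"
  obtain Z0 where "P Z0" using ag_eliminate[OF T x y xy] unfolding P_def by blast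
  then obtain Z where Z: "P Z" and min: "\<And>Y. P Y \<Longrightarrow> d Z \<le> d Y"
    using ex_has_least_nat[of P _ d] by blast
  have Zc: "Z \<in> cov T" and Ze: "Z e = Zer" and Zxy: "\<And>h. x h = y h \<Longrightarrow> Z h = x h"
    using Z by (auto simp: P_def)
  have nz: "Z f \<noteq> Zer" if f: "f \<in> E - {e}" for f
  proof
    assume Zf: "Z f = Zer"
    obtain u v where uv: "u \<in> T" "v \<in> T" "u e \<noteq> v e" "u f = v f" using np f by blast
    have uv': "Z \<odot> u \<in> T" "Z \<odot> v \<in> T" "(Z \<odot> u) e \<noteq> (Z \<odot> v) e"
      using uv cov_scomp_tope[OF Zc] Ze by (auto simp: scomp_apply)
    obtain Y where Y: "Y \<in> cov T" "Y e = Zer" "\<And>h. (Z \<odot> u) h = (Z \<odot> v) h \<Longrightarrow> Y h = (Z \<odot> u) h"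
      using ag_eliminate[OF T uv'] by blast
    have YZ: "Y h = Z h" if "Z h \<noteq> Zer" for h using Y(3)[of h] that by (simp add: scomp_apply)
    have Yf: "Y f \<noteq> Zer"
      using Y(3)[of f] uv(4) Zf f ag_Zer_iff[OF T uv(1), of f] ag_Zer_iff[OF T uv(2), of f]
      by (auto simp: scomp_apply)
    have "Y h = x h" if "x h = y h" for h
    proof (cases "x h = Zer")
      case True
      then have "h \<notin> E" using ag_Zer_iff[OF T x] by blast
      then show ?thesis using True Y(3)[of h] Zxy[OF that] ag_Zer_iff[OF T uv(1), of h] ag_Zer_iff[OF T uv(2), of h]
        by (simp add: scomp_apply)
    next
      case False then show ?thesis using YZ Zxy[OF that] by metis
    qed
    then have "P Y" using Y(1,2) by (simp add: P_def)
    moreover have "d Y < d Z"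
      unfolding d_def
    proof (rule psubset_card_mono)
      show "{h \<in> E. Y h = Zer} \<subset> {h \<in> E. Z h = Zer}"
      proof (rule psubset_CollectI)
        show "h \<in> E \<and> Z h = Zer" if "h \<in> E \<and> Y h = Zer" for h using that YZ by metis
        show "f \<in> E \<and> Z f = Zer" "\<not> (f \<in> E \<and> Y f = Zer)" using f Zf Yf by auto
      qed
    qed (use ag_finite[OF T] in simp)
    ultimately show False using min by fastforce
  qed
  have Zupd: "Z(e := t e) \<in> T" if "t \<in> T" for t
  proof -
    have "(Z \<odot> t) h = (Z(e := t e)) h" for h
      using nz[of h] Ze ag_Zer_iff[OF T that, of h] by (auto simp: scomp_apply)
    then have "Z \<odot> t = Z(e := t e)" by blast
    then show ?thesis using cov_scomp_tope[OF Zc that] by simp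
  qed
  have "x e \<noteq> Zer" "y e \<noteq> Zer" using ag_Zer_iff[OF T x, of e] ag_Zer_iff[OF T y, of e] xy by auto
  then have "s = x e \<or> s = y e" if "s \<noteq> Zer" for s
    using xy that by (cases s; cases "x e"; cases "y e") auto
  then have "Z \<in> zone e T" using Zupd[OF x] Zupd[OF y] Ze by (intro zoneI') auto
  then show ?thesis using that Zxy by blast
qed

text \<open>Since \<open>f\<close> flips whenever \<open>e\<close> does, \<open>X\<close> and
  \<open>Y\<close> are nonzero and opposite at \<open>f\<close>, so the eliminating covector may be
  zero there. Eliminate in the deletion of \<open>f\<close>; the result is a covector of
  \<open>T\<close> because the value of a tope at \<open>f\<close> is determined by its value at
  \<open>e\<close>.\<close>

lemma cov_eliminate_parallel:
  assumes T: "ag_system E T" and f: "f \<in> E - {e}" and com: "com (E - {f}) (cov (del f T))"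
    and par: "\<forall>u\<in>T. \<forall>v\<in>T. u e \<noteq> v e \<longrightarrow> u f \<noteq> v f"
    and X: "X \<in> cov T" and Y: "Y \<in> cov T" and e: "e \<in> sep X Y"
  obtains Z where "Z \<in> cov T" "Z e = Zer" "\<And>h. h \<in> E \<Longrightarrow> h \<notin> sep X Y \<Longrightarrow> Z h = (X \<odot> Y) h"
proof -
  have e': "X e \<noteq> Zer" "Y e \<noteq> Zer" "X e \<noteq> Y e" and ef: "e \<noteq> f" using e f by (auto simp: sep_iff)
  obtain t where t: "t \<in> T" using ag_nonempty[OF T] by blast
  note tz = ag_Zer_iff[OF T]
  have XT: "X \<odot> t \<in> T" "X \<odot> \<ominus> t \<in> T" "Y \<odot> t \<in> T" "Y \<odot> \<ominus> t \<in> T"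
    using cov_scomp_tope covD X Y t by blast+
  have ne: "u f \<noteq> v f" if "u \<in> {X \<odot> t, X \<odot> \<ominus> t}" "v \<in> {Y \<odot> t, Y \<odot> \<ominus> t}" for u v
  proof -
    have "u \<in> T" "v \<in> T" "u e \<noteq> v e" using XT that e' by (auto simp: scomp_apply)
    then show ?thesis using par by blast
  qed
  have tf: "t f \<noteq> Zer" using tz[OF t] f by blast
  have "X f \<noteq> Zer"
  proof
    assume "X f = Zer"
    then have "(Y \<odot> t) f \<noteq> t f" "(Y \<odot> t) f \<noteq> sneg (t f)"
      using ne[of "X \<odot> t" "Y \<odot> t"] ne[of "X \<odot> \<ominus> t" "Y \<odot> t"] by (auto simp: scomp_apply)
    then show False using tf tz[OF XT(3), of f] f sign_neq_iff by blast
  qed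
  moreover have "Y f \<noteq> Zer"
  proof
    assume "Y f = Zer"
    then have "(X \<odot> t) f \<noteq> t f" "(X \<odot> t) f \<noteq> sneg (t f)"
      using ne[of "X \<odot> t" "Y \<odot> t"] ne[of "X \<odot> t" "Y \<odot> \<ominus> t"] by (auto simp: scomp_apply)
    then show False using tf tz[OF XT(1), of f] f sign_neq_iff by blast
  qed
  ultimately have fsep: "f \<in> sep X Y" using ne[of "X \<odot> t" "Y \<odot> t"] by (auto simp: sep_iff scomp_apply)
  let ?X = "X(f := Zer)" and ?Y = "Y(f := Zer)"
  have "e \<in> sep ?X ?Y" using e' ef by (simp add: sep_iff)
  then obtain Z where Z: "Z \<in> cov (del f T)" "Z e = Zer"
    "\<And>h. h \<in> E - {f} \<Longrightarrow> h \<notin> sep ?X ?Y \<Longrightarrow> Z h = (?X \<odot> ?Y) h"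
    using com_elim[OF com cov_del[OF X] cov_del[OF Y]] by blast
  have "del f T \<noteq> {}" using ag_nonempty[OF T] by (simp add: del_def)
  moreover have "del f T \<subseteq> full (E - {f})" using ag_full[OF T] by (fastforce simp: del_def full_def)
  ultimately have "Z \<in> signvecs (E - {f})" using cov_signvecs Z(1) by blast
  then have Zf: "Z f = Zer" by (simp add: signvecs_def)
  have "Z \<odot> \<ominus> u \<in> T" if u: "u \<in> T" for u
  proof -
    have "Z \<odot> \<ominus> u(f := Zer) \<in> del f T" using covD[OF Z(1)] u by (simp add: del_def)
    then obtain v where v: "v \<in> T" "Z \<odot> \<ominus> u(f := Zer) = v(f := Zer)" by (auto simp: del_def)
    have vh: "v h = (Z \<odot> \<ominus> u) h" if "h \<noteq> f" for h
      using fun_cong[OF v(2), of h] that by (auto simp: scomp_apply split: if_splits)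
    have eE: "e \<in> E"
      using e'(1) X cov_signvecs[OF ag_nonempty[OF T] ag_full[OF T]] by (auto simp: signvecs_def)
    have "v e \<noteq> u e" using vh[OF ef] Z(2) tz[OF u, of e] eE by (simp add: scomp_apply)
    then have "v f \<noteq> u f" using par v(1) u by blast
    then have "v f = (Z \<odot> \<ominus> u) f"
      using Zf tz[OF u, of f] tz[OF v(1), of f] f sign_neq_iff by (auto simp: scomp_apply)
    then have "v = Z \<odot> \<ominus> u" using vh by (metis ext)
    then show ?thesis using v by simp
  qed
  then have "Z \<in> cov T" by (simp add: cov_def)
  moreover have "Z h = (X \<odot> Y) h" if "h \<in> E" "h \<notin> sep X Y" for h
  proof -
    have "h \<noteq> f" using that fsep by blast
    then show ?thesis using Z(3)[of h] that by (simp add: sep_iff scomp_apply)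
  qed
  ultimately show ?thesis using that Z(2) by blast
qed

text \<open>To eliminate \<open>e\<close> between \<open>X\<close> and \<open>Y\<close>, work in the zone of \<open>e\<close>, which is a COM by induction: the topes
  of the zone that agree with \<open>X \<odot> Y\<close> off \<open>sep X Y\<close> restrict to a symmetric set on the common zeros \<open>A\<close>
  of \<open>X\<close> and \<open>Y\<close>, so some covector of the zone vanishes on \<open>A\<close>. If \<open>e\<close> has a parallel element, the zone
  of \<open>e\<close> may be empty; then that element is deleted instead.\<close>

theorem ag_system_com:
  fixes E :: "'e set"
  shows "ag_system E T \<Longrightarrow> com E (cov T)"
proof (induction "card E" arbitrary: E T rule: less_induct)
  case less
  note T = less.prems
  have IH: "com F (cov U)" if "card F < card E" "ag_system F U" for F and U :: "('e \<Rightarrow> sign) set"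
    using less.hyps that by blast
  have finE: "finite E" by (rule ag_finite[OF T])
  have sv: "cov T \<subseteq> signvecs E" by (rule cov_signvecs[OF ag_nonempty[OF T] ag_full[OF T]])
  have elim: "\<exists>Z\<in>cov T. Z e = Zer \<and> (\<forall>h\<in>E - sep X Y. Z h = (X \<odot> Y) h)"
    if X: "X \<in> cov T" and Y: "Y \<in> cov T" and e: "e \<in> sep X Y" for X Y e
  proof (cases "\<exists>f\<in>E - {e}. \<forall>u\<in>T. \<forall>v\<in>T. u e \<noteq> v e \<longrightarrow> u f \<noteq> v f")
    case True
    then obtain f where f: "f \<in> E - {e}" "\<forall>u\<in>T. \<forall>v\<in>T. u e \<noteq> v e \<longrightarrow> u f \<noteq> v f" by blast
    have "card (E - {f}) < card E" using f finE by (intro card_Diff1_less) auto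
    then have c: "com (E - {f}) (cov (del f T))" using IH ag_system_del[OF T IH] by blast
    obtain Z where "Z \<in> cov T" "Z e = Zer" "\<And>h. h \<in> E \<Longrightarrow> h \<notin> sep X Y \<Longrightarrow> Z h = (X \<odot> Y) h"
      using cov_eliminate_parallel[OF T f(1) c f(2) X Y e] by blast
    then show ?thesis by blast
  next
    case False
    then have np: "\<forall>f\<in>E - {e}. \<exists>u\<in>T. \<exists>v\<in>T. u e \<noteq> v e \<and> u f = v f" by blast
    have e': "X e \<noteq> Zer" "Y e \<noteq> Zer" "X e \<noteq> Y e" using e by (auto simp: sep_iff)
    have eE: "e \<in> E" using e' X sv by (auto simp: signvecs_def)
    define X0 where "X0 = (\<lambda>h. if h \<in> sep X Y then Zer else (X \<odot> Y) h)"
    define A where "A = {h \<in> E. X h = Zer \<and> Y h = Zer}"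
    \<comment> \<open>\<open>X \<odot> Y \<odot> t\<close> and \<open>Y \<odot> X \<odot> t\<close>
      differ exactly on \<open>sep X Y\<close>, so a zone point between them agrees with
      \<open>X \<odot> Y\<close> off that set as far as this is nonzero, and with \<open>t\<close>
      on the common zeros.\<close>
    have mid: "\<exists>z\<in>face (zone e T) X0. \<forall>h\<in>A. z h = t h" if t: "t \<in> T" for t
    proof -
      let ?x = "X \<odot> Y \<odot> t" and ?y = "Y \<odot> X \<odot> t"
      have xy: "?x \<in> T" "?y \<in> T" "?x e \<noteq> ?y e"
        using cov_scomp_tope[OF X cov_scomp_tope[OF Y t]] cov_scomp_tope[OF Y cov_scomp_tope[OF X t]] e'
        by (simp_all add: scomp_apply)
      obtain z where z: "z \<in> zone e T" "\<And>h. ?x h = ?y h \<Longrightarrow> z h = ?x h"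
        using zone_between[OF T np xy] by blast
      have "z \<in> face (zone e T) X0"
      proof (rule faceI[OF z(1)])
        fix h assume "X0 h \<noteq> Zer"
        then show "z h = X0 h" using z(2)[of h]
          by (auto simp: X0_def sep_iff scomp_apply split: if_splits)
      qed
      moreover have "z h = t h" if "h \<in> A" for h
        using that z(2)[of h] by (simp add: A_def scomp_apply)
      ultimately show ?thesis by blast
    qed
    obtain t where t: "t \<in> T" using ag_nonempty[OF T] by blast
    have ne: "face (zone e T) X0 \<noteq> {}" using mid[OF t] by blast
    then have zne: "zone e T \<noteq> {}" by (auto simp: face_def)
    note Z = ag_system_zone[OF IH T zne]
    define F where "F = {h \<in> E - {e}. X0 h = Zer}"
    have "card F < card E" using finE eE by (intro psubset_card_mono) (auto simp: F_def)
    then have com: "com F (cov (restrict_vec F ` face (zone e T) X0))"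
      using IH ag_system_face[OF Z(1) F_def ne] by blast
    have AF: "A \<subseteq> F" using e' by (auto simp: A_def F_def X0_def scomp_apply)
    have sym: "\<exists>s\<in>face (zone e T) X0. \<forall>h\<in>A. s h = sneg (z h)" if z: "z \<in> face (zone e T) X0" for z
    proof -
      have "z(e := Pos) \<in> T" using zoneD(1)[OF faceD(1)[OF z]] by simp
      \<comment> \<open>On \<open>A\<close>, where \<open>X\<close> is zero, this tope is the
        negative of \<open>z\<close>; \<open>mid\<close> replaces it by a zone point with the same
        values on \<open>A\<close>.\<close>
      then have "X \<odot> \<ominus> z(e := Pos) \<in> T" using covD[OF X] by blast
      then obtain s where s: "s \<in> face (zone e T) X0" "\<forall>h\<in>A. s h = (X \<odot> \<ominus> z(e := Pos)) h"
        using mid by blast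
      have "s h = sneg (z h)" if "h \<in> A" for h
      proof -
        have "h \<noteq> e" "X h = Zer" using that AF by (auto simp: F_def A_def)
        then show ?thesis using s(2) that by (simp add: scomp_apply)
      qed
      then show ?thesis using s(1) by blast
    qed
    obtain W where W: "W \<in> cov (zone e T)" "\<And>h. X0 h \<noteq> Zer \<Longrightarrow> W h = X0 h" "\<And>h. h \<in> A \<Longrightarrow> W h = Zer"
      using cov_lift[OF Z(1) F_def ne com AF sym] by blast
    have "W h = (X \<odot> Y) h" if h: "h \<in> E - sep X Y" for h
    proof (cases "h \<in> A")
      case True then show ?thesis using W(3) by (simp add: A_def scomp_apply)
    next
      case False
      then have "X0 h \<noteq> Zer" using h by (auto simp: A_def X0_def scomp_apply)
      then show ?thesis using W(2) h by (simp add: X0_def)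
    qed
    then show ?thesis using W(1) Z(2) by blast
  qed
  show ?case
    unfolding com_def by (intro conjI ballI finE sv cov_comp_neg elim)
qed

text \<open>The proviso of \<open>ag_system_del\<close> is discharged by
  \<open>ag_system_com\<close>; closure of the graph class under contraction comes from
  here.\<close>

corollary ag_system_del_closed:
  "ag_system E T \<Longrightarrow> ag_system (E - {g}) (del g T)"
  by (rule ag_system_del, assumption, rule ag_system_com)

section \<open>Minimal families with a non-gated antipodal face\<close>

text \<open>Isometry in local form: from \<open>x\<close> one can always step towards
  \<open>y\<close> inside \<open>T\<close>, and iterating this gives a path of Hamming
  length.\<close>

definition cubical :: "'e set set \<Rightarrow> bool" where
  "cubical T \<longleftrightarrow> finite T \<and> (\<forall>t\<in>T. finite t) \<and>
     (\<forall>x\<in>T. \<forall>y\<in>T. x \<noteq> y \<longrightarrow> (\<exists>e\<in>sym_diff x y. sym_diff x {e} \<in> T))"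

text \<open>Here \<open>u\<close> and \<open>D\<close> describe the face \<open>{t. t - D = u - D}\<close> with free coordinates \<open>D\<close>, and
  \<open>(u - D) \<union> (t \<inter> D)\<close> is the gate of \<open>t\<close> in it.\<close>

definition ag_family :: "'e set set \<Rightarrow> bool" where
  "ag_family T \<longleftrightarrow> (\<forall>u\<in>T. \<forall>D. (\<forall>t\<in>T. t - D = u - D \<longrightarrow> sym_diff t D \<in> T) \<longrightarrow>
     (\<forall>t\<in>T. (u - D) \<union> (t \<inter> D) \<in> T))"

lemma cubicalD:
  assumes "cubical T"
  shows "finite T" "t \<in> T \<Longrightarrow> finite t"
    "x \<in> T \<Longrightarrow> y \<in> T \<Longrightarrow> x \<noteq> y \<Longrightarrow> \<exists>e\<in>sym_diff x y. sym_diff x {e} \<in> T"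
  using assms unfolding cubical_def by blast+

lemma ag_familyD:
  assumes "ag_family T" "u \<in> T" "t \<in> T" "\<And>x. x \<in> T \<Longrightarrow> x - D = u - D \<Longrightarrow> sym_diff x D \<in> T"
  shows "(u - D) \<union> (t \<inter> D) \<in> T"
  using assms unfolding ag_family_def by blast

lemma not_ag_familyE:
  assumes "\<not> ag_family T"
  obtains u D t where "u \<in> T" "t \<in> T" "\<And>x. x \<in> T \<Longrightarrow> x - D = u - D \<Longrightarrow> sym_diff x D \<in> T"
    "(u - D) \<union> (t \<inter> D) \<notin> T"
proof -
  define Q where "Q u D \<longleftrightarrow> (\<forall>t\<in>T. t - D = u - D \<longrightarrow> sym_diff t D \<in> T)" for u D
  have "\<exists>u\<in>T. \<exists>D. Q u D \<and> (\<exists>t\<in>T. (u - D) \<union> (t \<inter> D) \<notin> T)"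
    using assms unfolding ag_family_def Q_def[symmetric] by blast
  then obtain u D t where "u \<in> T" "t \<in> T" "Q u D" "(u - D) \<union> (t \<inter> D) \<notin> T" by blast
  then show ?thesis using that[of u t D] unfolding Q_def by simp
qed

text \<open>Minimality under restriction is used through this: if the face and \<open>t\<close> lie
  on the same side of \<open>e\<close>, the halfspace already sees the face, its antipodal map and
  the gate.\<close>

lemma gate_in_halfspace:
  assumes "ag_family {x \<in> T. (e \<in> x) = (e \<in> u)}" "u \<in> T" "t \<in> T" "e \<in> t \<longleftrightarrow> e \<in> u" "e \<notin> D"
    "\<And>x. x \<in> T \<Longrightarrow> x - D = u - D \<Longrightarrow> sym_diff x D \<in> T"
  shows "(u - D) \<union> (t \<inter> D) \<in> T"
proof -
  have "(u - D) \<union> (t \<inter> D) \<in> {x \<in> T. (e \<in> x) = (e \<in> u)}"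
    by (rule ag_familyD[OF assms(1)]) (use assms in auto)
  then show ?thesis by simp
qed

text \<open>Minimality under contraction: the gate in the contraction has at most two preimages in
  the cube, the wanted vertex and its neighbour across \<open>g\<close>. Antipodality of the face is
  required only up to the coordinate \<open>g\<close>.\<close>

lemma gate_in_contraction:
  assumes "ag_family ((\<lambda>x. x - {g}) ` T)" "u \<in> T" "t \<in> T"
    "\<And>x. x \<in> T \<Longrightarrow> x - insert g D = u - insert g D \<Longrightarrow> \<exists>y\<in>T. y - {g} = sym_diff x D - {g}"
  shows "(u - D) \<union> (t \<inter> D) \<in> T \<or> sym_diff ((u - D) \<union> (t \<inter> D)) {g} \<in> T"
proof -
  have "(u - {g}) - (D - {g}) \<union> (t - {g}) \<inter> (D - {g}) \<in> (\<lambda>x. x - {g}) ` T"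
  proof (rule ag_familyD[OF assms(1)])
    fix x' assume x': "x' \<in> (\<lambda>x. x - {g}) ` T" "x' - (D - {g}) = (u - {g}) - (D - {g})"
    then obtain x where x: "x \<in> T" "x' = x - {g}" by blast
    then have "x - insert g D = u - insert g D" using x'(2) by blast
    then obtain y where "y \<in> T" "y - {g} = sym_diff x D - {g}" using assms(4) x by blast
    moreover have "sym_diff x' (D - {g}) = sym_diff x D - {g}" using x by blast
    ultimately show "sym_diff x' (D - {g}) \<in> (\<lambda>x. x - {g}) ` T" by (metis image_eqI)
  qed (use assms in blast)+
  then obtain y where y: "y \<in> T" "(u - {g}) - (D - {g}) \<union> (t - {g}) \<inter> (D - {g}) = y - {g}" by blast
  have *: "h \<in> y \<longleftrightarrow> h \<in> (u - D) \<union> (t \<inter> D)" if "h \<noteq> g" for h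
    using eqset_imp_iff[OF y(2), of h] that by auto
  have "y = (u - D) \<union> (t \<inter> D) \<or> y = sym_diff ((u - D) \<union> (t \<inter> D)) {g}"
  proof (cases "g \<in> y \<longleftrightarrow> g \<in> (u - D) \<union> (t \<inter> D)")
    case True
    then have "h \<in> y \<longleftrightarrow> h \<in> (u - D) \<union> (t \<inter> D)" for h
      using *[of h] by (cases "h = g") auto
    then have "y = (u - D) \<union> (t \<inter> D)" by (rule set_eqI)
    then show ?thesis ..
  next
    case False
    then have "h \<in> y \<longleftrightarrow> h \<in> sym_diff ((u - D) \<union> (t \<inter> D)) {g}" for h
      using *[of h] by (cases "h = g") auto
    then have "y = sym_diff ((u - D) \<union> (t \<inter> D)) {g}" by (rule set_eqI)
    then show ?thesis ..
  qed
  then show ?thesis using y(1) by (elim disjE) simp_all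
qed

lemma sym_diff_cancel [simp]: "sym_diff (sym_diff x y) y = x"
  by auto

text \<open>Here \<open>r\<close> is the missing gate, \<open>D\<close> the set of free coordinates of the face, and \<open>e\<close> the only coordinate
  separating the face from the vertex \<open>sym_diff r {e}\<close> that has no gate.\<close>

lemma minimal_non_ag_face:
  assumes cub: "cubical T" and nag: "\<not> ag_family T"
    and restr: "\<And>e s. \<exists>x\<in>T. e \<in> x \<Longrightarrow> \<exists>x\<in>T. e \<notin> x \<Longrightarrow> ag_family {t \<in> T. (e \<in> t) = s}"
    and contr: "\<And>e. \<exists>x\<in>T. e \<in> x \<Longrightarrow> \<exists>x\<in>T. e \<notin> x \<Longrightarrow> ag_family ((\<lambda>t. t - {e}) ` T)"
  obtains r D e where "finite D" "card D \<ge> 3" "e \<notin> D"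
    "\<And>K. K \<subseteq> D \<Longrightarrow> sym_diff r K \<in> T \<longleftrightarrow> K \<noteq> {} \<and> K \<noteq> D"
    "sym_diff r {e} \<in> T"
    "\<And>x. x \<in> T \<Longrightarrow> sym_diff x r \<subseteq> insert e D"
proof -
  obtain u D t where u: "u \<in> T" and t: "t \<in> T"
    and sym: "\<And>x. x \<in> T \<Longrightarrow> x - D = u - D \<Longrightarrow> sym_diff x D \<in> T"
    and r': "(u - D) \<union> (t \<inter> D) \<notin> T"
    by (rule not_ag_familyE[OF nag]) (rule that, assumption+)
  define r where "r = (u - D) \<union> (t \<inter> D)"
  have rT: "r \<notin> T" using r' by (simp add: r_def)
  \<comment> \<open>The coordinates separating \<open>t\<close> from its missing gate; minimality
    will leave a single one.\<close>
  define S where "S = sym_diff r t"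
  have tr: "t = sym_diff r S" by (auto simp: S_def)
  have SD: "S \<inter> D = {}" by (auto simp: S_def r_def)
  have Su: "S = sym_diff u t - D" by (auto simp: S_def r_def)
  have uD: "sym_diff u D \<in> T" by (rule sym[OF u refl])
  have finD: "finite D"
  proof -
    have "D \<subseteq> u \<union> sym_diff u D" by auto
    moreover have "finite (u \<union> sym_diff u D)"
      using cubicalD(2)[OF cub u] cubicalD(2)[OF cub uD] by (rule finite_UnI)
    ultimately show ?thesis by (rule finite_subset)
  qed
  have nonconst: "\<exists>x\<in>T. e \<in> x" "\<exists>x\<in>T. e \<notin> x" if "e \<in> D \<union> S" for e
  proof -
    have "\<exists>y\<in>T. (e \<in> u) \<noteq> (e \<in> y)"
    proof (cases "e \<in> D")
      case True then show ?thesis by (intro bexI[OF _ uD]) auto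
    next
      case False then show ?thesis using that Su by (intro bexI[OF _ t]) auto
    qed
    then show "\<exists>x\<in>T. e \<in> x" "\<exists>x\<in>T. e \<notin> x" using u by blast+
  qed
  \<comment> \<open>One side of any further nonconstant coordinate contains the whole face and
    \<open>t\<close>, and would be a smaller counterexample.\<close>
  have spread: "sym_diff x y \<subseteq> D \<union> S" if "x \<in> T" "y \<in> T" for x y
  proof
    fix e assume e: "e \<in> sym_diff x y"
    show "e \<in> D \<union> S"
    proof (rule ccontr)
      assume n: "e \<notin> D \<union> S"
      have "ag_family {x \<in> T. (e \<in> x) = (e \<in> u)}" by (rule restr) (use e that in blast)+
      then have "r \<in> T" unfolding r_def
        by (rule gate_in_halfspace[OF _ u t _ _ sym]) (use n Su in \<open>simp_all, auto\<close>)
      then show False using rT by simp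
    qed
  qed
  \<comment> \<open>Contracting \<open>g\<close> keeps the face antipodal, so a gate exists there;
    it lifts to \<open>r\<close> or to the neighbour of \<open>r\<close> across
    \<open>g\<close>.\<close>
  have single: "sym_diff r {g} \<in> T" if g: "g \<in> D" for g
  proof -
    have "r \<in> T \<or> sym_diff r {g} \<in> T" unfolding r_def
    proof (rule gate_in_contraction[OF contr u t])
      fix x assume x: "x \<in> T" "x - insert g D = u - insert g D"
      then have "x - D = u - D" using insert_absorb[OF g] by simp
      then show "\<exists>y\<in>T. y - {g} = sym_diff x D - {g}" using sym[OF x(1)] by (intro bexI[of _ "sym_diff x D"]) simp_all
    qed (use nonconst g in blast)+
    then show ?thesis using rT by simp
  qed
  \<comment> \<open>A smallest missing \<open>K\<close> would make the face on \<open>K\<close> miss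
    exactly \<open>r\<close> and \<open>sym_diff r K\<close>. That face is antipodal, the gate of
    \<open>t\<close> in it is \<open>r\<close>, and a coordinate of \<open>D - K\<close> cuts off a
    halfspace containing the face and \<open>t\<close>.\<close>
  have sub: "sym_diff r K \<in> T" if "finite K" "K \<subseteq> D" "K \<noteq> {}" "K \<noteq> D" for K
    using that
  proof (induction K rule: finite_psubset_induct)
    case (psubset K)
    show ?case
    proof (rule ccontr)
      assume nK: "sym_diff r K \<notin> T"
      obtain k where k: "k \<in> K" using psubset.prems by blast
      obtain e where e: "e \<in> D" "e \<notin> K" using psubset.prems by blast
      let ?u = "sym_diff r {k}"
      have kT: "?u \<in> T" using single k psubset.prems by blast
      have er: "e \<in> r \<longleftrightarrow> e \<in> t" using e by (auto simp: r_def)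
      have "ag_family {x \<in> T. (e \<in> x) = (e \<in> ?u)}" by (rule restr) (use nonconst e in blast)+
      then have "(?u - K) \<union> (t \<inter> K) \<in> T"
      proof (rule gate_in_halfspace[OF _ kT t])
        fix x assume x: "x \<in> T" "x - K = ?u - K"
        define J where "J = sym_diff x r"
        have xJ: "x = sym_diff r J" by (auto simp: J_def)
        have JK: "J \<subseteq> K" using x(2) k by (auto simp: J_def)
        have "J \<noteq> {}" using xJ x(1) rT by auto
        moreover have "J \<noteq> K" using xJ x(1) nK by auto
        ultimately have "sym_diff r (K - J) \<in> T" using psubset.prems JK by (intro psubset.IH) auto
        moreover have "sym_diff r (K - J) = sym_diff x K" unfolding xJ using JK by auto
        ultimately show "sym_diff x K \<in> T" by simp
      qed (use e k er in auto)
      moreover have "(?u - K) \<union> (t \<inter> K) = r" using k psubset.prems(1) by (auto simp: r_def)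
      ultimately show False using rT by simp
    qed
  qed
  have rD: "sym_diff r D \<notin> T"
  proof
    assume a: "sym_diff r D \<in> T"
    have "sym_diff r D - D = u - D" by (auto simp: r_def)
    then have "sym_diff (sym_diff r D) D \<in> T" by (rule sym[OF a])
    then show False using rT by simp
  qed
  have rK: "sym_diff r K \<in> T \<longleftrightarrow> K \<noteq> {} \<and> K \<noteq> D" if "K \<subseteq> D" for K
    using sub[of K] that finite_subset[OF that finD] rD rT by auto
  define J where "J = sym_diff u r"
  have ur: "u = sym_diff r J" "J \<subseteq> D" by (auto simp: r_def J_def)
  then have urK: "J \<noteq> {}" "J \<noteq> D" using u rK[of J] by simp_all
  then obtain g where g: "g \<in> D" using ur(2) by blast
  obtain h where h: "h \<in> D" "h \<noteq> g" using urK ur(2) g by blast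
  \<comment> \<open>With two coordinates the face would consist of two opposite corners of a square,
    and no step leads from one towards the other.\<close>
  have "card D \<ge> 3"
  proof (rule ccontr)
    assume c: "\<not> card D \<ge> 3"
    have "card {g, h} = 2" using h by simp
    then have "{g, h} = D" using g h c finD by (intro card_seteq) auto
    then have D: "D = {g, h}" by simp
    let ?x = "sym_diff r {g}" and ?y = "sym_diff r {h}"
    have ne: "?x \<noteq> ?y"
    proof
      assume "?x = ?y"
      from eqset_imp_iff[OF this, of g] show False using h by auto
    qed
    obtain e where e: "e \<in> sym_diff ?x ?y" "sym_diff ?x {e} \<in> T"
      using cubicalD(3)[OF cub single[OF g] single[OF h(1)] ne] by (elim bexE)
    have "e = g \<or> e = h" using e(1) by auto
    then show False
    proof
      assume "e = g"
      then show False using e(2) rT sym_diff_cancel[of r "{g}"] by metis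
    next
      assume "e = h"
      moreover have "sym_diff ?x {h} = sym_diff r D" using h D by auto
      ultimately show False using e(2) rD by metis
    qed
  qed
  \<comment> \<open>If a vertex over \<open>r\<close> or over its antipode is reached by crossing
    only part of \<open>S\<close>, then one side of an uncrossed coordinate contains the face
    together with a vertex whose gate is missing.\<close>
  have opp: "S' = S" if S': "S' \<subseteq> S" "sym_diff c S' \<in> T" and c: "c = r \<or> c = sym_diff r D" for S' c
  proof (rule ccontr)
    assume "S' \<noteq> S"
    then obtain e where e: "e \<in> S" "e \<notin> S'" using S'(1) by blast
    then have eD: "e \<notin> D" using SD by blast
    have "ag_family {x \<in> T. (e \<in> x) = (e \<in> u)}" by (rule restr) (use nonconst e in blast)+
    then have "(u - D) \<union> (sym_diff c S' \<inter> D) \<in> T"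
      by (rule gate_in_halfspace[OF _ u S'(2) _ eD sym]) (use e eD c in \<open>auto simp: r_def\<close>)
    moreover have "(u - D) \<union> (sym_diff c S' \<inter> D) = c" using S'(1) SD c by (auto simp: r_def)
    ultimately show False using c rT rD by auto
  qed
  have "S \<noteq> {}" using tr t rT by auto
  then obtain e where e: "e \<in> S" by blast
  \<comment> \<open>If \<open>S\<close> had further elements, then by \<open>opp\<close> contracting
    \<open>e\<close> would add neither \<open>r\<close> nor its antipode to the face; it would stay
    antipodal, with the gate of \<open>t\<close> still missing.\<close>
  have Se: "S = {e}"
  proof (rule ccontr)
    assume Sn: "S \<noteq> {e}"
    have *: "sym_diff c {e} \<notin> T" if "c = r \<or> c = sym_diff r D" for c
      using opp[of "{e}" c] e Sn that by auto
    have eD: "e \<notin> D" using e SD by blast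
    have "r \<in> T \<or> sym_diff r {e} \<in> T" unfolding r_def
    proof (rule gate_in_contraction[OF contr u t])
      fix x assume x: "x \<in> T" "x - insert e D = u - insert e D"
      define K where "K = sym_diff x r - {e}"
      have KD: "K \<subseteq> D" using x(2) by (auto simp: K_def r_def)
      have xK: "x - {e} = sym_diff r K - {e}" by (auto simp: K_def)
      have x2: "x = sym_diff r K \<or> x = sym_diff (sym_diff r K) {e}"
      proof (cases "e \<in> x \<longleftrightarrow> e \<in> r")
        case True
        then have "h \<in> x \<longleftrightarrow> h \<in> sym_diff r K" for h
          using eqset_imp_iff[OF xK, of h] KD eD by (cases "h = e") auto
        then have "x = sym_diff r K" by (rule set_eqI)
        then show ?thesis ..
      next
        case False
        then have "h \<in> x \<longleftrightarrow> h \<in> sym_diff (sym_diff r K) {e}" for h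
          using eqset_imp_iff[OF xK, of h] KD eD by (cases "h = e") auto
        then have "x = sym_diff (sym_diff r K) {e}" by (rule set_eqI)
        then show ?thesis ..
      qed
      have "K \<noteq> {}" using x2 x(1) rT *[of r] by auto
      moreover have "K \<noteq> D" using x2 x(1) rD *[of "sym_diff r D"] by auto
      ultimately have "sym_diff r (D - K) \<in> T" using rK[of "D - K"] KD by blast
      moreover have "sym_diff r (D - K) - {e} = sym_diff x D - {e}"
      proof (rule set_eqI)
        fix h show "h \<in> sym_diff r (D - K) - {e} \<longleftrightarrow> h \<in> sym_diff x D - {e}"
          using eqset_imp_iff[OF xK, of h] KD by auto
      qed
      ultimately show "\<exists>y\<in>T. y - {e} = sym_diff x D - {e}" by blast
    qed (use nonconst e in blast)+
    then show False using rT *[of r] by simp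
  qed
  have "sym_diff x r \<subseteq> insert e D" if "x \<in> T" for x
    using spread[OF that t] Se tr by auto
  then show ?thesis
    using that[OF finD \<open>card D \<ge> 3\<close> _ rK] SD Se t tr by auto
qed

lemma nonconstant_coord:
  "x \<in> T \<Longrightarrow> y \<in> T \<Longrightarrow> (e \<in> x) \<noteq> (e \<in> y) \<Longrightarrow> \<exists>x\<in>T. e \<in> x"
  "x \<in> T \<Longrightarrow> y \<in> T \<Longrightarrow> (e \<in> x) \<noteq> (e \<in> y) \<Longrightarrow> \<exists>x\<in>T. e \<notin> x"
  by blast+

text \<open>For a smallest missing \<open>K\<close>, the face at \<open>sym_diff r {e}\<close> with
  free coordinates \<open>insert e K\<close> misses exactly the antipodal pair \<open>r\<close> and
  \<open>sym_diff r (insert e K)\<close>. The gate of \<open>sym_diff r {h}\<close> in it, for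
  \<open>h\<close> in \<open>D - K\<close>, is the missing \<open>r\<close>. A second coordinate
  \<open>h'\<close> of \<open>D - K\<close> provides a halfspace containing all this, which is where
  the bound \<open>card K + 2 \<le> card D\<close> comes from.\<close>

lemma minimal_non_ag_opposite:
  assumes restr: "\<And>e s. \<exists>x\<in>T. e \<in> x \<Longrightarrow> \<exists>x\<in>T. e \<notin> x \<Longrightarrow> ag_family {t \<in> T. (e \<in> t) = s}"
    and D: "finite D" "card D \<ge> 3" "e \<notin> D"
    and rK: "\<And>K. K \<subseteq> D \<Longrightarrow> sym_diff r K \<in> T \<longleftrightarrow> K \<noteq> {} \<and> K \<noteq> D"
    and re: "sym_diff r {e} \<in> T"
  shows "finite K \<Longrightarrow> K \<subseteq> D \<Longrightarrow> card K + 2 \<le> card D \<Longrightarrow> sym_diff r (insert e K) \<in> T"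
proof (induction K rule: finite_psubset_induct)
  case (psubset K)
  have rT: "r \<notin> T" using rK[of "{}"] by simp
  show ?case
  proof (cases "K = {}")
    case True
    then show ?thesis using re by simp
  next
    case False
    show ?thesis
    proof (rule ccontr)
      assume nK: "sym_diff r (insert e K) \<notin> T"
      have "card (D - K) \<ge> 2" using psubset.prems psubset.hyps by (simp add: card_Diff_subset)
      then have "D - K \<noteq> {}" by force
      then obtain h where h: "h \<in> D - K" by blast
      then have "card (D - K - {h}) \<ge> 1" using \<open>card (D - K) \<ge> 2\<close> by simp
      then have "D - K - {h} \<noteq> {}" by force
      then obtain h' where h': "h' \<in> D" "h' \<notin> K" "h' \<noteq> h" by blast
      have hD: "{h} \<subseteq> D" "{h} \<noteq> D" using h h' by auto
      have hT: "sym_diff r {h} \<in> T" using rK[OF hD(1)] hD(2) by simp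
      have h'T: "sym_diff r {h'} \<in> T" using rK[of "{h'}"] h' h by auto
      let ?D = "insert e K" and ?u = "sym_diff r {e}"
      have "\<exists>x\<in>T. h' \<in> x" "\<exists>x\<in>T. h' \<notin> x"
        using nonconstant_coord[OF hT h'T, of h'] h' by auto
      then have "ag_family {x \<in> T. (h' \<in> x) = (h' \<in> ?u)}" by (rule restr)
      then have "(?u - ?D) \<union> (sym_diff r {h} \<inter> ?D) \<in> T"
      proof (rule gate_in_halfspace[OF _ re hT])
        show "(h' \<in> sym_diff r {h}) = (h' \<in> ?u)" "h' \<notin> ?D" using h' D(3) by auto
      next
        fix x assume x: "x \<in> T" "x - ?D = ?u - ?D"
        define J where "J = sym_diff x r - {e}"
        have JK: "J \<subseteq> K" using x(2) by (auto simp: J_def)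
        have JD: "K - J \<subseteq> D" "J \<subseteq> D" using psubset.prems(1) JK by auto
        have KD: "K - J \<noteq> D" using h by auto
        have eJ: "e \<notin> J" "e \<notin> K" using D(3) psubset.prems(1) by (auto simp: J_def)
        show "sym_diff x ?D \<in> T"
        proof (cases "e \<in> x \<longleftrightarrow> e \<in> r")
          case True
          then have xJ: "x = sym_diff r J" by (auto simp: J_def)
          then have "J \<noteq> {}" using x(1) rT by auto
          then have "K - J \<subset> K" using JK by auto
          moreover from this have "card (K - J) \<le> card K" using psubset.hyps by (intro card_mono) auto
          ultimately have "sym_diff r (insert e (K - J)) \<in> T"
            using psubset.prems(2) JD by (intro psubset.IH) auto
          moreover have "sym_diff r (insert e (K - J)) = sym_diff x ?D"
            unfolding xJ using JK eJ by auto
          ultimately show ?thesis by simp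
        next
          case False
          have xJ: "x = sym_diff r (insert e J)"
          proof (rule set_eqI)
            fix k show "k \<in> x \<longleftrightarrow> k \<in> sym_diff r (insert e J)"
              using False by (cases "k = e") (auto simp: J_def)
          qed
          have "J \<noteq> K" using xJ x(1) nK by auto
          then have "sym_diff r (K - J) \<in> T" using rK[OF JD(1)] KD JK by auto
          moreover have "sym_diff r (K - J) = sym_diff x ?D"
            unfolding xJ using JK eJ by auto
          ultimately show ?thesis by simp
        qed
      qed
      moreover have "(?u - ?D) \<union> (sym_diff r {h} \<inter> ?D) = r" using h D(3) by auto
      ultimately show False using rT by simp
    qed
  qed
qed

text \<open>In coordinates centred at the antipode \<open>v\<close> of the missing gate.\<close>

lemma minimal_non_ag:
  assumes cub: "cubical T" and nag: "\<not> ag_family T"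
    and restr: "\<And>e s. \<exists>x\<in>T. e \<in> x \<Longrightarrow> \<exists>x\<in>T. e \<notin> x \<Longrightarrow> ag_family {t \<in> T. (e \<in> t) = s}"
    and contr: "\<And>e. \<exists>x\<in>T. e \<in> x \<Longrightarrow> \<exists>x\<in>T. e \<notin> x \<Longrightarrow> ag_family ((\<lambda>t. t - {e}) ` T)"
  obtains U v where "finite U" "card U \<ge> 4" "\<And>x. x \<in> T \<Longrightarrow> sym_diff x v \<subseteq> U"
    "(\<exists>e\<in>U. {B. B \<subseteq> U \<and> sym_diff v B \<in> T} = Pow U - {U, {e}}) \<or>
     (\<exists>M\<subseteq>U. M \<noteq> {} \<and> {B. B \<subseteq> U \<and> sym_diff v B \<in> T} = Pow U - {U, {}} - (\<lambda>i. {i}) ` M)"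
proof -
  obtain r D e where D: "finite D" "card D \<ge> 3" "e \<notin> D"
    and rK: "\<And>K. K \<subseteq> D \<Longrightarrow> sym_diff r K \<in> T \<longleftrightarrow> K \<noteq> {} \<and> K \<noteq> D"
    and re: "sym_diff r {e} \<in> T" and sp: "\<And>x. x \<in> T \<Longrightarrow> sym_diff x r \<subseteq> insert e D"
    by (rule minimal_non_ag_face[OF cub nag restr contr]) (assumption+, rule that, assumption+)
  define U where "U = insert e D"
  define v where "v = sym_diff r U"
  define Y where "Y = {B. B \<subseteq> U \<and> sym_diff v B \<in> T}"
  have vB: "sym_diff v B = sym_diff r (U - B)" if "B \<subseteq> U" for B
    using that by (auto simp: v_def)
  have Y: "B \<in> Y \<longleftrightarrow> sym_diff r (U - B) \<in> T" if "B \<subseteq> U" for B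
    using that by (simp add: Y_def vB)
  have Ye: "B \<in> Y \<longleftrightarrow> B \<noteq> U \<and> B \<noteq> {e}" if "B \<subseteq> U" "e \<in> B" for B
  proof -
    have "U - B \<subseteq> D" "U - B = {} \<longleftrightarrow> B = U" "U - B = D \<longleftrightarrow> B = {e}"
      using that D(3) by (auto simp: U_def)
    then show ?thesis using Y[OF that(1)] rK by simp
  qed
  \<comment> \<open>These vertices lie across \<open>e\<close> from the face; complementation turns
    \<open>card B \<ge> 2\<close> into the bound of \<open>minimal_non_ag_opposite\<close>.\<close>
  have YD: "B \<in> Y" if "B \<subseteq> D" "card B \<ge> 2" for B
  proof -
    have eq: "U - B = insert e (D - B)" using that D(3) by (auto simp: U_def)
    have fB: "finite B" using that D(1) finite_subset by blast
    have "sym_diff r (insert e (D - B)) \<in> T"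
    proof (rule minimal_non_ag_opposite[OF restr D rK re])
      have "card B \<le> card D" using that D(1) card_mono by blast
      then show "card (D - B) + 2 \<le> card D" using that fB by (simp add: card_Diff_subset)
    qed (use D(1) in auto)
    then show ?thesis using Y[of B] that eq by (auto simp: U_def)
  qed
  \<comment> \<open>If \<open>v\<close> is present, isometry demands a step from \<open>v\<close>
    towards \<open>sym_diff v {e, g}\<close>. The step along \<open>e\<close> leads to a missing
    vertex, so the one along \<open>g\<close> is possible.\<close>
  have Ysing: "{g} \<in> Y" if g: "g \<in> D" and empty: "{} \<in> Y" for g
  proof -
    let ?x = "sym_diff r U" and ?y = "sym_diff r (D - {g})"
    have x: "?x \<in> T" using Y[of "{}"] empty by simp
    have "D - {g} \<noteq> {}"
    proof
      assume "D - {g} = {}"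
      then have "D \<subseteq> {g}" by blast
      then have "card D \<le> 1" using card_mono[of "{g}" D] by simp
      then show False using D(2) by simp
    qed
    then have y: "?y \<in> T" using rK[of "D - {g}"] g by auto
    have ne: "?x \<noteq> ?y"
    proof
      assume "?x = ?y"
      from eqset_imp_iff[OF this, of e] show False using D(3) by (auto simp: U_def)
    qed
    obtain k where k: "k \<in> sym_diff ?x ?y" "sym_diff ?x {k} \<in> T"
      using cubicalD(3)[OF cub x y ne] by (elim bexE)
    have "k = e \<or> k = g" using k(1) g D(3) by (auto simp: U_def)
    then show ?thesis
    proof
      assume ke: "k = e"
      have "sym_diff ?x {e} = sym_diff r D" using D(3) by (auto simp: U_def)
      then have "sym_diff r D \<in> T" using k(2) ke by metis
      then show ?thesis using rK[of D] by simp
    next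
      assume kg: "k = g"
      have "sym_diff ?x {g} = sym_diff r (U - {g})" using g by (auto simp: U_def)
      then have "sym_diff r (U - {g}) \<in> T" using k(2) kg by metis
      then show ?thesis using Y[of "{g}"] g by (simp add: U_def)
    qed
  qed
  have UY: "U \<notin> Y" "{e} \<notin> Y" "Y \<subseteq> Pow U" using Ye[of U] Ye[of "{e}"] by (auto simp: U_def Y_def)
  have big: "B \<in> Y" if "B \<subseteq> U" "B \<noteq> U" "B \<noteq> {}" "\<And>i. B \<noteq> {i}" for B
  proof (cases "e \<in> B")
    case True then show ?thesis using Ye that by blast
  next
    case False
    have "finite B" using that(1) D(1) finite_subset by (auto simp: U_def)
    then have "card B \<noteq> 0" "card B \<noteq> 1" using that(3,4) by (auto simp: card_1_singleton_iff)
    then show ?thesis using False that(1) by (intro YD) (auto simp: U_def)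
  qed
  \<comment> \<open>The vertex \<open>v\<close> decides the family: if it is present, only its
    antipode and one neighbour are missing; if it is absent, \<open>M\<close> collects the missing
    neighbours, and \<open>e\<close> is always one of them.\<close>
  have main: "(\<exists>e\<in>U. Y = Pow U - {U, {e}}) \<or> (\<exists>M\<subseteq>U. M \<noteq> {} \<and> Y = Pow U - {U, {}} - (\<lambda>i. {i}) ` M)"
  proof (cases "{} \<in> Y")
    case True
    have "B \<in> Y" if "B \<subseteq> U" "B \<noteq> U" "B \<noteq> {e}" for B
    proof (cases "B = {} \<or> (\<exists>i. B = {i})")
      case True
      then show ?thesis using Ysing \<open>{} \<in> Y\<close> that by (auto simp: U_def)
    qed (use big that in blast)
    then have "Y = Pow U - {U, {e}}" using UY by blast
    then show ?thesis by (auto simp: U_def)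
  next
    case False
    define M where "M = {i \<in> U. {i} \<notin> Y}"
    have "Y = Pow U - {U, {}} - (\<lambda>i. {i}) ` M"
    proof (intro equalityI subsetI)
      fix B assume "B \<in> Y"
      then show "B \<in> Pow U - {U, {}} - (\<lambda>i. {i}) ` M" using UY False by (auto simp: M_def)
    next
      fix B assume B: "B \<in> Pow U - {U, {}} - (\<lambda>i. {i}) ` M"
      show "B \<in> Y"
      proof (cases "\<exists>i. B = {i}")
        case True then show ?thesis using B by (auto simp: M_def)
      qed (use B big in blast)
    qed
    moreover have "e \<in> M" "M \<subseteq> U" using UY by (auto simp: M_def U_def)
    ultimately show ?thesis by blast
  qed
  have "finite U" "card U \<ge> 4" using D by (auto simp: U_def)
  moreover have "sym_diff x v \<subseteq> U" if "x \<in> T" for x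
    using sp[OF that] by (auto simp: v_def U_def)
  ultimately show ?thesis using that[of U v] main unfolding Y_def by simp
qed

section \<open>Cube representations of graphs\<close>

lemma is_walk_single: "is_walk G [p] x y \<longleftrightarrow> p = x \<and> p = y \<and> p \<in> fst G"
  by (auto simp: is_walk_def)

lemma all_nat_split: "(\<forall>i. Q i) \<longleftrightarrow> Q 0 \<and> (\<forall>i. Q (Suc i))"
proof safe
  fix i assume "Q 0" "\<forall>i. Q (Suc i)"
  then show "Q i" by (cases i) auto
qed auto

lemma is_walk_Cons_Cons:
  "is_walk G (p # q # qs) x y \<longleftrightarrow> p = x \<and> x \<in> fst G \<and> (x, q) \<in> snd G \<and> is_walk G (q # qs) q y"
proof -
  have "(\<forall>i. Suc i < length (p # q # qs) \<longrightarrow> ((p # q # qs) ! i, (p # q # qs) ! Suc i) \<in> snd G) \<longleftrightarrow>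
    (p, q) \<in> snd G \<and> (\<forall>i. Suc i < length (q # qs) \<longrightarrow> ((q # qs) ! i, (q # qs) ! Suc i) \<in> snd G)"
    (is "(\<forall>i. ?P i) \<longleftrightarrow> ?R \<and> (\<forall>i. ?Q i)")
  proof -
    have "?P 0 \<longleftrightarrow> ?R" "?P (Suc i) \<longleftrightarrow> ?Q i" for i by auto
    then show ?thesis by (simp only: all_nat_split[of ?P])
  qed
  then show ?thesis unfolding is_walk_def by auto
qed

lemma is_walk_append:
  "is_walk G (as @ z # bs) x y \<longleftrightarrow> is_walk G (as @ [z]) x z \<and> is_walk G (z # bs) z y"
proof (induction as arbitrary: x)
  case Nil
  have "is_walk G (z # bs) x y \<Longrightarrow> z = x \<and> x \<in> fst G" by (auto simp: is_walk_def)
  then show ?case by (auto simp: is_walk_single)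
next
  case (Cons a as)
  show ?case
  proof (cases as)
    case Nil then show ?thesis by (auto simp: is_walk_single is_walk_Cons_Cons)
      (auto simp: is_walk_def)
  next
    case (Cons b as')
    then show ?thesis using Cons.IH[of b] by (simp add: is_walk_Cons_Cons)
  qed
qed

lemma is_walk_mem: "is_walk G ps x y \<Longrightarrow> x \<in> fst G \<and> y \<in> fst G \<and> set ps \<subseteq> fst G \<and> ps \<noteq> []"
  by (cases ps rule: rev_cases) (auto simp: is_walk_def hd_append split: if_splits)

section \<open>Intervals and Hamming distance in the cube\<close>

definition between :: "'e set \<Rightarrow> 'e set \<Rightarrow> 'e set \<Rightarrow> bool" where
  "between a z b \<longleftrightarrow> (\<forall>h. (h \<in> a \<longleftrightarrow> h \<in> b) \<longrightarrow> (h \<in> z \<longleftrightarrow> h \<in> a))"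

lemma between_iff: "between a z b \<longleftrightarrow> sym_diff a z \<inter> sym_diff z b = {}"
  unfolding between_def by auto

lemma card_sym_diff_triangle:
  assumes "finite a" "finite b" "finite z"
  shows "card (sym_diff a b) \<le> card (sym_diff a z) + card (sym_diff z b)"
    and "card (sym_diff a z) + card (sym_diff z b) = card (sym_diff a b) \<longleftrightarrow> between a z b"
proof -
  let ?A = "sym_diff a z" and ?B = "sym_diff z b"
  have fin: "finite ?A" "finite ?B" using assms by auto
  have c: "card ?A + card ?B = card (?A \<union> ?B) + card (?A \<inter> ?B)" by (rule card_Un_Int[OF fin])
  have "sym_diff a b \<subseteq> ?A \<union> ?B" by auto
  then have le: "card (sym_diff a b) \<le> card (?A \<union> ?B)" using fin by (intro card_mono) auto
  then show "card (sym_diff a b) \<le> card ?A + card ?B" using c by simp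
  show "card ?A + card ?B = card (sym_diff a b) \<longleftrightarrow> between a z b"
  proof
    assume "card ?A + card ?B = card (sym_diff a b)"
    then have "card (?A \<inter> ?B) = 0" using c le by simp
    then show "between a z b" unfolding between_iff using fin by auto
  next
    assume b: "between a z b"
    then have "?A \<inter> ?B = {}" by (simp only: between_iff)
    moreover have "?A \<union> ?B = sym_diff a b"
    proof (rule set_eqI)
      fix h show "h \<in> ?A \<union> ?B \<longleftrightarrow> h \<in> sym_diff a b"
        using b[unfolded between_def, rule_format, of h] by auto
    qed
    ultimately show "card ?A + card ?B = card (sym_diff a b)" using c by simp
  qed
qed

lemma card_sym_diff_single:
  assumes "finite a" "finite b"
  shows "e \<in> sym_diff a b \<Longrightarrow> Suc (card (sym_diff (sym_diff a {e}) b)) = card (sym_diff a b)"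
    and "e \<notin> sym_diff a b \<Longrightarrow> card (sym_diff (sym_diff a {e}) b) = Suc (card (sym_diff a b))"
proof -
  assume e: "e \<in> sym_diff a b"
  have "sym_diff (sym_diff a {e}) b = sym_diff a b - {e}" using e by auto
  then show "Suc (card (sym_diff (sym_diff a {e}) b)) = card (sym_diff a b)"
    using e assms card_Suc_Diff1[of "sym_diff a b" e] by simp
next
  assume e: "e \<notin> sym_diff a b"
  have "sym_diff (sym_diff a {e}) b = insert e (sym_diff a b)" using e by auto
  then show "card (sym_diff (sym_diff a {e}) b) = Suc (card (sym_diff a b))"
    using e assms card_insert_disjoint[of "sym_diff a b" e] by simp
qed

text \<open>An isometric cube embedding with its image \<open>T\<close> kept explicit. Only
  adjacency is prescribed; that graph distance is Hamming distance follows from \<open>cub\<close>.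
  The type of coordinates is arbitrary, so that minors keep the coordinates of the original
  graph.\<close>

locale cube_rep =
  fixes G :: "'a graph" and T :: "'e set set" and \<phi> :: "'a \<Rightarrow> 'e set"
  assumes graph: "is_graph G" and cub: "cubical T" and bij: "bij_betw \<phi> (fst G) T"
    and edge: "\<And>x y. x \<in> fst G \<Longrightarrow> y \<in> fst G \<Longrightarrow>
      (x, y) \<in> snd G \<longleftrightarrow> card (sym_diff (\<phi> x) (\<phi> y)) = 1"
begin

lemma phi_mem: "x \<in> fst G \<Longrightarrow> \<phi> x \<in> T"
  using bij by (auto simp: bij_betw_def)

lemma phi_obtain: assumes "t \<in> T" obtains x where "x \<in> fst G" "t = \<phi> x"
  using bij assms by (auto simp: bij_betw_def)

lemma phi_inj: "x \<in> fst G \<Longrightarrow> y \<in> fst G \<Longrightarrow> \<phi> x = \<phi> y \<longleftrightarrow> x = y"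
  using bij by (auto simp: bij_betw_def inj_on_def)

lemma fin: "x \<in> fst G \<Longrightarrow> finite (\<phi> x)"
  using cubicalD(2)[OF cub phi_mem] .

lemma edge_mem: "(x, y) \<in> snd G \<Longrightarrow> x \<in> fst G" "(x, y) \<in> snd G \<Longrightarrow> y \<in> fst G"
  using graph by (auto simp: is_graph_def)

abbreviation d where "d x y \<equiv> card (sym_diff (\<phi> x) (\<phi> y))"

lemma edge_obtain:
  assumes "(x, y) \<in> snd G"
  obtains e where "sym_diff (\<phi> x) (\<phi> y) = {e}"
  using edge[OF edge_mem[OF assms]] assms by (auto simp: card_1_singleton_iff)

lemma toggle:
  assumes "x \<in> fst G" "y \<in> fst G" "x \<noteq> y"
  obtains e z where "z \<in> fst G" "\<phi> z = sym_diff (\<phi> x) {e}" "e \<in> sym_diff (\<phi> x) (\<phi> y)"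
    "(x, z) \<in> snd G"
proof -
  have ne: "\<phi> x \<noteq> \<phi> y" using phi_inj assms by simp
  obtain e where e: "e \<in> sym_diff (\<phi> x) (\<phi> y)" "sym_diff (\<phi> x) {e} \<in> T"
    using cubicalD(3)[OF cub phi_mem[OF assms(1)] phi_mem[OF assms(2)] ne] by (elim bexE)
  obtain z where z: "z \<in> fst G" "sym_diff (\<phi> x) {e} = \<phi> z" using phi_obtain[OF e(2)] by blast
  have "sym_diff (\<phi> x) (\<phi> z) = {e}" unfolding z(2)[symmetric] by auto
  then have "(x, z) \<in> snd G" using edge[OF assms(1) z(1)] by simp
  then show ?thesis using that z e(1) by metis
qed

lemma walk_length: "is_walk G ps x y \<Longrightarrow> Suc (d x y) \<le> length ps"
proof (induction ps arbitrary: x)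
  case Nil then show ?case by (simp add: is_walk_def)
next
  case (Cons p ps)
  show ?case
  proof (cases ps)
    case Nil then show ?thesis using Cons.prems by (auto simp: is_walk_single)
  next
    case (Cons q qs)
    then have w: "x \<in> fst G" "(x, q) \<in> snd G" "is_walk G ps q y"
      using Cons.prems by (auto simp: is_walk_Cons_Cons)
    have q: "q \<in> fst G" "y \<in> fst G" using is_walk_mem[OF w(3)] by auto
    have "d x q = 1" using edge w q by simp
    then show ?thesis
      using Cons.IH[OF w(3)] card_sym_diff_triangle(1)[OF fin[OF w(1)] fin[OF q(2)] fin[OF q(1)]] by simp
  qed
qed

lemma walk_exists: "x \<in> fst G \<Longrightarrow> y \<in> fst G \<Longrightarrow> \<exists>ps. is_walk G ps x y \<and> length ps = Suc (d x y)"
proof (induction "d x y" arbitrary: x rule: less_induct)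
  case less
  show ?case
  proof (cases "x = y")
    case True
    then show ?thesis using less.prems by (intro exI[of _ "[x]"]) (simp add: is_walk_single)
  next
    case False
    then obtain e z where z: "z \<in> fst G" "\<phi> z = sym_diff (\<phi> x) {e}" "e \<in> sym_diff (\<phi> x) (\<phi> y)"
      "(x, z) \<in> snd G" using toggle less.prems by metis
    have dz: "Suc (d z y) = d x y"
      unfolding z(2) by (rule card_sym_diff_single(1)[OF fin fin z(3)]) (use less.prems in simp_all)
    then obtain ps where ps: "is_walk G ps z y" "length ps = Suc (d z y)"
      using less.hyps[of z] z(1) less.prems(2) by auto
    then obtain qs where "ps = z # qs" by (cases ps) (auto simp: is_walk_def)
    then have "is_walk G (x # ps) x y" using ps z less.prems by (simp add: is_walk_Cons_Cons)
    then show ?thesis using ps dz by (intro exI[of _ "x # ps"]) simp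
  qed
qed

lemma reach: "x \<in> fst G \<Longrightarrow> y \<in> fst G \<Longrightarrow> reach G x y"
  using walk_exists by (auto simp: reach_def)

lemma dist: "x \<in> fst G \<Longrightarrow> y \<in> fst G \<Longrightarrow> dist G x y = d x y"
  unfolding dist_def using walk_exists walk_length by (intro Least_equality) fastforce+

text \<open>Lying on a geodesic means equality in the triangle inequality, which for Hamming
  distance is membership in the cube interval. Convexity, hulls and gates are read off from
  this.\<close>

lemma shortest_path_through:
  assumes x: "x \<in> fst G" and y: "y \<in> fst G"
  shows "(\<exists>ps. shortest_path G ps x y \<and> z \<in> set ps) \<longleftrightarrow> z \<in> fst G \<and> between (\<phi> x) (\<phi> z) (\<phi> y)"
proof
  assume "\<exists>ps. shortest_path G ps x y \<and> z \<in> set ps"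
  then obtain ps where ps: "is_walk G ps x y" "length ps = Suc (d x y)" "z \<in> set ps"
    using dist[OF x y] by (auto simp: shortest_path_def)
  then obtain as bs where ab: "ps = as @ z # bs" by (meson split_list)
  have z: "z \<in> fst G" using is_walk_mem[OF ps(1)] ps(3) by blast
  have "is_walk G (as @ [z]) x z" "is_walk G (z # bs) z y" using ps(1) ab is_walk_append by metis+
  then have "Suc (d x z) \<le> length (as @ [z])" "Suc (d z y) \<le> length (z # bs)" using walk_length by blast+
  then have "d x z + d z y \<le> d x y" using ps(2) ab by simp
  then have "d x z + d z y = d x y" using card_sym_diff_triangle(1)[OF fin[OF x] fin[OF y] fin[OF z]] by simp
  then show "z \<in> fst G \<and> between (\<phi> x) (\<phi> z) (\<phi> y)"
    using card_sym_diff_triangle(2)[OF fin[OF x] fin[OF y] fin[OF z]] z by simp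
next
  assume z: "z \<in> fst G \<and> between (\<phi> x) (\<phi> z) (\<phi> y)"
  then have eq: "d x z + d z y = d x y" using card_sym_diff_triangle(2)[OF fin[OF x] fin[OF y] fin, of z] by simp
  obtain ps where ps: "is_walk G ps x z" "length ps = Suc (d x z)" using walk_exists x z by blast
  obtain qs where qs: "is_walk G qs z y" "length qs = Suc (d z y)" using walk_exists y z by blast
  obtain as where as: "ps = as @ [z]" using ps(1) by (cases ps rule: rev_cases) (auto simp: is_walk_def)
  obtain bs where bs: "qs = z # bs" using qs(1) by (cases qs) (auto simp: is_walk_def)
  have "is_walk G (as @ z # bs) x y" using is_walk_append ps qs as bs by metis
  moreover have "length (as @ z # bs) = Suc (dist G x y)" using ps(2) qs(2) as bs eq dist[OF x y] by simp
  ultimately show "\<exists>ps. shortest_path G ps x y \<and> z \<in> set ps"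
    by (intro exI[of _ "as @ z # bs"]) (simp add: shortest_path_def)
qed

lemma convex_iff:
  "convex G W \<longleftrightarrow> W \<subseteq> fst G \<and> (\<forall>x\<in>W. \<forall>y\<in>W. \<forall>z\<in>fst G. between (\<phi> x) (\<phi> z) (\<phi> y) \<longrightarrow> z \<in> W)"
  unfolding convex_def using shortest_path_through by (intro conj_cong refl ball_cong) (blast | meson subsetD)+

lemma gated_iff:
  "gated G W \<longleftrightarrow> W \<subseteq> fst G \<and> (\<forall>x\<in>fst G. \<exists>x'\<in>W. \<forall>y\<in>W. between (\<phi> x) (\<phi> x') (\<phi> y))"
proof -
  have "(\<exists>ps. shortest_path G ps x y \<and> x' \<in> set ps) \<longleftrightarrow> between (\<phi> x) (\<phi> x') (\<phi> y)"
    if "W \<subseteq> fst G" "x \<in> fst G" "x' \<in> W" "y \<in> W" for x x' y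
    using shortest_path_through[of x y x'] that by blast
  then show ?thesis unfolding gated_def by (intro conj_cong refl ball_cong bex_cong) blast+
qed

lemma conv_pair:
  assumes x: "x \<in> fst G" and y: "y \<in> fst G"
  shows "conv G {x, y} = {z \<in> fst G. between (\<phi> x) (\<phi> z) (\<phi> y)}"
proof -
  let ?I = "{z \<in> fst G. between (\<phi> x) (\<phi> z) (\<phi> y)}"
  have "between (\<phi> x) (\<phi> z) (\<phi> y)"
    if "between (\<phi> x) (\<phi> u) (\<phi> y)" "between (\<phi> x) (\<phi> v) (\<phi> y)" "between (\<phi> u) (\<phi> z) (\<phi> v)" for u v z
    using that unfolding between_def by metis
  then have "convex G ?I" unfolding convex_iff by blast
  moreover have "{x, y} \<subseteq> ?I" using x y by (auto simp: between_def)
  moreover have "?I \<subseteq> W" if "convex G W" "{x, y} \<subseteq> W" for W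
    using that unfolding convex_iff by blast
  ultimately show ?thesis unfolding conv_def by (intro equalityI) blast+
qed

text \<open>The hull of a pair is the part of \<open>T\<close> in a cube interval, so the hull of
  \<open>u\<close> and its antipode is a face whose free coordinates \<open>D\<close> are those in
  which the two differ. Any other member must span the same face with its own antipode, which
  therefore differs from it exactly on \<open>D\<close>.\<close>

lemma antipodal_iff:
  "antipodal G W \<longleftrightarrow> (\<exists>u\<in>fst G. \<exists>D. W = {z \<in> fst G. \<phi> z - D = \<phi> u - D} \<and>
     (\<forall>t\<in>T. t - D = \<phi> u - D \<longrightarrow> sym_diff t D \<in> T))"
proof
  assume W: "antipodal G W"
  then obtain u where u: "u \<in> W" "u \<in> fst G" by (auto simp: antipodal_def)
  have anti: "\<exists>y\<in>fst G. W = {z \<in> fst G. between (\<phi> x) (\<phi> z) (\<phi> y)}" if xW: "x \<in> W" for x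
  proof -
    obtain y where y: "y \<in> W" "conv G {x, y} = W" using W xW unfolding antipodal_def by blast
    have V: "x \<in> fst G" "y \<in> fst G" using W xW y(1) by (auto simp: antipodal_def)
    show ?thesis using conv_pair[OF V] y(2) V by (intro bexI[of _ y]) simp_all
  qed
  obtain v where v: "v \<in> fst G" "W = {z \<in> fst G. between (\<phi> u) (\<phi> z) (\<phi> v)}" using anti[OF u(1)] by blast
  define D where "D = sym_diff (\<phi> u) (\<phi> v)"
  have btw: "between (\<phi> u) t (\<phi> v) \<longleftrightarrow> t - D = \<phi> u - D" for t
  proof -
    have "between (\<phi> u) t (\<phi> v) \<longleftrightarrow> (\<forall>h. h \<notin> D \<longrightarrow> (h \<in> t \<longleftrightarrow> h \<in> \<phi> u))"
      unfolding between_def D_def by auto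
    then show ?thesis by auto
  qed
  have WD: "W = {z \<in> fst G. \<phi> z - D = \<phi> u - D}" using v(2) btw by simp
  moreover have "sym_diff t D \<in> T" if t: "t \<in> T" "t - D = \<phi> u - D" for t
  proof -
    obtain x where x: "x \<in> fst G" "t = \<phi> x" using phi_obtain[OF t(1)] .
    then have "x \<in> W" using WD t by simp
    then obtain y where y: "y \<in> fst G" "W = {z \<in> fst G. between (\<phi> x) (\<phi> z) (\<phi> y)}" using anti by blast
    have yW: "y \<in> W" using y by (auto simp: between_def)
    have uW: "between (\<phi> x) (\<phi> u) (\<phi> y)" using u y(2) by blast
    have "v \<in> W" using v by (auto simp: between_def)
    then have vW: "between (\<phi> x) (\<phi> v) (\<phi> y)" using y(2) by blast
    have "\<phi> y - D = \<phi> u - D" using yW WD by blast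
    have "\<phi> y = sym_diff t D"
    proof (rule set_eqI)
      fix h
      show "h \<in> \<phi> y \<longleftrightarrow> h \<in> sym_diff t D"
        using uW[unfolded between_def, rule_format, of h] vW[unfolded between_def, rule_format, of h]
          eqset_imp_iff[OF \<open>\<phi> y - D = \<phi> u - D\<close>, of h] eqset_imp_iff[OF t(2), of h] x(2)
        by (auto simp: D_def)
    qed
    then show ?thesis using phi_mem[OF y(1)] by simp
  qed
  ultimately show "\<exists>u\<in>fst G. \<exists>D. W = {z \<in> fst G. \<phi> z - D = \<phi> u - D} \<and>
     (\<forall>t\<in>T. t - D = \<phi> u - D \<longrightarrow> sym_diff t D \<in> T)" using u(2) by (intro bexI[of _ u] exI[of _ D]) auto
next
  assume "\<exists>u\<in>fst G. \<exists>D. W = {z \<in> fst G. \<phi> z - D = \<phi> u - D} \<and>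
     (\<forall>t\<in>T. t - D = \<phi> u - D \<longrightarrow> sym_diff t D \<in> T)"
  then obtain u D where u: "u \<in> fst G" and W: "W = {z \<in> fst G. \<phi> z - D = \<phi> u - D}"
    and sym: "\<And>t. t \<in> T \<Longrightarrow> t - D = \<phi> u - D \<Longrightarrow> sym_diff t D \<in> T" by (elim bexE exE conjE) (rule that, assumption+, drule (1) bspec, erule (1) mp)
  show "antipodal G W"
    unfolding antipodal_def
  proof (intro conjI ballI)
    fix x assume "x \<in> W"
    then have x: "x \<in> fst G" "\<phi> x - D = \<phi> u - D" using W by auto
    obtain y where y: "y \<in> fst G" "sym_diff (\<phi> x) D = \<phi> y"
      using phi_obtain[OF sym[OF phi_mem[OF x(1)] x(2)]] .
    have btw: "between (\<phi> x) t (\<phi> y) \<longleftrightarrow> t - D = \<phi> u - D" for t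
    proof -
      have "between (\<phi> x) t (\<phi> y) \<longleftrightarrow> (\<forall>h. h \<notin> D \<longrightarrow> (h \<in> t \<longleftrightarrow> h \<in> \<phi> x))"
        unfolding between_def y(2)[symmetric] by auto
      then show ?thesis using x(2) by auto
    qed
    have "conv G {x, y} = W" using conv_pair[OF x(1) y(1)] btw W by simp
    moreover have "\<phi> y - D = \<phi> u - D" using y(2) x(2) by auto
    ultimately show "\<exists>y\<in>W. conv G {x, y} = W" using W y(1) by blast
  qed (use W u in auto)
qed

text \<open>A gate of \<open>t\<close> lies between \<open>t\<close> and \<open>u\<close> and also
  between \<open>t\<close> and the antipode of \<open>u\<close>. On \<open>D\<close> these two
  differ everywhere, so the gate must copy \<open>t\<close> there.\<close>

lemma gated_face_iff:
  assumes u: "u \<in> fst G" and sym: "\<And>t. t \<in> T \<Longrightarrow> t - D = \<phi> u - D \<Longrightarrow> sym_diff t D \<in> T"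
  shows "gated G {z \<in> fst G. \<phi> z - D = \<phi> u - D} \<longleftrightarrow> (\<forall>t\<in>T. (\<phi> u - D) \<union> (t \<inter> D) \<in> T)"
    (is "gated G ?W \<longleftrightarrow> _")
proof
  assume g: "gated G ?W"
  show "\<forall>t\<in>T. (\<phi> u - D) \<union> (t \<inter> D) \<in> T"
  proof
    fix t assume "t \<in> T"
    then obtain x where x: "x \<in> fst G" "t = \<phi> x" by (rule phi_obtain)
    have "\<exists>x'\<in>?W. \<forall>y\<in>?W. between (\<phi> x) (\<phi> x') (\<phi> y)" using g x(1) unfolding gated_iff by simp
    then obtain x' where x': "x' \<in> ?W" and x'': "\<forall>y\<in>?W. between (\<phi> x) (\<phi> x') (\<phi> y)" by (elim bexE)
    obtain v where v: "v \<in> fst G" "sym_diff (\<phi> u) D = \<phi> v"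
      using phi_obtain[OF sym[OF phi_mem[OF u] refl]] .
    have "\<phi> v - D = \<phi> u - D" unfolding v(2)[symmetric] by auto
    then have b: "between t (\<phi> x') (\<phi> u)" "between t (\<phi> x') (\<phi> v)" using x'' u v(1) x(2) by simp_all
    have "\<phi> x' - D = \<phi> u - D" using x' by simp
    have "\<phi> x' = (\<phi> u - D) \<union> (t \<inter> D)"
    proof (rule set_eqI)
      fix h show "h \<in> \<phi> x' \<longleftrightarrow> h \<in> (\<phi> u - D) \<union> (t \<inter> D)"
        using b(1)[unfolded between_def, rule_format, of h] b(2)[unfolded between_def, rule_format, of h]
          eqset_imp_iff[OF \<open>\<phi> x' - D = \<phi> u - D\<close>, of h] eqset_imp_iff[OF v(2), of h] by auto
    qed
    then show "(\<phi> u - D) \<union> (t \<inter> D) \<in> T" using phi_mem[of x'] x'(1) by simp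
  qed
next
  assume g: "\<forall>t\<in>T. (\<phi> u - D) \<union> (t \<inter> D) \<in> T"
  show "gated G ?W"
    unfolding gated_iff
  proof (intro conjI ballI)
    fix x assume x: "x \<in> fst G"
    obtain x' where x': "x' \<in> fst G" "(\<phi> u - D) \<union> (\<phi> x \<inter> D) = \<phi> x'"
      using phi_obtain[OF g[rule_format, OF phi_mem[OF x]]] .
    have x'D: "\<phi> x' - D = \<phi> u - D" unfolding x'(2)[symmetric] by auto
    have "between (\<phi> x) (\<phi> x') (\<phi> y)" if "y \<in> ?W" for y
      unfolding between_def
    proof (intro allI impI)
      fix h assume h: "h \<in> \<phi> x \<longleftrightarrow> h \<in> \<phi> y"
      have "\<phi> y - D = \<phi> u - D" using that by simp
      then show "h \<in> \<phi> x' \<longleftrightarrow> h \<in> \<phi> x"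
        using eqset_imp_iff[OF x'(2), of h] h eqset_imp_iff[of "\<phi> y - D" "\<phi> u - D" h] by auto
    qed
    then show "\<exists>x'\<in>?W. \<forall>y\<in>?W. between (\<phi> x) (\<phi> x') (\<phi> y)"
      using x'(1) x'D by (intro bexI[of _ x'] ballI) simp_all
  qed simp
qed

lemma all_antipodal_gated_iff: "(\<forall>W. antipodal G W \<longrightarrow> gated G W) \<longleftrightarrow> ag_family T"
proof
  assume a: "\<forall>W. antipodal G W \<longrightarrow> gated G W"
  show "ag_family T"
    unfolding ag_family_def
  proof (intro ballI allI impI)
    fix u D t assume u: "u \<in> T" and s: "\<forall>t\<in>T. t - D = u - D \<longrightarrow> sym_diff t D \<in> T" and t: "t \<in> T"
    obtain x where x: "x \<in> fst G" "u = \<phi> x" using phi_obtain[OF u] .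
    let ?W = "{z \<in> fst G. \<phi> z - D = \<phi> x - D}"
    have "antipodal G ?W" unfolding antipodal_iff using x s by (intro bexI[of _ x] exI[of _ D]) simp_all
    then have "gated G ?W" using a by blast
    then show "(u - D) \<union> (t \<inter> D) \<in> T" using gated_face_iff[OF x(1), of D] s x(2) t by simp
  qed
next
  assume a: "ag_family T"
  show "\<forall>W. antipodal G W \<longrightarrow> gated G W"
  proof (intro allI impI)
    fix W assume "antipodal G W"
    then obtain u D where u: "u \<in> fst G" and W: "W = {z \<in> fst G. \<phi> z - D = \<phi> u - D}"
      and sym: "\<And>t. t \<in> T \<Longrightarrow> t - D = \<phi> u - D \<Longrightarrow> sym_diff t D \<in> T"
      unfolding antipodal_iff
      by (elim bexE exE conjE) (rule that, assumption+, drule (1) bspec, erule (1) mp)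
    have "(\<phi> u - D) \<union> (t \<inter> D) \<in> T" if "t \<in> T" for t
      by (rule ag_familyD[OF a phi_mem[OF u] that sym])
    then show "gated G W" using gated_face_iff[OF u sym] W by simp
  qed
qed

end

section \<open>Theta classes and minors\<close>

context cube_rep
begin

definition coord_class :: "'e \<Rightarrow> ('a \<times> 'a) set" where
  "coord_class e = {(x, y) \<in> snd G. sym_diff (\<phi> x) (\<phi> y) = {e}}"

definition nonconstant :: "'e \<Rightarrow> bool" where
  "nonconstant e \<longleftrightarrow> (\<exists>x\<in>T. e \<in> x) \<and> (\<exists>x\<in>T. e \<notin> x)"

lemma edge_phi: "sym_diff a b = {e} \<Longrightarrow> b = sym_diff a {e}"
proof (rule set_eqI)
  fix h assume "sym_diff a b = {e}"
  from eqset_imp_iff[OF this, of h] show "h \<in> b \<longleftrightarrow> h \<in> sym_diff a {e}" by auto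
qed

text \<open>Toggling one coordinate changes a Hamming distance by one, up or down according to
  whether the two sets agree there. For distinct coordinates the changes at the two ends add up; for
  equal ones the second toggle undoes the first.\<close>

lemma theta_edges:
  assumes xy: "(x, y) \<in> snd G" "sym_diff (\<phi> x) (\<phi> y) = {e}"
    and uv: "(u, v) \<in> snd G" "sym_diff (\<phi> u) (\<phi> v) = {f}"
  shows "theta G (x, y) (u, v) \<longleftrightarrow> e = f"
proof -
  note V = edge_mem[OF xy(1)] edge_mem[OF uv(1)]
  define a where "a = \<phi> x"
  define b where "b = \<phi> u"
  have y: "\<phi> y = sym_diff a {e}" and v: "\<phi> v = sym_diff b {f}"
    using edge_phi[OF xy(2)] edge_phi[OF uv(2)] by (simp_all add: a_def b_def)
  have fab: "finite a" "finite b" using fin V by (simp_all add: a_def b_def)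
  have fb: "finite (sym_diff b {f})" using fab by simp
  have bf: "card (sym_diff a (sym_diff b {f})) = card (sym_diff (sym_diff b {f}) a)"
    "card (sym_diff a b) = card (sym_diff b a)" by (simp_all only: Un_commute)
  have mem: "f \<in> sym_diff b a \<longleftrightarrow> f \<in> sym_diff a b"
    "e \<in> sym_diff a (sym_diff b {f}) \<longleftrightarrow> (e \<in> sym_diff a b) \<noteq> (e = f)" by auto
  define p where "p \<longleftrightarrow> e \<in> sym_diff a b"
  define q where "q \<longleftrightarrow> f \<in> sym_diff a b"
  define c0 where "c0 = card (sym_diff a b)"
  define c1 where "c1 = card (sym_diff (sym_diff a {e}) b)"
  define c2 where "c2 = card (sym_diff a (sym_diff b {f}))"
  define c3 where "c3 = card (sym_diff (sym_diff a {e}) (sym_diff b {f}))"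
  have s1: "p \<Longrightarrow> Suc c1 = c0" "\<not> p \<Longrightarrow> c1 = Suc c0"
    unfolding p_def c0_def c1_def using card_sym_diff_single[OF fab, of e] by blast+
  have s2: "q \<Longrightarrow> Suc c2 = c0" "\<not> q \<Longrightarrow> c2 = Suc c0"
    unfolding q_def c0_def c2_def bf mem(1)[symmetric] using card_sym_diff_single[OF fab(2,1), of f] by blast+
  have s3: "p \<noteq> (e = f) \<Longrightarrow> Suc c3 = c2" "\<not> (p \<noteq> (e = f)) \<Longrightarrow> c3 = Suc c2"
    unfolding p_def mem(2)[symmetric] c3_def c2_def using card_sym_diff_single[OF fab(1) fb, of e] by blast+
  have pq: "e = f \<Longrightarrow> p = q" by (simp add: p_def q_def)
  have "theta G (x, y) (u, v) \<longleftrightarrow>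
    c0 + c3 \<noteq> c2 + c1"
    unfolding theta_def split dist[OF V(1,3)] dist[OF V(2,4)] dist[OF V(1,4)] dist[OF V(2,3)]
      y v a_def[symmetric] b_def[symmetric] c0_def c1_def c2_def c3_def by (rule refl)
  also have "\<dots> \<longleftrightarrow> e = f"
    using s1 s2 s3 pq by (cases "e = f"; cases p; cases q) auto
  finally show ?thesis .
qed

lemma edge_with_coord:
  "x \<in> fst G \<Longrightarrow> y \<in> fst G \<Longrightarrow> e \<in> sym_diff (\<phi> x) (\<phi> y) \<Longrightarrow>
    \<exists>u z. (u, z) \<in> snd G \<and> sym_diff (\<phi> u) (\<phi> z) = {e}"
proof (induction "d x y" arbitrary: x rule: less_induct)
  case less
  have "x \<noteq> y" using less.prems(3) by auto
  then obtain f z where z: "z \<in> fst G" "\<phi> z = sym_diff (\<phi> x) {f}" "f \<in> sym_diff (\<phi> x) (\<phi> y)"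
    "(x, z) \<in> snd G" using toggle less.prems by metis
  show ?case
  proof (cases "f = e")
    case True
    have "sym_diff (\<phi> x) (\<phi> z) = {e}" unfolding z(2) True by auto
    then show ?thesis using z(4) by blast
  next
    case False
    have "Suc (d z y) = d x y"
      unfolding z(2) by (rule card_sym_diff_single(1)[OF fin fin z(3)]) (use less.prems in simp_all)
    moreover have "e \<in> sym_diff (\<phi> z) (\<phi> y)" unfolding z(2) using False less.prems(3) by auto
    ultimately show ?thesis using less.hyps[of z] z(1) less.prems(2) by simp
  qed
qed

lemma theta_class_iff: "theta_class G C \<longleftrightarrow> (\<exists>e. nonconstant e \<and> C = coord_class e)"
proof -
  have cc: "{f \<in> snd G. theta G (x, y) f} = coord_class e"
    if "(x, y) \<in> snd G" "sym_diff (\<phi> x) (\<phi> y) = {e}" for x y e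
  proof (rule set_eqI)
    fix f :: "'a \<times> 'a"
    obtain u v where f: "f = (u, v)" by (cases f)
    show "f \<in> {f \<in> snd G. theta G (x, y) f} \<longleftrightarrow> f \<in> coord_class e"
    proof (cases "(u, v) \<in> snd G")
      case True
      obtain k where k: "sym_diff (\<phi> u) (\<phi> v) = {k}" using edge_obtain[OF True] .
      show ?thesis using theta_edges[OF that True k] True k f by (auto simp: coord_class_def)
    qed (simp add: f coord_class_def)
  qed
  show ?thesis
  proof
    assume "theta_class G C"
    then obtain x y where xy: "(x, y) \<in> snd G" "C = {f \<in> snd G. theta G (x, y) f}"
      by (auto simp: theta_class_def)
    obtain e where e: "sym_diff (\<phi> x) (\<phi> y) = {e}" using edge_obtain[OF xy(1)] .
    have "(e \<in> \<phi> x) \<noteq> (e \<in> \<phi> y)" using eqset_imp_iff[OF e, of e] by auto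
    then have "nonconstant e" unfolding nonconstant_def
      using phi_mem[OF edge_mem(1)[OF xy(1)]] phi_mem[OF edge_mem(2)[OF xy(1)]] by metis
    then show "\<exists>e. nonconstant e \<and> C = coord_class e" using cc[OF xy(1) e] xy(2) by blast
  next
    assume "\<exists>e. nonconstant e \<and> C = coord_class e"
    then obtain e s t where e: "C = coord_class e" and st: "s \<in> T" "t \<in> T" "e \<in> s" "e \<notin> t"
      by (auto simp: nonconstant_def)
    obtain x where x: "x \<in> fst G" "s = \<phi> x" using phi_obtain[OF st(1)] .
    obtain y where y: "y \<in> fst G" "t = \<phi> y" using phi_obtain[OF st(2)] .
    obtain u z where uz: "(u, z) \<in> snd G" "sym_diff (\<phi> u) (\<phi> z) = {e}"
      using edge_with_coord[OF x(1) y(1), of e] st x y by auto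
    show "theta_class G C" unfolding theta_class_def e cc[OF uz, symmetric]
      by (rule bexI[of _ "(u, z)"]) (simp_all add: uz(1))
  qed
qed

end

section \<open>Halfspaces, fibres of a contraction, convex restrictions\<close>

lemma reach_iff_rtrancl:
  assumes "snd H \<subseteq> fst H \<times> fst H"
  shows "reach H x y \<longleftrightarrow> x \<in> fst H \<and> (x, y) \<in> (snd H)\<^sup>*"
proof
  have "is_walk H ps x y \<Longrightarrow> (x, y) \<in> (snd H)\<^sup>*" for ps
  proof (induction ps arbitrary: x)
    case (Cons p ps)
    then show ?case
      by (cases ps) (auto simp: is_walk_single is_walk_Cons_Cons intro: converse_rtrancl_into_rtrancl)
  qed (simp add: is_walk_def)
  then show "reach H x y \<Longrightarrow> x \<in> fst H \<and> (x, y) \<in> (snd H)\<^sup>*"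
    using is_walk_mem unfolding reach_def by metis
next
  assume a: "x \<in> fst H \<and> (x, y) \<in> (snd H)\<^sup>*"
  then have "(x, y) \<in> (snd H)\<^sup>*" "x \<in> fst H" by auto
  then show "reach H x y"
  proof (induction rule: converse_rtrancl_induct)
    case base
    then show ?case unfolding reach_def by (intro exI[of _ "[y]"]) (simp add: is_walk_single)
  next
    case (step x z)
    then obtain ps where ps: "is_walk H ps z y" using assms by (auto simp: reach_def)
    then obtain qs where "ps = z # qs" by (cases ps) (auto simp: is_walk_def)
    then have "is_walk H (x # ps) x y" using ps step by (simp add: is_walk_Cons_Cons)
    then show ?case by (auto simp: reach_def)
  qed
qed

context cube_rep
begin

text \<open>A geodesic between two vertices on the same side of \<open>e\<close> never flips
  \<open>e\<close>, so each side stays connected once the edges flipping \<open>e\<close> are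
  removed.\<close>

lemma component_minus_coord_class:
  assumes x: "x \<in> fst G"
  shows "component (fst G, snd G - coord_class e) x = {y \<in> fst G. e \<in> \<phi> y \<longleftrightarrow> e \<in> \<phi> x}"
proof -
  let ?H = "(fst G, snd G - coord_class e)"
  have sub: "snd ?H \<subseteq> fst ?H \<times> fst ?H" using graph by (auto simp: is_graph_def)
  have inv: "e \<in> \<phi> y \<longleftrightarrow> e \<in> \<phi> x" if "(x, y) \<in> (snd ?H)\<^sup>*" for y
    using that
  proof (induction rule: rtrancl_induct)
    case (step y z)
    obtain f where f: "sym_diff (\<phi> y) (\<phi> z) = {f}" using edge_obtain step.hyps(2) by auto
    then have "f \<noteq> e" using step.hyps(2) by (auto simp: coord_class_def)
    then show ?case using step.IH eqset_imp_iff[OF f, of e] by auto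
  qed simp
  have conn: "y \<in> fst G \<Longrightarrow> x \<in> fst G \<Longrightarrow> e \<in> \<phi> y \<longleftrightarrow> e \<in> \<phi> x \<Longrightarrow> (x, y) \<in> (snd ?H)\<^sup>*" for x y
  proof (induction "d x y" arbitrary: x rule: less_induct)
    case less
    show ?case
    proof (cases "x = y")
      case False
      then obtain f z where z: "z \<in> fst G" "\<phi> z = sym_diff (\<phi> x) {f}" "f \<in> sym_diff (\<phi> x) (\<phi> y)"
        "(x, z) \<in> snd G" using toggle less.prems by metis
      have fe: "f \<noteq> e" using z(3) less.prems(3) by auto
      have "Suc (d z y) = d x y"
        unfolding z(2) by (rule card_sym_diff_single(1)[OF fin fin z(3)]) (use less.prems in simp_all)
      moreover have "e \<in> \<phi> y \<longleftrightarrow> e \<in> \<phi> z" unfolding z(2) using fe less.prems(3) by auto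
      ultimately have zy: "(z, y) \<in> (snd ?H)\<^sup>*" using less.hyps[of z] z(1) less.prems(1) by simp
      have "sym_diff (\<phi> x) (\<phi> z) = {f}" unfolding z(2) by auto
      then have "(x, z) \<in> snd ?H" using z(4) fe by (auto simp: coord_class_def)
      then show ?thesis using zy by (rule converse_rtrancl_into_rtrancl)
    qed simp
  qed
  show ?thesis
  proof (rule set_eqI)
    fix y
    have "y \<in> component ?H x \<longleftrightarrow> y \<in> fst G \<and> (x, y) \<in> (snd ?H)\<^sup>*"
      unfolding component_def reach_iff_rtrancl[OF sub] using x by simp
    then show "y \<in> component ?H x \<longleftrightarrow> y \<in> {y \<in> fst G. e \<in> \<phi> y \<longleftrightarrow> e \<in> \<phi> x}"
      using inv[of y] conn[of y x] x by blast
  qed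
qed

lemma halfspace_iff:
  "halfspace G (coord_class e) W \<longleftrightarrow> (\<exists>x\<in>fst G. W = {y \<in> fst G. e \<in> \<phi> y \<longleftrightarrow> e \<in> \<phi> x})"
  unfolding halfspace_def using component_minus_coord_class by (intro bex_cong) simp_all

lemma component_coord_class:
  assumes x: "x \<in> fst G"
  shows "component (fst G, coord_class e) x = {y \<in> fst G. \<phi> y - {e} = \<phi> x - {e}}"
proof -
  let ?H = "(fst G, coord_class e)"
  have sub: "snd ?H \<subseteq> fst ?H \<times> fst ?H" using graph by (auto simp: is_graph_def coord_class_def)
  have inv: "\<phi> y - {e} = \<phi> x - {e}" if "(x, y) \<in> (snd ?H)\<^sup>*" for y
    using that
  proof (induction rule: rtrancl_induct)
    case (step y z)
    then have "sym_diff (\<phi> y) (\<phi> z) = {e}" by (simp add: coord_class_def)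
    then have "\<phi> z = sym_diff (\<phi> y) {e}" by (rule edge_phi)
    then have "\<phi> z - {e} = \<phi> y - {e}" by auto
    then show ?case using step.IH by simp
  qed simp
  have conn: "(x, y) \<in> (snd ?H)\<^sup>*" if "y \<in> fst G" "\<phi> y - {e} = \<phi> x - {e}" for y
  proof (cases "e \<in> \<phi> x \<longleftrightarrow> e \<in> \<phi> y")
    case True
    have "\<phi> x = \<phi> y"
    proof (rule set_eqI)
      fix h show "h \<in> \<phi> x \<longleftrightarrow> h \<in> \<phi> y"
        using eqset_imp_iff[OF that(2), of h] True by (cases "h = e") auto
    qed
    then show ?thesis using phi_inj[OF x that(1)] by simp
  next
    case False
    have s: "sym_diff (\<phi> x) (\<phi> y) = {e}"
    proof (rule set_eqI)
      fix h show "h \<in> sym_diff (\<phi> x) (\<phi> y) \<longleftrightarrow> h \<in> {e}"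
        using eqset_imp_iff[OF that(2), of h] False by (cases "h = e") auto
    qed
    then have "(x, y) \<in> snd G" using edge[OF x that(1)] by simp
    then show ?thesis using s by (auto simp: coord_class_def)
  qed
  show ?thesis
  proof (rule set_eqI)
    fix y
    have "y \<in> component ?H x \<longleftrightarrow> y \<in> fst G \<and> (x, y) \<in> (snd ?H)\<^sup>*"
      unfolding component_def reach_iff_rtrancl[OF sub] using x by simp
    then show "y \<in> component ?H x \<longleftrightarrow> y \<in> {y \<in> fst G. \<phi> y - {e} = \<phi> x - {e}}"
      using inv[of y] conn[of y] by blast
  qed
qed

text \<open>\<open>K\<close> is a convex set of cube vertices, so the step towards \<open>y\<close>
  granted by \<open>cubical\<close> stays inside it.\<close>

lemma induced_rep:
  assumes K: "\<And>a b z. a \<in> K \<Longrightarrow> b \<in> K \<Longrightarrow> between a z b \<Longrightarrow> z \<in> K"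
    and W: "\<And>x. x \<in> fst G \<Longrightarrow> x \<in> W \<longleftrightarrow> \<phi> x \<in> K"
  shows "cube_rep (induced G W) (T \<inter> K) \<phi>"
proof
  show "is_graph (induced G W)" using graph by (auto simp: is_graph_def induced_def sym_def)
  have "\<exists>e\<in>sym_diff x y. sym_diff x {e} \<in> T \<inter> K" if xy: "x \<in> T" "x \<in> K" "y \<in> T" "y \<in> K" "x \<noteq> y" for x y
  proof -
    obtain e where e: "e \<in> sym_diff x y" "sym_diff x {e} \<in> T"
      using cubicalD(3)[OF cub xy(1,3,5)] by (elim bexE)
    have "between x (sym_diff x {e}) y" unfolding between_def using e(1) by auto
    then have "sym_diff x {e} \<in> K" by (rule K[OF xy(2,4)])
    then show ?thesis using e by (intro bexI[of _ e] IntI)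
  qed
  then show "cubical (T \<inter> K)" using cub unfolding cubical_def by simp
  have "\<phi> ` (fst G \<inter> W) = T \<inter> K" using W bij by (auto simp: bij_betw_def)
  then show "bij_betw \<phi> (fst (induced G W)) (T \<inter> K)"
    using bij by (auto simp: bij_betw_def induced_def intro: inj_on_subset)
  show "(x, y) \<in> snd (induced G W) \<longleftrightarrow> card (sym_diff (\<phi> x) (\<phi> y)) = 1"
    if "x \<in> fst (induced G W)" "y \<in> fst (induced G W)" for x y
    using edge[of x y] that by (simp add: induced_def)
qed

end

text \<open>A face that is antipodal in \<open>T \<inter> K\<close> lies in the interval between
  \<open>u\<close> and its antipode, hence in \<open>K\<close> by convexity. So it is antipodal in
  \<open>T\<close> as well, and its gates, being in the same interval, are in
  \<open>K\<close>.\<close>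

lemma ag_family_Int:
  assumes T: "ag_family T" and K: "\<And>a b z. a \<in> K \<Longrightarrow> b \<in> K \<Longrightarrow> between a z b \<Longrightarrow> z \<in> K"
  shows "ag_family (T \<inter> K)"
  unfolding ag_family_def
proof (intro ballI allI impI)
  fix u D t
  assume u: "u \<in> T \<inter> K" and t: "t \<in> T \<inter> K"
    and "\<forall>t\<in>T \<inter> K. t - D = u - D \<longrightarrow> sym_diff t D \<in> T \<inter> K"
  then have sym: "x \<in> T \<inter> K \<Longrightarrow> x - D = u - D \<Longrightarrow> sym_diff x D \<in> T \<inter> K" for x by simp
  have face: "x \<in> K" if "x - D = u - D" for x
  proof (rule K)
    show "u \<in> K" using u by simp
    show "sym_diff u D \<in> K" using sym[OF u refl] by simp
    show "between u x (sym_diff u D)"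
      unfolding between_def
    proof (intro allI impI)
      fix h assume "h \<in> u \<longleftrightarrow> h \<in> sym_diff u D"
      then show "h \<in> x \<longleftrightarrow> h \<in> u" using eqset_imp_iff[OF that, of h] by auto
    qed
  qed
  have "(u - D) \<union> (t \<inter> D) \<in> T"
  proof (rule ag_familyD[OF T])
    show "u \<in> T" "t \<in> T" using u t by simp_all
    show "sym_diff x D \<in> T" if "x \<in> T" "x - D = u - D" for x
      using sym[of x] that face[OF that(2)] by simp
  qed
  moreover have "(u - D) \<union> (t \<inter> D) \<in> K" by (rule face) auto
  ultimately show "(u - D) \<union> (t \<inter> D) \<in> T \<inter> K" by simp
qed

text \<open>Vertices of minors are sets that contraction merges by union. Nonemptiness and
  disjointness ensure that different fibres have different unions.\<close>

locale disjoint_cube_rep = cube_rep G T \<phi>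
  for G :: "'a set graph" and T :: "'e set set" and \<phi> +
  assumes nonempty: "X \<in> fst G \<Longrightarrow> X \<noteq> {}"
    and disjoint: "X \<in> fst G \<Longrightarrow> Y \<in> fst G \<Longrightarrow> X \<inter> Y \<noteq> {} \<Longrightarrow> X = Y"
begin

abbreviation merge where "merge e X \<equiv> cunion G (coord_class e) X"

lemma mem_merge: "X \<in> fst G \<Longrightarrow> p \<in> merge e X \<longleftrightarrow> (\<exists>Y\<in>fst G. \<phi> Y - {e} = \<phi> X - {e} \<and> p \<in> Y)"
  unfolding cunion_def component_coord_class by auto

lemma merge_inter:
  assumes "X \<in> fst G" "Y \<in> fst G" "merge e X \<inter> merge e Y \<noteq> {}"
  shows "\<phi> X - {e} = \<phi> Y - {e}"
proof -
  obtain p where "p \<in> merge e X" "p \<in> merge e Y" using assms by blast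
  then obtain X' Y' where X': "X' \<in> fst G" "\<phi> X' - {e} = \<phi> X - {e}" "p \<in> X'"
    and Y': "Y' \<in> fst G" "\<phi> Y' - {e} = \<phi> Y - {e}" "p \<in> Y'"
    using mem_merge[OF assms(1)] mem_merge[OF assms(2)] by metis
  have "X' = Y'" by (rule disjoint) (use X' Y' in blast)+
  then show ?thesis using X' Y' by simp
qed

lemma merge_nonempty: "X \<in> fst G \<Longrightarrow> merge e X \<noteq> {}"
  using mem_merge[of X] nonempty[of X] by blast

lemma merge_eq_iff:
  assumes "X \<in> fst G" "Y \<in> fst G"
  shows "merge e X = merge e Y \<longleftrightarrow> \<phi> X - {e} = \<phi> Y - {e}"
proof
  assume "merge e X = merge e Y"
  then have "merge e X \<inter> merge e Y \<noteq> {}" using merge_nonempty[OF assms(1), of e] by simp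
  then show "\<phi> X - {e} = \<phi> Y - {e}" by (rule merge_inter[OF assms])
next
  assume "\<phi> X - {e} = \<phi> Y - {e}"
  then show "merge e X = merge e Y" using mem_merge[OF assms(1)] mem_merge[OF assms(2)] by (intro set_eqI) simp
qed

text \<open>If the step from \<open>x\<close> towards \<open>y\<close> flips \<open>e\<close>, it is
  invisible after contraction; the next step cannot flip \<open>e\<close> again.\<close>

lemma cubical_contraction: "cubical ((\<lambda>t. t - {e}) ` T)"
  unfolding cubical_def
proof (intro conjI ballI impI)
  show "finite ((\<lambda>t. t - {e}) ` T)" using cubicalD(1)[OF cub] by simp
  show "finite t" if "t \<in> (\<lambda>t. t - {e}) ` T" for t using that cubicalD(2)[OF cub] by auto
next
  fix x' y' assume "x' \<in> (\<lambda>t. t - {e}) ` T" "y' \<in> (\<lambda>t. t - {e}) ` T" and ne: "x' \<noteq> y'"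
  then obtain x y where x: "x \<in> T" "x' = x - {e}" and y: "y \<in> T" "y' = y - {e}" by blast
  have step: "\<exists>k\<in>sym_diff x' y'. sym_diff x' {k} \<in> (\<lambda>t. t - {e}) ` T"
    if z: "z \<in> T" "z - {e} = x'" "k \<in> sym_diff z y" "sym_diff z {k} \<in> T" "k \<noteq> e" for z k
  proof
    have "sym_diff x' {k} = sym_diff z {k} - {e}" unfolding z(2)[symmetric] using z(5) by auto
    then show "sym_diff x' {k} \<in> (\<lambda>t. t - {e}) ` T" using z(4) by (rule image_eqI)
    show "k \<in> sym_diff x' y'" unfolding z(2)[symmetric] y(2) using z(3,5) by auto
  qed
  have "x \<noteq> y" using ne x y by blast
  then obtain k where k: "k \<in> sym_diff x y" "sym_diff x {k} \<in> T"
    using cubicalD(3)[OF cub x(1) y(1)] by metis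
  show "\<exists>k\<in>sym_diff x' y'. sym_diff x' {k} \<in> (\<lambda>t. t - {e}) ` T"
  proof (cases "k = e")
    case False
    then show ?thesis using step[OF x(1) x(2)[symmetric] k] by blast
  next
    case True
    let ?z = "sym_diff x {e}"
    have z: "?z \<in> T" "?z - {e} = x'" using k True x(2) by auto
    then have "?z \<noteq> y" using ne y(2) by metis
    then obtain l where l: "l \<in> sym_diff ?z y" "sym_diff ?z {l} \<in> T"
      using cubicalD(3)[OF cub z(1) y(1)] by metis
    have "l \<noteq> e" using l(1) k(1) True by auto
    then show ?thesis using step[OF z l] by blast
  qed
qed

lemma contract_rep: "\<exists>\<phi>'. disjoint_cube_rep (contract G (coord_class e)) ((\<lambda>t. t - {e}) ` T) \<phi>'"
proof -
  define \<phi>' where "\<phi>' P = \<phi> (SOME X. X \<in> fst G \<and> P = merge e X) - {e}" for P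
  have \<phi>': "\<phi>' (merge e X) = \<phi> X - {e}" if X: "X \<in> fst G" for X
  proof -
    define Y where "Y = (SOME Y. Y \<in> fst G \<and> merge e X = merge e Y)"
    have "Y \<in> fst G \<and> merge e X = merge e Y"
      unfolding Y_def by (rule someI[where x = X]) (simp add: X)
    then have "\<phi> X - {e} = \<phi> Y - {e}" using merge_eq_iff[OF X, of Y] by blast
    then show ?thesis by (simp add: \<phi>'_def Y_def)
  qed
  let ?C = "contract G (coord_class e)"
  have V: "fst ?C = merge e ` fst G" by (simp add: contract_def)
  have E: "(merge e X, merge e Y) \<in> snd ?C \<longleftrightarrow> (\<exists>X' Y'. (X', Y') \<in> snd G \<and> \<phi> X' - {e} = \<phi> X - {e} \<and>
      \<phi> Y' - {e} = \<phi> Y - {e} \<and> \<phi> X' - {e} \<noteq> \<phi> Y' - {e})" (is "?L \<longleftrightarrow> ?R")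
    if X: "X \<in> fst G" "Y \<in> fst G" for X Y
  proof -
    have "?L \<longleftrightarrow> (\<exists>X' Y'. (X', Y') \<in> snd G \<and> merge e X = merge e X' \<and> merge e Y = merge e Y' \<and>
        merge e X' \<noteq> merge e Y')"
      unfolding contract_def snd_conv mem_Collect_eq prod.inject
      by (intro ex_cong1 iffI; elim conjE; intro conjI; assumption)
    also have "\<dots> \<longleftrightarrow> ?R"
    proof (intro ex_cong1 conj_cong refl)
      fix X' Y' assume "(X', Y') \<in> snd G"
      note V' = edge_mem[OF this]
      show "merge e X = merge e X' \<longleftrightarrow> \<phi> X' - {e} = \<phi> X - {e}"
        using merge_eq_iff[OF X(1) V'(1)] by metis
      show "merge e Y = merge e Y' \<longleftrightarrow> \<phi> Y' - {e} = \<phi> Y - {e}"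
        using merge_eq_iff[OF X(2) V'(2)] by metis
      show "merge e X' \<noteq> merge e Y' \<longleftrightarrow> \<phi> X' - {e} \<noteq> \<phi> Y' - {e}"
        using merge_eq_iff[OF V'] by metis
    qed
    finally show ?thesis .
  qed
  have edges: "(merge e X, merge e Y) \<in> snd ?C \<longleftrightarrow> card (sym_diff (\<phi> X - {e}) (\<phi> Y - {e})) = 1"
    if X: "X \<in> fst G" and Y: "Y \<in> fst G" for X Y
  proof
    assume "(merge e X, merge e Y) \<in> snd ?C"
    then obtain X' Y' where X': "(X', Y') \<in> snd G" "\<phi> X' - {e} = \<phi> X - {e}"
      "\<phi> Y' - {e} = \<phi> Y - {e}" "\<phi> X' - {e} \<noteq> \<phi> Y' - {e}" using E[OF X Y] by blast
    obtain f where f: "sym_diff (\<phi> X') (\<phi> Y') = {f}" using edge_obtain[OF X'(1)] .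
    have y: "\<phi> Y' = sym_diff (\<phi> X') {f}" by (rule edge_phi[OF f])
    have "f \<noteq> e" using X'(4) unfolding y by auto
    then have "sym_diff (\<phi> X' - {e}) (\<phi> Y' - {e}) = {f}" unfolding y by auto
    then show "card (sym_diff (\<phi> X - {e}) (\<phi> Y - {e})) = 1" using X' by simp
  next
    assume "card (sym_diff (\<phi> X - {e}) (\<phi> Y - {e})) = 1"
    then obtain f where f: "sym_diff (\<phi> X - {e}) (\<phi> Y - {e}) = {f}" by (auto simp: card_1_singleton_iff)
    have fe: "f \<noteq> e" using eqset_imp_iff[OF f, of f] by auto
    have near: "k = e \<or> k = f" if "k \<in> sym_diff (\<phi> X) (\<phi> Y)" for k
      using eqset_imp_iff[OF f, of k] that by auto
    have ne: "\<phi> X - {e} \<noteq> \<phi> Y - {e}" using f by auto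
    then have "X \<noteq> Y" by blast
    \<comment> \<open>\<open>X\<close> and \<open>Y\<close> may lie on different sides of
      \<open>e\<close>, so the first step from \<open>X\<close> flips \<open>e\<close> or
      \<open>f\<close>. Flipping \<open>e\<close> leads to a neighbour of \<open>Y\<close> in the
      fibre of \<open>X\<close>; flipping \<open>f\<close> leads into the fibre of
      \<open>Y\<close>.\<close>
    then obtain k Z where Z: "Z \<in> fst G" "\<phi> Z = sym_diff (\<phi> X) {k}" "k \<in> sym_diff (\<phi> X) (\<phi> Y)"
      "(X, Z) \<in> snd G" using toggle X Y by metis
    show "(merge e X, merge e Y) \<in> snd ?C"
    proof (cases "k = e")
      case True
      have ZX: "\<phi> Z - {e} = \<phi> X - {e}" unfolding Z(2) True by auto
      have "sym_diff (\<phi> Z) (\<phi> Y) = {f}"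
      proof (rule set_eqI)
        fix h show "h \<in> sym_diff (\<phi> Z) (\<phi> Y) \<longleftrightarrow> h \<in> {f}"
          unfolding Z(2) True using eqset_imp_iff[OF f, of h] Z(3) True fe by (cases "h = e") auto
      qed
      then have "(Z, Y) \<in> snd G" using edge[OF Z(1) Y] by simp
      then show ?thesis using E[OF X Y] ZX ne by metis
    next
      case False
      then have kf: "k = f" using near[OF Z(3)] by blast
      have "\<phi> Z - {e} = \<phi> Y - {e}"
      proof (rule set_eqI)
        fix h show "h \<in> \<phi> Z - {e} \<longleftrightarrow> h \<in> \<phi> Y - {e}"
          unfolding Z(2) kf using eqset_imp_iff[OF f, of h] by (cases "h = f") auto
      qed
      then show ?thesis using E[OF X Y] Z(4) ne by metis
    qed
  qed
  have "disjoint_cube_rep ?C ((\<lambda>t. t - {e}) ` T) \<phi>'"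
  proof
    have "sym (snd G)" using graph by (simp add: is_graph_def)
    then have "sym (snd ?C)" unfolding contract_def sym_def snd_conv by blast
    moreover have "snd ?C \<subseteq> fst ?C \<times> fst ?C" unfolding contract_def using edge_mem by auto
    ultimately show "is_graph ?C" unfolding is_graph_def by (auto simp: contract_def)
    show "cubical ((\<lambda>t. t - {e}) ` T)" by (rule cubical_contraction)
    show "bij_betw \<phi>' (fst ?C) ((\<lambda>t. t - {e}) ` T)"
      unfolding bij_betw_def
    proof
      show "inj_on \<phi>' (fst ?C)" unfolding V
      proof (rule inj_onI, elim imageE)
        fix P Q X Y assume "\<phi>' P = \<phi>' Q" "P = merge e X" "X \<in> fst G" "Q = merge e Y" "Y \<in> fst G"
        then show "P = Q" using \<phi>' merge_eq_iff by simp
      qed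
      have "\<phi>' ` fst ?C = (\<lambda>X. \<phi> X - {e}) ` fst G" unfolding V using \<phi>' by (auto simp: image_image)
      also have "\<dots> = (\<lambda>t. t - {e}) ` T" using bij by (auto simp: bij_betw_def)
      finally show "\<phi>' ` fst ?C = (\<lambda>t. t - {e}) ` T" .
    qed
    show "(x, y) \<in> snd ?C \<longleftrightarrow> card (sym_diff (\<phi>' x) (\<phi>' y)) = 1" if xy: "x \<in> fst ?C" "y \<in> fst ?C" for x y
    proof -
      obtain X where X: "X \<in> fst G" "x = merge e X" using xy(1) unfolding V by (elim imageE)
      obtain Y where Y: "Y \<in> fst G" "y = merge e Y" using xy(2) unfolding V by (elim imageE)
      show ?thesis unfolding X(2) Y(2) edges[OF X(1) Y(1)] \<phi>'[OF X(1)] \<phi>'[OF Y(1)] by (rule refl)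
    qed
    show "X \<noteq> {}" if "X \<in> fst ?C" for X
      using that unfolding V by (elim imageE) (simp only: merge_nonempty not_False_eq_True)
    show "P = Q" if P: "P \<in> fst ?C" "Q \<in> fst ?C" "P \<inter> Q \<noteq> {}" for P Q
    proof -
      obtain X where X: "X \<in> fst G" "P = merge e X" using P(1) unfolding V by (elim imageE)
      obtain Y where Y: "Y \<in> fst G" "Q = merge e Y" using P(2) unfolding V by (elim imageE)
      have "merge e X \<inter> merge e Y \<noteq> {}" using P(3) X(2) Y(2) by simp
      then have "\<phi> X - {e} = \<phi> Y - {e}" by (rule merge_inter[OF X(1) Y(1)])
      then show ?thesis using merge_eq_iff[OF X(1) Y(1)] X(2) Y(2) by simp
    qed
  qed
  then show ?thesis by blast
qed

lemma induced_disjoint_rep: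
  assumes K: "\<And>a b z. a \<in> K \<Longrightarrow> b \<in> K \<Longrightarrow> between a z b \<Longrightarrow> z \<in> K"
    and W: "\<And>x. x \<in> fst G \<Longrightarrow> x \<in> W \<longleftrightarrow> \<phi> x \<in> K"
  shows "disjoint_cube_rep (induced G W) (T \<inter> K) \<phi>"
proof -
  interpret I: cube_rep "induced G W" "T \<inter> K" \<phi> by (rule induced_rep[OF K W])
  show ?thesis by unfold_locales (use nonempty disjoint in \<open>auto simp: induced_def\<close>)
qed

lemma restriction_rep:
  assumes "\<forall>C\<in>\<C>. theta_class G C \<and> halfspace G C (h C)"
  shows "\<exists>K. (\<forall>a\<in>K. \<forall>b\<in>K. \<forall>z. between a z b \<longrightarrow> z \<in> K) \<and>
    disjoint_cube_rep (induced G (fst G \<inter> \<Inter> (h ` \<C>))) (T \<inter> K) \<phi>"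
proof -
  have "\<exists>e x. x \<in> fst G \<and> h C = {y \<in> fst G. e \<in> \<phi> y \<longleftrightarrow> e \<in> \<phi> x}" if "C \<in> \<C>" for C
  proof -
    obtain e where e: "C = coord_class e" using assms \<open>C \<in> \<C>\<close> theta_class_iff by blast
    have "halfspace G (coord_class e) (h C)" using assms \<open>C \<in> \<C>\<close> e by simp
    then show ?thesis unfolding halfspace_iff by (elim bexE) (intro exI conjI)
  qed
  then have "\<forall>C\<in>\<C>. \<exists>ex. snd ex \<in> fst G \<and>
      h C = {y \<in> fst G. fst ex \<in> \<phi> y \<longleftrightarrow> fst ex \<in> \<phi> (snd ex)}" by simp
  from bchoice[OF this] obtain f where f: "\<forall>C\<in>\<C>. snd (f C) \<in> fst G \<and>
      h C = {y \<in> fst G. fst (f C) \<in> \<phi> y \<longleftrightarrow> fst (f C) \<in> \<phi> (snd (f C))}" by (elim exE)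
  define e where "e C = fst (f C)" for C
  define x where "x C = snd (f C)" for C
  have ex: "h C = {y \<in> fst G. e C \<in> \<phi> y \<longleftrightarrow> e C \<in> \<phi> (x C)}" if "C \<in> \<C>" for C
    using f that by (simp add: e_def x_def)
  define K where "K = {t. \<forall>C\<in>\<C>. e C \<in> t \<longleftrightarrow> e C \<in> \<phi> (x C)}"
  have K: "z \<in> K" if "a \<in> K" "b \<in> K" "between a z b" for a b z
    using that unfolding K_def between_def by simp
  have "disjoint_cube_rep (induced G (fst G \<inter> \<Inter> (h ` \<C>))) (T \<inter> K) \<phi>"
    by (rule induced_disjoint_rep[OF K]) (auto simp: K_def ex)
  then show ?thesis using K by blast
qed

end

lemma lift_rep:
  assumes "cube_rep G T \<phi>"
  shows "disjoint_cube_rep (lift G) T (\<lambda>X. \<phi> (the_elem X))"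
proof -
  interpret cube_rep G T \<phi> by (rule assms)
  show ?thesis
  proof
    show "is_graph (lift G)" using graph by (auto simp: is_graph_def lift_def sym_def)
    have "inj_on (\<lambda>X. \<phi> (the_elem X)) (fst (lift G))"
      using phi_inj by (auto simp: lift_def inj_on_def)
    moreover have "(\<lambda>X. \<phi> (the_elem X)) ` fst (lift G) = T"
      using bij by (auto simp: lift_def bij_betw_def image_image)
    ultimately show "bij_betw (\<lambda>X. \<phi> (the_elem X)) (fst (lift G)) T" by (simp add: bij_betw_def)
    show "(X, Y) \<in> snd (lift G) \<longleftrightarrow> card (sym_diff (\<phi> (the_elem X)) (\<phi> (the_elem Y))) = 1"
      if "X \<in> fst (lift G)" "Y \<in> fst (lift G)" for X Y
      using that edge by (auto simp: lift_def)
  qed (use cub in \<open>auto simp: lift_def\<close>)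
qed

text \<open>Carries an invariant \<open>P\<close> of set families along a sequence of minor
  operations, on families just intersection with a convex \<open>K\<close> and removal of an
  element. It is applied with \<open>P = ag_family\<close>.\<close>

lemma pc_minor_rep:
  assumes G: "cube_rep G T0 \<phi>0" and T0: "P T0"
    and restr: "\<And>T K. P T \<Longrightarrow> (\<forall>a\<in>K. \<forall>b\<in>K. \<forall>z. between a z b \<longrightarrow> z \<in> K) \<Longrightarrow> P (T \<inter> K)"
    and contr: "\<And>T e. P T \<Longrightarrow> cubical T \<Longrightarrow> P ((\<lambda>t. t - {e}) ` T)"
  shows "H \<in> pc_minors G \<Longrightarrow> \<exists>T \<phi>. disjoint_cube_rep H T \<phi> \<and> P T"
proof (induction rule: pc_minors.induct)
  case base
  then show ?case using lift_rep[OF G] T0 by blast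
next
  case (restr H \<C> h)
  then obtain T \<phi> where T: "disjoint_cube_rep H T \<phi>" "P T" by blast
  then show ?case using disjoint_cube_rep.restriction_rep[OF T(1) restr.hyps(2)] assms(3) by metis
next
  case (contr H C)
  then obtain T \<phi> where T: "disjoint_cube_rep H T \<phi>" "P T" by blast
  then interpret disjoint_cube_rep H T \<phi> by simp
  obtain e where "C = coord_class e" using theta_class_iff contr.hyps(2) by blast
  then show ?case using contract_rep[of e] assms(4)[OF T(2) cub] by blast
qed

section \<open>Families of sets and systems of sign vectors\<close>

definition sv :: "'e set \<Rightarrow> 'e set \<Rightarrow> 'e \<Rightarrow> sign" where
  "sv E t = (\<lambda>e. if e \<in> E then (if e \<in> t then Pos else Neg) else Zer)"

lemma sv_full: "sv E t \<in> full E"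
  by (simp add: sv_def full_def)

lemma sv_eq_iff:
  assumes "sym_diff t u \<subseteq> E"
  shows "sv E t = sv E u \<longleftrightarrow> t = u"
proof
  assume eq: "sv E t = sv E u"
  show "t = u"
  proof (rule set_eqI)
    fix h show "h \<in> t \<longleftrightarrow> h \<in> u"
      using fun_cong[OF eq, of h] assms by (cases "h \<in> E") (auto simp: sv_def split: if_splits)
  qed
qed simp

text \<open>Translates faces: the zeros of \<open>X\<close> in \<open>E\<close> are the free
  coordinates \<open>D\<close> of \<open>ag_family\<close>.\<close>

lemma sv_face_iff:
  assumes "sym_diff t u \<subseteq> E" "sv E u \<in> face S X"
  shows "(\<forall>e. X e \<noteq> Zer \<longrightarrow> sv E t e = X e) \<longleftrightarrow> t - {e \<in> E. X e = Zer} = u - {e \<in> E. X e = Zer}"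
    (is "?L \<longleftrightarrow> t - ?D = u - ?D")
proof
  assume l: ?L
  show "t - ?D = u - ?D"
  proof (rule set_eqI)
    fix h show "h \<in> t - ?D \<longleftrightarrow> h \<in> u - ?D"
    proof (cases "h \<in> E \<and> X h \<noteq> Zer")
      case True
      then have "sv E t h = sv E u h" using l faceD(2)[OF assms(2), of h] by simp
      then show ?thesis using True by (simp add: sv_def split: if_splits)
    next
      case False then show ?thesis using assms(1) by auto
    qed
  qed
next
  assume r: "t - ?D = u - ?D"
  show ?L
  proof (intro allI impI)
    fix h assume h: "X h \<noteq> Zer"
    then have "h \<in> t \<longleftrightarrow> h \<in> u" using eqset_imp_iff[OF r, of h] by simp
    then have "sv E t h = sv E u h" by (simp add: sv_def)
    then show "sv E t h = X h" using faceD(2)[OF assms(2) h] by simp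
  qed
qed

lemma sv_antipode:
  assumes X: "sv E u \<in> face S X" and t: "t - {e \<in> E. X e = Zer} = u - {e \<in> E. X e = Zer}"
  shows "X \<odot> \<ominus> sv E t = sv E (sym_diff t {e \<in> E. X e = Zer})"
proof
  fix h
  show "(X \<odot> \<ominus> sv E t) h = sv E (sym_diff t {e \<in> E. X e = Zer}) h"
  proof (cases "X h = Zer")
    case True then show ?thesis by (auto simp: scomp_apply sv_def)
  next
    case False
    then have "h \<in> t \<longleftrightarrow> h \<in> u" using eqset_imp_iff[OF t, of h] by simp
    then have "sv E (sym_diff t {e \<in> E. X e = Zer}) h = sv E u h" using False by (simp add: sv_def)
    then show ?thesis using False faceD(2)[OF X, of h] by (simp add: scomp_apply)
  qed
qed

text \<open>Follow a geodesic from \<open>x\<close> to \<open>y\<close> up to the moment when it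
  flips \<open>e\<close>.\<close>

lemma cubical_edge_between:
  assumes T: "cubical T"
  shows "x \<in> T \<Longrightarrow> y \<in> T \<Longrightarrow> e \<in> sym_diff x y \<Longrightarrow> \<exists>v\<in>T. sym_diff v {e} \<in> T \<and> between x v y"
proof (induction "card (sym_diff x y)" arbitrary: x rule: less_induct)
  case less
  have ne: "x \<noteq> y" using less.prems(3) by auto
  obtain k where k: "k \<in> sym_diff x y" "sym_diff x {k} \<in> T"
    using cubicalD(3)[OF T less.prems(1,2) ne] by (elim bexE)
  show ?case
  proof (cases "k = e")
    case True
    then show ?thesis using k less.prems(1) by (intro bexI[of _ x]) (simp_all add: between_def)
  next
    case False
    have "Suc (card (sym_diff (sym_diff x {k}) y)) = card (sym_diff x y)"
      by (rule card_sym_diff_single(1)[OF _ _ k(1)]) (use cubicalD(2)[OF T] less.prems in auto)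
    moreover have "e \<in> sym_diff (sym_diff x {k}) y" using less.prems(3) False by auto
    ultimately obtain v where v: "v \<in> T" "sym_diff v {e} \<in> T" "between (sym_diff x {k}) v y"
      using less.hyps[OF _ k(2) less.prems(2)] by auto
    have "between x v y"
      unfolding between_def
    proof (intro allI impI)
      fix h assume h: "h \<in> x \<longleftrightarrow> h \<in> y"
      then have "h \<noteq> k" using k(1) by auto
      then show "h \<in> v \<longleftrightarrow> h \<in> x" using v(3)[unfolded between_def, rule_format, of h] h by auto
    qed
    then show ?thesis using v by blast
  qed
qed

text \<open>The elimination condition comes from isometry: an edge in direction \<open>e\<close>
  between the two topes is an antipodal face with the single zero \<open>e\<close>, hence a
  covector.\<close>

lemma ag_system_sv:
  assumes T: "cubical T" "ag_family T" "T \<noteq> {}" and E: "finite E"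
    and spread: "\<And>t u. t \<in> T \<Longrightarrow> u \<in> T \<Longrightarrow> sym_diff t u \<subseteq> E"
  shows "ag_system E (sv E ` T)"
proof -
  have ag: "X \<in> cov (sv E ` T)" if X: "antipodal_face (sv E ` T) X" for X
  proof -
    define D where "D = {e \<in> E. X e = Zer}"
    obtain u where u: "u \<in> T" "sv E u \<in> face (sv E ` T) X"
      using X unfolding antipodal_face_def face_def by blast
    have sym: "sym_diff t D \<in> T" if t: "t \<in> T" "t - D = u - D" for t
    proof -
      have "sv E t \<in> face (sv E ` T) X"
        using sv_face_iff[OF spread[OF t(1) u(1)] u(2)] t D_def by (simp add: face_def)
      then have "X \<odot> \<ominus> sv E t \<in> sv E ` T" using X by (simp add: antipodal_face_def)
      then obtain s where s: "s \<in> T" "sv E (sym_diff t D) = sv E s"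
        using sv_antipode[OF u(2), of t] t(2) D_def by auto
      have "sym_diff (sym_diff t D) s \<subseteq> E" using spread[OF t(1) s(1)] by (auto simp: D_def)
      then have "sym_diff t D = s" using s(2) sv_eq_iff by metis
      then show ?thesis using s(1) by simp
    qed
    show ?thesis
      unfolding cov_def
    proof (intro CollectI ballI)
      fix t' assume "t' \<in> sv E ` T"
      then obtain t where t: "t \<in> T" "t' = sv E t" by blast
      define g where "g = (u - D) \<union> (t \<inter> D)"
      have g: "g \<in> T" unfolding g_def by (rule ag_familyD[OF T(2) u(1) t(1) sym])
      have gD: "g - D = u - D" by (auto simp: g_def)
      have "X \<odot> \<ominus> sv E g = sv E (sym_diff g D)" using sv_antipode[OF u(2), of g] gD D_def by simp
      moreover have "X \<odot> \<ominus> sv E g = X \<odot> \<ominus> t'"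
      proof
        fix h show "(X \<odot> \<ominus> sv E g) h = (X \<odot> \<ominus> t') h"
          by (auto simp: scomp_apply t(2) sv_def g_def D_def)
      qed
      ultimately show "X \<odot> \<ominus> t' \<in> sv E ` T" using sym[OF g gD] by simp
    qed
  qed
  have elim: "\<exists>X\<in>cov (sv E ` T). X e = Zer \<and> (\<forall>h. x h = y h \<longrightarrow> X h = x h)"
    if xy': "x \<in> sv E ` T" "y \<in> sv E ` T" "x e \<noteq> y e" for x y e
  proof -
    obtain a where a: "a \<in> T" "x = sv E a" using xy'(1) by blast
    obtain b where b: "b \<in> T" "y = sv E b" using xy'(2) by blast
    have e: "e \<in> E" "e \<in> sym_diff a b" using xy'(3) a b by (auto simp: sv_def split: if_splits)
    obtain v where v: "v \<in> T" "sym_diff v {e} \<in> T" "between a v b"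
      using cubical_edge_between[OF T(1) a(1) b(1) e(2)] by blast
    define X where "X = (sv E v)(e := Zer)"
    have X0: "{h \<in> E. X h = Zer} = {e}" using e(1) by (auto simp: X_def sv_def)
    have vf: "sv E v \<in> face (sv E ` T) X" using v(1) by (auto simp: face_def X_def)
    have "antipodal_face (sv E ` T) X"
      unfolding antipodal_face_def
    proof (intro conjI ballI)
      fix t' assume t': "t' \<in> face (sv E ` T) X"
      then obtain t where t: "t \<in> T" "t' = sv E t" unfolding face_def by blast
      have "\<forall>h. X h \<noteq> Zer \<longrightarrow> sv E t h = X h" using t' t(2) by (simp add: face_def)
      then have tv: "t - {e} = v - {e}" using sv_face_iff[OF spread[OF t(1) v(1)] vf] X0 by simp
      have "X \<odot> \<ominus> t' = sv E (sym_diff t {e})" using sv_antipode[OF vf, of t] tv X0 t(2) by simp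
      moreover have "sym_diff t {e} \<in> T"
      proof (cases "e \<in> t \<longleftrightarrow> e \<in> v")
        case True
        have "t = v"
        proof (rule set_eqI)
          fix h show "h \<in> t \<longleftrightarrow> h \<in> v" using eqset_imp_iff[OF tv, of h] True by (cases "h = e") auto
        qed
        then show ?thesis using v(2) by simp
      next
        case False
        have "sym_diff t {e} = v"
        proof (rule set_eqI)
          fix h show "h \<in> sym_diff t {e} \<longleftrightarrow> h \<in> v"
            using eqset_imp_iff[OF tv, of h] False by (cases "h = e") auto
        qed
        then show ?thesis using v(1) by simp
      qed
      ultimately show "X \<odot> \<ominus> t' \<in> sv E ` T" by simp
    qed (use vf in blast)
    then have "X \<in> cov (sv E ` T)" by (rule ag)
    moreover have "X h = x h" if "x h = y h" for h
    proof (cases "h \<in> E")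
      case True
      then have "h \<in> a \<longleftrightarrow> h \<in> b" using that a b by (auto simp: sv_def split: if_splits)
      then have "h \<in> v \<longleftrightarrow> h \<in> a" "h \<noteq> e" using v(3) e(2) by (auto simp: between_def)
      then show ?thesis using a(2) by (simp add: X_def sv_def)
    qed (use a e in \<open>auto simp: X_def sv_def\<close>)
    ultimately show ?thesis by (intro bexI[of _ X]) (auto simp: X_def)
  qed
  have "sv E ` T \<subseteq> full E" "sv E ` T \<noteq> {}" using sv_full T(3) by auto
  then show ?thesis
    unfolding ag_system_def using E ag elim by (intro conjI allI impI ballI)
qed

lemma ag_family_sv:
  assumes ag: "\<And>X. antipodal_face (sv E ` T) X \<Longrightarrow> X \<in> cov (sv E ` T)"
    and spread: "\<And>t u. t \<in> T \<Longrightarrow> u \<in> T \<Longrightarrow> sym_diff t u \<subseteq> E"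
  shows "ag_family T"
  unfolding ag_family_def
proof (intro ballI allI impI)
  fix u D t assume u: "u \<in> T" and s: "\<forall>t\<in>T. t - D = u - D \<longrightarrow> sym_diff t D \<in> T" and t: "t \<in> T"
  have uD: "sym_diff u D \<in> T" using s u by simp
  have DE: "D \<subseteq> E" using spread[OF u uD] by auto
  define X where "X = (\<lambda>e. if e \<in> D then Zer else sv E u e)"
  have X0: "{e \<in> E. X e = Zer} = D" using DE by (auto simp: X_def sv_def)
  have uf: "sv E u \<in> face (sv E ` T) X" using u by (auto simp: face_def X_def)
  have "antipodal_face (sv E ` T) X"
    unfolding antipodal_face_def
  proof (intro conjI ballI)
    fix x' assume x': "x' \<in> face (sv E ` T) X"
    then obtain x where x: "x \<in> T" "x' = sv E x" unfolding face_def by blast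
    have "\<forall>h. X h \<noteq> Zer \<longrightarrow> sv E x h = X h" using x' x(2) by (simp add: face_def)
    then have xu: "x - D = u - D" using sv_face_iff[OF spread[OF x(1) u] uf] X0 by simp
    then have "X \<odot> \<ominus> x' = sv E (sym_diff x D)" using sv_antipode[OF uf, of x] X0 x(2) by simp
    then show "X \<odot> \<ominus> x' \<in> sv E ` T" using s x(1) xu by simp
  qed (use uf in blast)
  then have "X \<odot> sv E t \<in> sv E ` T" using cov_scomp_tope[OF ag] t by blast
  moreover have "X \<odot> sv E t = sv E ((u - D) \<union> (t \<inter> D))"
  proof
    fix h show "(X \<odot> sv E t) h = sv E ((u - D) \<union> (t \<inter> D)) h"
      by (auto simp: scomp_apply X_def sv_def)
  qed
  ultimately obtain y where y: "y \<in> T" "sv E ((u - D) \<union> (t \<inter> D)) = sv E y" by auto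
  have "sym_diff ((u - D) \<union> (t \<inter> D)) y \<subseteq> E" using spread[OF u y(1)] spread[OF t y(1)] by auto
  then have "(u - D) \<union> (t \<inter> D) = y" using y(2) sv_eq_iff by metis
  then show "(u - D) \<union> (t \<inter> D) \<in> T" using y(1) by simp
qed

text \<open>Contraction can create new antipodal faces, whose gates are not visible in
  \<open>T\<close>. The proof therefore passes to sign vectors, where contraction is
  \<open>del\<close> and \<open>ag_system_del_closed\<close> applies; it thus depends on the COM
  theorem.\<close>

lemma ag_family_contraction:
  assumes T: "ag_family T" "cubical T"
  shows "ag_family ((\<lambda>t. t - {e}) ` T)"
proof (cases "T = {}")
  case True then show ?thesis by (simp add: ag_family_def)
next
  case False
  define E where "E = \<Union> T"
  have "finite E" using cubicalD(1,2)[OF T(2)] by (auto simp: E_def)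
  then have "ag_system E (sv E ` T)" by (intro ag_system_sv T False) (auto simp: E_def)
  then have "ag_system (E - {e}) (del e (sv E ` T))" by (rule ag_system_del_closed)
  moreover have "(sv E t)(e := Zer) = sv (E - {e}) (t - {e})" for t by (auto simp: sv_def)
  then have "del e (sv E ` T) = sv (E - {e}) ` (\<lambda>t. t - {e}) ` T" by (simp add: del_def image_image)
  ultimately have "ag_system (E - {e}) (sv (E - {e}) ` (\<lambda>t. t - {e}) ` T)" by simp
  then show ?thesis
    by (intro ag_family_sv[of "E - {e}"] ag_antipodal_cov) (auto simp: E_def)
qed

section \<open>Partial cubes and tope graphs\<close>

lemma cube_rep_iso:
  assumes G: "is_graph G" and H: "cube_rep H T \<phi>" and f: "bij_betw f (fst G) (fst H)"
    and fe: "\<And>x y. x \<in> fst G \<Longrightarrow> y \<in> fst G \<Longrightarrow> (x, y) \<in> snd G \<longleftrightarrow> (f x, f y) \<in> snd H"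
  shows "cube_rep G T (\<phi> \<circ> f)"
proof -
  interpret H: cube_rep H T \<phi> by (rule H)
  show ?thesis
  proof
    show "is_graph G" "cubical T" by (rule G, rule H.cub)
    show "bij_betw (\<phi> \<circ> f) (fst G) T" by (rule bij_betw_trans[OF f H.bij])
    show "(x, y) \<in> snd G \<longleftrightarrow> card (sym_diff ((\<phi> \<circ> f) x) ((\<phi> \<circ> f) y)) = 1"
      if "x \<in> fst G" "y \<in> fst G" for x y
      using fe[OF that] H.edge[of "f x" "f y"] that f by (simp add: bij_betwE)
  qed
qed

section \<open>Partial cubes and their coordinate families\<close>

lemma is_graph_induced: "is_graph G \<Longrightarrow> is_graph (induced G W)"
  by (auto simp: is_graph_def induced_def sym_def)

lemma is_graph_hypercube: "is_graph (hypercube n)"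
  unfolding is_graph_def hypercube_def sym_def by (auto simp: Un_commute)

lemma cubical_Pow: "finite U \<Longrightarrow> cubical (Pow U)"
  unfolding cubical_def
proof (intro conjI ballI impI)
  fix x y assume U: "finite U" and x: "x \<in> Pow U" and y: "y \<in> Pow U" and ne: "x \<noteq> y"
  then obtain e where e: "e \<in> sym_diff x y" by blast
  then have "sym_diff x {e} \<in> Pow U" using x y by auto
  then show "\<exists>e\<in>sym_diff x y. sym_diff x {e} \<in> Pow U" using e by (rule bexI)
qed (auto intro: finite_subset)

lemma cube_rep_induced_hypercube:
  assumes "cubical T" "T \<subseteq> Pow {0..<n}"
  shows "cube_rep (induced (hypercube n) T) T (\<lambda>x. x)"
proof
  show "is_graph (induced (hypercube n) T)" by (rule is_graph_induced[OF is_graph_hypercube])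
  have "fst (induced (hypercube n) T) = T" using assms(2) by (auto simp: induced_def hypercube_def)
  then show "bij_betw (\<lambda>x. x) (fst (induced (hypercube n) T)) T" by (simp add: bij_betw_def)
  show "(x, y) \<in> snd (induced (hypercube n) T) \<longleftrightarrow> card (sym_diff x y) = 1"
    if "x \<in> fst (induced (hypercube n) T)" "y \<in> fst (induced (hypercube n) T)" for x y
    using that by (simp add: induced_def hypercube_def)
qed (rule assms)

lemma cube_rep_hypercube: "cube_rep (hypercube n) (Pow {0..<n}) (\<lambda>x. x)"
proof
  show "cubical (Pow {0..<n})" by (rule cubical_Pow) simp
  show "is_graph (hypercube n)" by (rule is_graph_hypercube)
qed (simp_all add: hypercube_def bij_betw_def)

lemma dist_walk:
  assumes "reach G x y"
  obtains ps where "is_walk G ps x y" "length ps = Suc (dist G x y)"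
proof -
  obtain qs where qs: "is_walk G qs x y" using assms by (auto simp: reach_def)
  then have "qs \<noteq> []" by (simp add: is_walk_def)
  then have "\<exists>k ps. is_walk G ps x y \<and> length ps = Suc k" using qs by (metis length_greater_0_conv Suc_pred)
  then have "\<exists>ps. is_walk G ps x y \<and> length ps = Suc (dist G x y)" unfolding dist_def by (rule LeastI_ex)
  then show ?thesis using that by blast
qed

text \<open>The first edge of a geodesic inside \<open>S\<close> brings \<open>x\<close> closer to
  \<open>y\<close>, so it flips a coordinate in which they differ.\<close>

lemma isometric_cubical:
  assumes S: "isometric (hypercube n) S"
  shows "cubical S"
  unfolding cubical_def
proof (intro conjI ballI impI)
  let ?Q = "hypercube n"
  let ?I = "induced ?Q S"
  interpret Q: cube_rep ?Q "Pow {0..<n}" "\<lambda>x. x" by (rule cube_rep_hypercube)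
  have sub: "S \<subseteq> Pow {0..<n}" using S by (simp add: isometric_def hypercube_def)
  then show "finite S" by (rule finite_subset) simp
  show "finite t" if "t \<in> S" for t using that sub finite_subset[of t "{0..<n}"] by blast
  fix x y assume x: "x \<in> S" and y: "y \<in> S" and ne: "x \<noteq> y"
  have xy: "x \<in> fst ?Q" "y \<in> fst ?Q" using x y sub by (auto simp: hypercube_def)
  have "reach ?I x y" "dist ?I x y = card (sym_diff x y)"
    using S x y Q.dist[OF xy] by (auto simp: isometric_def)
  then obtain ps where ps: "is_walk ?I ps x y" "length ps = Suc (card (sym_diff x y))"
    using dist_walk by metis
  then obtain p ps' where p: "ps = p # ps'" by (cases ps) (auto simp: is_walk_def)
  then obtain q qs where q: "ps' = q # qs" using ps(1) ne by (cases ps') (auto simp: is_walk_single)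
  have w: "(x, q) \<in> snd ?I" "is_walk ?I (q # qs) q y" using ps(1) p q by (auto simp: is_walk_Cons_Cons)
  have "is_walk ?Q (q # qs) q y" using w(2) unfolding is_walk_def induced_def by auto
  then have le: "card (sym_diff q y) < card (sym_diff x y)" using Q.walk_length[of "q # qs" q y] ps(2) p q by simp
  have "(x, q) \<in> snd ?Q" "q \<in> S" using w(1) by (auto simp: induced_def)
  then obtain e where e: "sym_diff x q = {e}" using Q.edge_obtain by blast
  have qe: "q = sym_diff x {e}" by (rule Q.edge_phi[OF e])
  have "e \<in> sym_diff x y"
  proof (rule ccontr)
    assume "e \<notin> sym_diff x y"
    then have "card (sym_diff q y) = Suc (card (sym_diff x y))"
      unfolding qe by (rule card_sym_diff_single(2)[OF Q.fin[OF xy(1)] Q.fin[OF xy(2)]])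
    then show False using le by simp
  qed
  then show "\<exists>e\<in>sym_diff x y. sym_diff x {e} \<in> S" using \<open>q \<in> S\<close> unfolding qe by (rule bexI[rotated])
qed

lemma partial_cube_rep:
  assumes "is_graph G" "partial_cube G"
  obtains T :: "nat set set" and \<phi> where "cube_rep G T \<phi>"
proof -
  obtain n S where S: "isometric (hypercube n) S" "iso G (induced (hypercube n) S)"
    using assms(2) by (auto simp: partial_cube_def)
  have "S \<subseteq> Pow {0..<n}" using S(1) by (simp add: isometric_def hypercube_def)
  then have "cube_rep (induced (hypercube n) S) S (\<lambda>x. x)"
    by (rule cube_rep_induced_hypercube[OF isometric_cubical[OF S(1)]])
  then show ?thesis using S(2) cube_rep_iso[OF assms(1)] that unfolding iso_def by metis
qed

lemma (in cube_rep) isoI: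
  assumes "bij_betw f T (fst H)"
    and "\<And>s t. s \<in> T \<Longrightarrow> t \<in> T \<Longrightarrow> card (sym_diff s t) = 1 \<longleftrightarrow> (f s, f t) \<in> snd H"
  shows "iso G H"
  unfolding iso_def
proof (intro exI conjI ballI)
  show "bij_betw (f \<circ> \<phi>) (fst G) (fst H)" by (rule bij_betw_trans[OF bij assms(1)])
  show "(x, y) \<in> snd G \<longleftrightarrow> ((f \<circ> \<phi>) x, (f \<circ> \<phi>) y) \<in> snd H" if "x \<in> fst G" "y \<in> fst G" for x y
    using edge[OF that] assms(2)[OF phi_mem[OF that(1)] phi_mem[OF that(2)]] by simp
qed

lemma cube_rep_partial_cube:
  fixes T :: "nat set set"
  assumes "cube_rep G T \<phi>"
  shows "partial_cube G"
proof -
  interpret cube_rep G T \<phi> by (rule assms)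
  have "finite (\<Union> T)" using cubicalD(1,2)[OF cub] by auto
  then obtain n where "\<forall>i\<in>\<Union> T. i < n" using finite_nat_set_iff_bounded by auto
  then have sub: "T \<subseteq> Pow {0..<n}" by auto
  interpret I: cube_rep "induced (hypercube n) T" T "\<lambda>x. x"
    by (rule cube_rep_induced_hypercube[OF cub sub])
  interpret Q: cube_rep "hypercube n" "Pow {0..<n}" "\<lambda>x. x" by (rule cube_rep_hypercube)
  have V: "fst (induced (hypercube n) T) = T" using sub by (auto simp: induced_def hypercube_def)
  have "isometric (hypercube n) T"
    unfolding isometric_def
  proof (intro conjI ballI)
    show "T \<subseteq> fst (hypercube n)" using sub by (simp add: hypercube_def)
    fix x y assume xy: "x \<in> T" "y \<in> T"
    show "reach (induced (hypercube n) T) x y" using I.reach xy V by simp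
    show "dist (induced (hypercube n) T) x y = dist (hypercube n) x y"
    proof -
      have "x \<in> fst (hypercube n)" "y \<in> fst (hypercube n)" using xy sub by (auto simp: hypercube_def)
      then have "dist (hypercube n) x y = card (sym_diff x y)" by (rule Q.dist)
      then show ?thesis using I.dist[of x y] xy V by simp
    qed
  qed
  moreover have "iso G (induced (hypercube n) T)"
    by (rule isoI[of "\<lambda>x. x"]) (use V I.edge in \<open>auto simp: bij_betw_def\<close>)
  ultimately show ?thesis unfolding partial_cube_def by blast
qed

section \<open>Topes of a COM as an isometric family\<close>

definition pos :: "('e \<Rightarrow> sign) \<Rightarrow> 'e set" where
  "pos X = {e. X e = Pos}"

lemma sv_pos: "X \<in> full E \<Longrightarrow> sv E (pos X) = X"
proof
  fix e assume "X \<in> full E"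
  then have "X e = Zer \<longleftrightarrow> e \<notin> E" by (rule fullD)
  then show "sv E (pos X) e = X e" by (cases "X e") (auto simp: sv_def pos_def)
qed

lemma sym_diff_pos: "X \<in> full E \<Longrightarrow> Y \<in> full E \<Longrightarrow> sym_diff (pos X) (pos Y) = {e \<in> E. X e \<noteq> Y e}"
proof (rule set_eqI)
  fix e assume "X \<in> full E" "Y \<in> full E"
  then have "X e = Zer \<longleftrightarrow> e \<notin> E" "Y e = Zer \<longleftrightarrow> e \<notin> E" by (simp_all add: fullD)
  then show "e \<in> sym_diff (pos X) (pos Y) \<longleftrightarrow> e \<in> {e \<in> E. X e \<noteq> Y e}"
    by (cases "X e"; cases "Y e") (auto simp: pos_def)
qed

text \<open>Eliminate \<open>e\<close> to get \<open>Z\<close> and complete it by a suitable tope.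
  If \<open>Z\<close> is nonzero at some coordinate where \<open>X\<close> and \<open>Y\<close>
  differ, complete it by whichever of the two it contradicts there. Otherwise \<open>Z\<close>
  leaves all these coordinates free; \<open>X\<close> and \<open>Y\<close> have the same sign
  product at \<open>e\<close> and \<open>f\<close>, so a vector with the other product, supplied by
  \<open>distinguished\<close>, leads to neither.\<close>

lemma com_topes_between:
  assumes L: "com E L" and dist: "\<forall>e\<in>E. \<forall>f\<in>E. e \<noteq> f \<longrightarrow> distinguished L e f"
    and X: "X \<in> L \<inter> full E" and Y: "Y \<in> L \<inter> full E"
    and ef: "e \<noteq> f" "X e \<noteq> Y e" "X f \<noteq> Y f"
  obtains Z where "Z \<in> L \<inter> full E" "Z \<noteq> X" "Z \<noteq> Y" "\<And>h. X h = Y h \<Longrightarrow> Z h = X h"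
proof -
  have x0: "X h = Zer \<longleftrightarrow> h \<notin> E" "Y h = Zer \<longleftrightarrow> h \<notin> E" for h using X Y by (simp_all add: fullD)
  have sep: "h \<in> sep X Y \<longleftrightarrow> X h \<noteq> Y h" for h using x0[of h] by (auto simp: sep_iff)
  have XL: "X \<in> L" and YL: "Y \<in> L" using X Y by auto
  obtain Z where Z: "Z \<in> L" "Z e = Zer" "\<And>h. h \<in> E \<Longrightarrow> h \<notin> sep X Y \<Longrightarrow> Z h = (X \<odot> Y) h"
    using com_elim[OF L XL YL] ef(2) sep by metis
  have Zsv: "Z h = Zer" if "h \<notin> E" for h using Z(1) L that by (auto simp: com_def signvecs_def)
  have Zeq: "Z h = X h" if "X h = Y h" for h
    using that Z(3)[of h] Zsv[of h] sep x0[of h] by (cases "h \<in> E") (auto simp: scomp_apply)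
  note res = that
  have mk: thesis if W: "W \<in> L" "W \<in> full E" "(Z \<odot> W) a \<noteq> X a" "(Z \<odot> W) b \<noteq> Y b"
    and agree: "\<And>h. X h = Y h \<Longrightarrow> (Z \<odot> W) h = X h" for W a b
  proof (rule res)
    have "Z \<odot> W \<in> full E" using W(2) Zsv by (auto simp: full_def scomp_apply)
    then show "Z \<odot> W \<in> L \<inter> full E" using com_scomp[OF L Z(1) W(1)] by simp
    show "Z \<odot> W \<noteq> X" "Z \<odot> W \<noteq> Y" using W by metis+
  qed (rule agree)
  have Xf: "X \<in> full E" and Yf: "Y \<in> full E" using X Y by auto
  show ?thesis
  proof (cases "\<exists>g. X g \<noteq> Y g \<and> Z g \<noteq> Zer")
    case True
    then obtain g where g: "X g \<noteq> Y g" "Z g \<noteq> Zer" by blast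
    show ?thesis
    proof (cases "Z g = X g")
      case True
      show ?thesis
        by (rule mk[OF YL Yf, of e g]) (use True g ef Z(2) Zeq in \<open>auto simp: scomp_apply\<close>)
    next
      case False
      show ?thesis
        by (rule mk[OF XL Xf, of g e]) (use False g ef Z(2) Zeq in \<open>auto simp: scomp_apply\<close>)
    qed
  next
    case False
    then have Z0: "Z h = Zer" if "X h \<noteq> Y h" for h using that by blast
    have eE: "e \<in> E" "f \<in> E" using ef x0[of e] x0[of f] by auto
    obtain A B where AB: "A \<in> L" "B \<in> L" "{sprod (A e) (A f), sprod (B e) (B f)} = {Pos, Neg}"
    proof -
      have "distinguished L e f" using dist eE ef(1) by blast
      then show ?thesis using that unfolding distinguished_def by (elim bexE)
    qed
    have "\<exists>W\<in>L. sprod (W e) (W f) \<noteq> Zer \<and> sprod (W e) (W f) \<noteq> sprod (X e) (X f)"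
    proof (cases "sprod (A e) (A f) = sprod (X e) (X f)")
      case True
      then have "sprod (B e) (B f) \<noteq> Zer \<and> sprod (B e) (B f) \<noteq> sprod (X e) (X f)"
        using AB(3) by (auto simp: doubleton_eq_iff)
      then show ?thesis using AB by blast
    next
      case False
      then have "sprod (A e) (A f) \<noteq> Zer \<and> sprod (A e) (A f) \<noteq> sprod (X e) (X f)"
        using AB(3) by (auto simp: doubleton_eq_iff)
      then show ?thesis using AB by blast
    qed
    then obtain W where W: "W \<in> L" "sprod (W e) (W f) \<noteq> Zer" "sprod (W e) (W f) \<noteq> sprod (X e) (X f)"
      by blast
    have W0: "W e \<noteq> Zer" "W f \<noteq> Zer" using W(2) by (cases "W e"; cases "W f"; simp)+
    have YX: "Y e = sneg (X e)" "Y f = sneg (X f)"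
      using sign_neq_iff[of "Y e" "X e"] sign_neq_iff[of "Y f" "X f"] x0 eE ef by auto
    have "\<not> (W e = X e \<and> W f = X f)" using W(3) by auto
    moreover have "\<not> (W e = Y e \<and> W f = Y f)"
    proof
      assume "W e = Y e \<and> W f = Y f"
      then show False using W(3) YX by (cases "X e"; cases "X f") auto
    qed
    ultimately obtain a b where ab: "a = e \<or> a = f" "b = e \<or> b = f" "W a \<noteq> X a" "W b \<noteq> Y b" by blast
    have ab0: "(Z \<odot> W \<odot> X) a = W a" "(Z \<odot> W \<odot> X) b = W b"
      using ab(1,2) W0 Z0 ef(2,3) by (auto simp: scomp_apply)
    have WX: "W \<odot> X \<in> L" "W \<odot> X \<in> full E"
    proof -
      have "W h = Zer" if "h \<notin> E" for h using W(1) L that by (auto simp: com_def signvecs_def)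
      then show "W \<odot> X \<in> full E" using Xf by (auto simp: full_def scomp_apply)
    qed (rule com_scomp[OF L W(1) XL])
    show ?thesis
    proof (rule mk[OF WX, of a b])
      show "(Z \<odot> W \<odot> X) a \<noteq> X a" "(Z \<odot> W \<odot> X) b \<noteq> Y b" using ab0 ab by simp_all
      show "(Z \<odot> W \<odot> X) h = X h" if "X h = Y h" for h
      proof (cases "h \<in> E")
        case True
        then show ?thesis using Zeq[OF that] x0[of h] by (simp add: scomp_apply)
      next
        case False
        then have "(W \<odot> X) h = Zer" using WX(2) by (simp add: fullD)
        then show ?thesis using Zsv[OF False] x0[of h] False by (simp add: scomp_apply)
      qed
    qed
  qed
qed

text \<open>Topes strictly between pull \<open>Y\<close> towards \<open>X\<close> until a neighbour
  of \<open>X\<close> is reached.\<close>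

lemma com_topes_step:
  assumes L: "com E L" and dist: "\<forall>e\<in>E. \<forall>f\<in>E. e \<noteq> f \<longrightarrow> distinguished L e f"
  shows "X \<in> L \<inter> full E \<Longrightarrow> Y \<in> L \<inter> full E \<Longrightarrow> X \<noteq> Y \<Longrightarrow>
    \<exists>e. X e \<noteq> Y e \<and> X(e := Y e) \<in> L \<inter> full E"
proof (induction "card {h. X h \<noteq> Y h}" arbitrary: Y rule: less_induct)
  case less
  obtain e where e: "X e \<noteq> Y e" using less.prems(3) by blast
  show ?case
  proof (cases "\<exists>f. f \<noteq> e \<and> X f \<noteq> Y f")
    case False
    then have "X(e := Y e) = Y" by (auto simp: fun_eq_iff)
    then show ?thesis using e less.prems(2) by metis
  next
    case True
    then obtain f where f: "e \<noteq> f" "X f \<noteq> Y f" by metis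
    obtain Z where Z: "Z \<in> L \<inter> full E" "Z \<noteq> X" "Z \<noteq> Y" "\<And>h. X h = Y h \<Longrightarrow> Z h = X h"
      using com_topes_between[OF L dist less.prems(1,2) f(1) e f(2)] by blast
    have x0: "V h = Zer \<longleftrightarrow> h \<notin> E" if "V \<in> L \<inter> full E" for V h using that by (simp add: fullD)
    have ZY: "Z h = Y h" if "X h \<noteq> Z h" for h
    proof -
      have "X h \<noteq> Y h" using Z(4)[of h] that by metis
      then show ?thesis
        using that x0[OF less.prems(1), of h] x0[OF less.prems(2), of h] x0[OF Z(1), of h]
        by (cases "X h"; cases "Y h"; cases "Z h") auto
    qed
    obtain l where l: "Z l \<noteq> Y l" using Z(3) by blast
    have "{h. X h \<noteq> Y h} \<subseteq> E" using x0[OF less.prems(1)] x0[OF less.prems(2)] by force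
    then have fin: "finite {h. X h \<noteq> Y h}" using L finite_subset by (auto simp: com_def)
    have "{h. X h \<noteq> Z h} \<subset> {h. X h \<noteq> Y h}"
    proof (rule psubset_CollectI)
      show "X h \<noteq> Y h" if "X h \<noteq> Z h" for h using Z(4)[of h] that by metis
      show "\<not> X l \<noteq> Z l" using ZY l by metis
      then show "X l \<noteq> Y l" using l by simp
    qed
    then have "card {h. X h \<noteq> Z h} < card {h. X h \<noteq> Y h}" by (rule psubset_card_mono[OF fin])
    then obtain k where k: "X k \<noteq> Z k" "X(k := Z k) \<in> L \<inter> full E"
      using less.hyps[OF _ less.prems(1) Z(1)] Z(2) by blast
    then show ?thesis using ZY[OF k(1)] by metis
  qed
qed

lemma com_topes_rep:
  assumes L: "com E L" and dist: "\<forall>e\<in>E. \<forall>f\<in>E. e \<noteq> f \<longrightarrow> distinguished L e f"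
  shows "cubical (pos ` (L \<inter> full E))" "ag_family (pos ` (L \<inter> full E))"
proof -
  let ?T = "pos ` (L \<inter> full E)"
  have finE: "finite E" using L by (simp add: com_def)
  have posE: "pos X \<subseteq> E" if X: "X \<in> full E" for X
  proof
    fix e assume "e \<in> pos X"
    then show "e \<in> E" using fullD[OF X, of e] by (simp add: pos_def)
  qed
  have sub: "?T \<subseteq> Pow E"
  proof (rule image_subsetI)
    fix X assume "X \<in> L \<inter> full E"
    then show "pos X \<in> Pow E" using posE by simp
  qed
  show "cubical ?T"
    unfolding cubical_def
  proof (intro conjI ballI impI)
    show "finite ?T" using sub by (rule finite_subset) (simp add: finE)
    show "finite t" if "t \<in> ?T" for t
    proof -
      have "t \<subseteq> E" using that sub by (meson PowD subsetD)
      then show ?thesis using finE by (rule finite_subset)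
    qed
    fix x y assume "x \<in> ?T" "y \<in> ?T" and ne: "x \<noteq> y"
    then obtain X Y where X: "X \<in> L \<inter> full E" "x = pos X" and Y: "Y \<in> L \<inter> full E" "y = pos Y"
      by (elim imageE)
    have XY: "X \<noteq> Y" using ne X(2) Y(2) by blast
    obtain e where e: "X e \<noteq> Y e" "X(e := Y e) \<in> L \<inter> full E"
      using com_topes_step[OF L dist X(1) Y(1) XY] by (elim exE conjE)
    have x0: "X h = Zer \<longleftrightarrow> h \<notin> E" "Y h = Zer \<longleftrightarrow> h \<notin> E" for h using X Y by (simp_all add: fullD)
    have eE: "e \<in> E" using e(1) x0[of e] by auto
    have "e \<in> sym_diff x y" using sym_diff_pos[of X E Y] X Y e(1) eE by simp
    moreover have "sym_diff x {e} = pos (X(e := Y e))"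
      using e(1) x0[of e] eE X(2) by (cases "X e"; cases "Y e") (auto simp: pos_def)
    then have "sym_diff x {e} \<in> ?T" using e(2) by simp
    ultimately show "\<exists>e\<in>sym_diff x y. sym_diff x {e} \<in> ?T" by (rule bexI[rotated])
  qed
  have "sv E (pos X) = X" if "X \<in> L \<inter> full E" for X using sv_pos that by blast
  then have svT: "sv E ` ?T = L \<inter> full E" by (simp add: image_image)
  show "ag_family ?T"
  proof (rule ag_family_sv[of E])
    fix X assume "antipodal_face (sv E ` ?T) X"
    then have "X \<in> L" using antipodal_face_mem_com[OF L] svT by simp
    moreover have "X h = Zer" if "h \<notin> E" for h
      using \<open>X \<in> L\<close> L that by (auto simp: com_def signvecs_def)
    ultimately show "X \<in> cov (sv E ` ?T)"
      unfolding svT cov_def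
    proof (intro CollectI ballI IntI)
      fix t assume t: "t \<in> L \<inter> full E"
      then show "X \<odot> \<ominus> t \<in> L" using \<open>X \<in> L\<close> L by (simp add: com_def)
      show "X \<odot> \<ominus> t \<in> full E" using t \<open>\<And>h. h \<notin> E \<Longrightarrow> X h = Zer\<close> by (auto simp: full_def scomp_apply)
    qed
  next
    show "sym_diff t u \<subseteq> E" if "t \<in> ?T" "u \<in> ?T" for t u
    proof -
      have "t \<subseteq> E" "u \<subseteq> E" using that sub by (meson PowD subsetD)+
      then show ?thesis by auto
    qed
  qed
qed

lemma tope_graph_eq:
  "fst (tope_graph E L) = restrict_vec E ` L \<inter> full E"
  "snd (tope_graph E L) = {(X, Y). X \<in> restrict_vec E ` L \<inter> full E \<and> Y \<in> restrict_vec E ` L \<inter> full E \<and>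
     card {e \<in> E. X e \<noteq> Y e} = 1}"
proof -
  have "{restrict_vec E X | X. X \<in> L \<and> (\<forall>e\<in>E. X e \<noteq> Zer)} = restrict_vec E ` L \<inter> full E"
    by (auto simp: full_def restrict_vec_apply split: if_splits)
  then show "fst (tope_graph E L) = restrict_vec E ` L \<inter> full E"
    "snd (tope_graph E L) = {(X, Y). X \<in> restrict_vec E ` L \<inter> full E \<and> Y \<in> restrict_vec E ` L \<inter> full E \<and>
     card {e \<in> E. X e \<noteq> Y e} = 1}" by (simp_all add: tope_graph_def Let_def)
qed

lemma tope_graph_rep:
  assumes L: "com E (restrict_vec E ` L)"
    and dist: "\<forall>e\<in>E. \<forall>f\<in>E. e \<noteq> f \<longrightarrow> distinguished (restrict_vec E ` L) e f"
  shows "cube_rep (tope_graph E L) (pos ` (restrict_vec E ` L \<inter> full E)) pos"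
proof
  let ?S = "restrict_vec E ` L \<inter> full E"
  show "is_graph (tope_graph E L)"
  proof -
    have comm: "card {e \<in> E. X e \<noteq> Y e} = card {e \<in> E. Y e \<noteq> X e}" for X Y :: "'a \<Rightarrow> sign"
      by (rule arg_cong[where f = card]) auto
    have "sym (snd (tope_graph E L))"
    proof (rule symI)
      fix X Y assume "(X, Y) \<in> snd (tope_graph E L)"
      then show "(Y, X) \<in> snd (tope_graph E L)" using comm[of X Y] by (simp add: tope_graph_eq)
    qed
    then show ?thesis unfolding is_graph_def by (auto simp: tope_graph_eq)
  qed
  show "cubical (pos ` ?S)" by (rule com_topes_rep(1)[OF L dist])
  have "inj_on pos ?S"
    by (rule inj_on_inverseI[of _ "sv E"]) (simp add: sv_pos)
  then show "bij_betw pos (fst (tope_graph E L)) (pos ` ?S)" by (simp add: bij_betw_def tope_graph_eq)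
  show "(X, Y) \<in> snd (tope_graph E L) \<longleftrightarrow> card (sym_diff (pos X) (pos Y)) = 1"
    if "X \<in> fst (tope_graph E L)" "Y \<in> fst (tope_graph E L)" for X Y
    using that sym_diff_pos[of X E Y] by (simp add: tope_graph_eq)
qed

lemma G_COM_rep:
  assumes G: "is_graph G" and com: "G_COM G"
  shows "\<exists>(T :: nat set set) \<phi>. cube_rep G T \<phi> \<and> ag_family T"
proof -
  obtain E :: "nat set" and L E' where L: "COM E L" and E': "simplification_coords E L E'"
    and iso: "iso G (tope_graph E' L)"
    using com by (auto simp: G_COM_def)
  have "com E L" using L unfolding COM_def com_def by blast
  moreover have "E' \<subseteq> E" using E' by (auto simp: simplification_coords_def)
  ultimately have L': "com E' (restrict_vec E' ` L)" by (rule com_restrict)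
  have dist: "\<forall>e\<in>E'. \<forall>f\<in>E'. e \<noteq> f \<longrightarrow> distinguished (restrict_vec E' ` L) e f"
  proof (intro ballI impI)
    fix e f assume ef: "e \<in> E'" "f \<in> E'" "e \<noteq> f"
    then have "distinguished L e f" using E' by (auto simp: simplification_coords_def)
    then show "distinguished (restrict_vec E' ` L) e f"
      unfolding distinguished_def using ef by (simp add: restrict_vec_apply)
  qed
  note rep = tope_graph_rep[OF L' dist]
  obtain f where "bij_betw f (fst G) (fst (tope_graph E' L))"
    "\<forall>x\<in>fst G. \<forall>y\<in>fst G. (x, y) \<in> snd G \<longleftrightarrow> (f x, f y) \<in> snd (tope_graph E' L)"
    using iso unfolding iso_def by (elim exE conjE)
  then have "cube_rep G (pos ` (restrict_vec E' ` L \<inter> full E')) (pos \<circ> f)"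
    by (intro cube_rep_iso[OF G rep]) simp_all
  then show ?thesis using com_topes_rep(2)[OF L' dist] by blast
qed

lemma ag_family_G_COM:
  fixes T :: "nat set set"
  assumes rep: "cube_rep G T \<phi>" and ag: "ag_family T" and ne: "T \<noteq> {}"
  shows "G_COM G"
proof -
  interpret cube_rep G T \<phi> by (rule rep)
  define N where "N = {e. (\<exists>x\<in>T. e \<in> x) \<and> (\<exists>x\<in>T. e \<notin> x)}"
  have "finite (\<Union> T)" using cubicalD(1,2)[OF cub] by auto
  then have finN: "finite N" by (rule rev_finite_subset) (auto simp: N_def)
  have spread: "sym_diff s t \<subseteq> N" if "s \<in> T" "t \<in> T" for s t using that by (auto simp: N_def)
  define S where "S = sv N ` T"
  have S: "ag_system N S" unfolding S_def by (rule ag_system_sv[OF cub ag ne finN spread])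
  define L where "L = cov S"
  have L: "com N L" unfolding L_def by (rule ag_system_com[OF S])
  then have Lsv: "L \<subseteq> signvecs N" by (simp add: com_def)
  have LS: "L \<inter> full N = S" unfolding L_def by (rule cov_Int_full[OF ag_nonempty[OF S] ag_full[OF S]])
  then have SL: "S \<subseteq> L" by blast
  \<comment> \<open>\<open>COM\<close> demands a nonempty ground set, but \<open>N\<close> is empty
    for a graph with one vertex. The dummy \<open>k\<close> is zero on all of \<open>L\<close>, so
    simplification discards it.\<close>
  obtain k where k: "k \<notin> N" using ex_new_if_finite[OF infinite_UNIV_nat finN] by blast
  have Lk: "X k = Zer" if "X \<in> L" for X using that Lsv k by (auto simp: signvecs_def)
  have com: "COM (insert k N) L"
    unfolding COM_def
  proof (intro conjI ballI)
    show "finite (insert k N)" "insert k N \<noteq> {}" using finN by simp_all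
    show "L \<noteq> {}" using SL ag_nonempty[OF S] by blast
    show "L \<subseteq> signvecs (insert k N)" using Lsv by (auto simp: signvecs_def)
    show "X \<odot> \<ominus> Y \<in> L" if "X \<in> L" "Y \<in> L" for X Y using L that by (simp add: com_def)
    fix X Y e assume X: "X \<in> L" and Y: "Y \<in> L" and e: "e \<in> sep X Y"
    obtain Z where Z: "Z \<in> L" "Z e = Zer" "\<And>f. f \<in> N \<Longrightarrow> f \<notin> sep X Y \<Longrightarrow> Z f = (X \<odot> Y) f"
      using com_elim[OF L X Y e] by blast
    have "Z f = (X \<odot> Y) f" if "f \<in> insert k N - sep X Y" for f
      using that Z(3)[of f] Lk[OF Z(1)] Lk[OF X] Lk[OF Y] by (auto simp: scomp_apply)
    then show "\<exists>Z\<in>L. Z e = Zer \<and> (\<forall>f\<in>insert k N - sep X Y. Z f = (X \<odot> Y) f)"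
      using Z(1,2) by (intro bexI[of _ Z] conjI ballI)
  qed
  have full_coord: "full_coord L e" if e: "e \<in> N" for e
  proof -
    obtain x y where x: "x \<in> T" "e \<in> x" and y: "y \<in> T" "e \<notin> y" using e by (auto simp: N_def)
    have xS: "sv N x \<in> S" "sv N y \<in> S" using x y by (simp_all add: S_def)
    have v: "sv N x e = Pos" "sv N y e = Neg" using x y e by (simp_all add: sv_def)
    then obtain Z where Z: "Z \<in> L" "Z e = Zer" using ag_eliminate[OF S xS, of e] unfolding L_def by auto
    have "\<exists>X\<in>L. X e = s" for s
    proof (cases s)
      case Pos then show ?thesis using v(1) xS(1) SL by (intro bexI[of _ "sv N x"]) auto
    next
      case Neg then show ?thesis using v(2) xS(2) SL by (intro bexI[of _ "sv N y"]) auto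
    next
      case Zer then show ?thesis using Z by (intro bexI[of _ Z]) auto
    qed
    then have "s \<in> {X e |X. X \<in> L}" for s by (metis (mono_tags, lifting) mem_Collect_eq)
    moreover have "s \<in> {Pos, Neg, Zer}" for s by (cases s) auto
    ultimately show ?thesis unfolding full_coord_def by (intro equalityI subsetI)
  qed
  \<comment> \<open>The ends of an edge in direction \<open>e\<close> have opposite signs at
    \<open>e\<close> and the same sign at \<open>f\<close>.\<close>
  have distinguished: "distinguished L e f" if e: "e \<in> N" and f: "f \<in> N" "e \<noteq> f" for e f
  proof -
    obtain x y where x: "x \<in> T" "e \<in> x" and y: "y \<in> T" "e \<notin> y" using e by (auto simp: N_def)
    then have "e \<in> sym_diff x y" by simp
    then obtain v where v: "v \<in> T" "sym_diff v {e} \<in> T"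
      using cubical_edge_between[OF cub x(1) y(1)] by blast
    define X where "X = sv N v"
    define Y where "Y = sv N (sym_diff v {e})"
    have XY: "X \<in> L" "Y \<in> L" using v SL by (auto simp: X_def Y_def S_def)
    have "{sprod (X e) (X f), sprod (Y e) (Y f)} = {Pos, Neg}"
      using e f by (cases "e \<in> v"; cases "f \<in> v") (auto simp: X_def Y_def sv_def)
    then show ?thesis unfolding distinguished_def using XY by (intro bexI[of _ X] bexI[of _ Y])
  qed
  have nk: "\<not> full_coord L k"
  proof
    assume "full_coord L k"
    then have eq: "{X k |X. X \<in> L} = {Pos, Neg, Zer}" unfolding full_coord_def .
    have "Pos \<in> {X k |X. X \<in> L}" unfolding eq by simp
    then obtain X where "Pos = X k" "X \<in> L" by (elim CollectE exE conjE)
    then show False using Lk[of X] by simp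
  qed
  have simp: "simplification_coords (insert k N) L N"
    unfolding simplification_coords_def
  proof (intro conjI subsetI ballI impI)
    show "e \<in> {e \<in> insert k N. full_coord L e}" if "e \<in> N" for e using that full_coord by simp
    show "\<exists>f\<in>N. e = f \<or> \<not> distinguished L e f" if "e \<in> insert k N" "full_coord L e" for e
      using that nk by (intro bexI[of _ e]) auto
    show "distinguished L e f" if "e \<in> N" "f \<in> N" "e \<noteq> f" for e f using distinguished that .
  qed
  have "restrict_vec N X = X" if "X \<in> L" for X
    using that Lsv by (auto simp: signvecs_def restrict_vec_def fun_eq_iff)
  then have "restrict_vec N ` L = L" by simp
  then have V: "restrict_vec N ` L \<inter> full N = S" using LS by simp
  have "iso G (tope_graph N L)"
  proof (rule isoI)
    show "bij_betw (sv N) T (fst (tope_graph N L))"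
      unfolding tope_graph_eq V unfolding S_def bij_betw_def
      using sv_eq_iff[OF spread] by (auto intro!: inj_onI)
    fix s t assume st: "s \<in> T" "t \<in> T"
    have "{e \<in> N. sv N s e \<noteq> sv N t e} = sym_diff s t"
      using spread[OF st] by (auto simp: sv_def)
    then show "card (sym_diff s t) = 1 \<longleftrightarrow> (sv N s, sv N t) \<in> snd (tope_graph N L)"
      unfolding tope_graph_eq V using st by (simp add: S_def)
  qed
  then show ?thesis unfolding G_COM_def using com simp by blast
qed

lemma AG_iff:
  fixes T :: "nat set set"
  assumes "cube_rep G T \<phi>"
  shows "AG G \<longleftrightarrow> ag_family T"
  unfolding AG_def using cube_rep_partial_cube[OF assms] cube_rep.all_antipodal_gated_iff[OF assms] by simp

section \<open>Excluded minors\<close>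

text \<open>Treats both families at once: \<open>single\<close> says that if the base vertex is
  present, at most one of its neighbours is missing. The face of sets containing \<open>e\<close>
  misses only the antipodal pair \<open>U\<close> and \<open>{e}\<close>, and the gate of
  \<open>U - {e}\<close> in it would be \<open>U\<close>.\<close>

lemma Qminus_family:
  assumes U: "finite U" "card U \<ge> 4" and T: "T \<subseteq> Pow U" "U \<notin> T"
    and big: "\<And>B. B \<subseteq> U \<Longrightarrow> B \<noteq> U \<Longrightarrow> card B \<ge> 2 \<Longrightarrow> B \<in> T"
    and single: "\<And>i j. {} \<in> T \<Longrightarrow> i \<in> U \<Longrightarrow> j \<in> U \<Longrightarrow> i \<noteq> j \<Longrightarrow> {i} \<in> T \<or> {j} \<in> T"
    and e: "e \<in> U" "{e} \<notin> T"
  shows "cubical T" "\<not> ag_family T"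
proof -
  have fin: "finite B" if "B \<subseteq> U" for B using that U(1) finite_subset by blast
  have card2: "card B \<ge> 2" if "B \<subseteq> U" "a \<in> B" "b \<in> B" "a \<noteq> b" for B a b
  proof -
    have "card {a, b} \<le> card B" using that fin by (intro card_mono) auto
    then show ?thesis using that(4) by simp
  qed
  have three: "\<exists>c\<in>U. c \<noteq> a \<and> c \<noteq> b" for a b
  proof (rule ccontr)
    assume "\<not> ?thesis"
    then have "U \<subseteq> {a, b}" by blast
    then have "card U \<le> card {a, b}" by (rule card_mono[rotated]) simp
    also have "\<dots> \<le> 2" by (simp add: card_insert_if)
    finally show False using U(2) by simp
  qed
  show "cubical T"
    unfolding cubical_def
  proof (intro conjI ballI impI)
    show "finite T" using T(1) by (rule finite_subset) (simp add: U)
    show "finite t" if "t \<in> T" for t using that T(1) fin by blast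
    fix x y assume x: "x \<in> T" and y: "y \<in> T" and ne: "x \<noteq> y"
    have xU: "x \<subseteq> U" "y \<subseteq> U" "x \<noteq> U" "y \<noteq> U" using x y T by auto
    have remove: "\<exists>e\<in>sym_diff x y. sym_diff x {e} \<in> T" if f: "f \<in> x - y" "x - {f} \<in> T" for f
      using f by (intro bexI[of _ f]) (simp_all add: insert_absorb)
    have add: "\<exists>e\<in>sym_diff x y. sym_diff x {e} \<in> T" if f: "f \<in> y - x" "insert f x \<in> T" for f
    proof -
      have "sym_diff x {f} = insert f x" using f(1) by auto
      then show ?thesis using f by (intro bexI[of _ f]) simp_all
    qed
    show "\<exists>e\<in>sym_diff x y. sym_diff x {e} \<in> T"
    proof (cases "y \<subseteq> x")
      case True
      then obtain f where f: "f \<in> x - y" using ne by blast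
      show ?thesis
      proof (cases "card (x - {f}) \<ge> 2")
        case True
        then have "x - {f} \<in> T" using xU f by (intro big) auto
        then show ?thesis by (rule remove[OF f])
      next
        case False
        show ?thesis
        proof (cases "x - {f} = y")
          case True then show ?thesis using remove[OF f] y by simp
        next
          case ny: False
          obtain g where g: "g \<in> x - {f}" "g \<notin> y" using ny True f by blast
          have only: "h = g" if "h \<in> x - {f}" for h
            using card2[of "x - {f}" g h] g(1) that xU(1) False by blast
          have "y = {}" using only g True f by blast
          moreover have "x - {f} = {g}" "x - {g} = {f}" using only g f by blast+
          ultimately show ?thesis
            using single[of f g] y f g xU remove[of f] remove[of g] by auto
        qed
      qed
    next
      case False
      then obtain f where f: "f \<in> y - x" by blast
      show ?thesis
      proof (cases "insert f x = U")
        case True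
        then obtain g where g: "g \<in> x - y" using xU f by blast
        \<comment> \<open>Here \<open>x\<close> is \<open>U - {f}\<close>;
          \<open>card U \<ge> 4\<close> leaves two elements \<open>c\<close>, \<open>c'\<close>
          besides \<open>f\<close> and \<open>g\<close>, so removing \<open>g\<close> stays among
          the sets covered by \<open>big\<close>.\<close>
        obtain c where c: "c \<in> U" "c \<noteq> f" "c \<noteq> g" using three by blast
        obtain c' where c': "c' \<in> U - {f, g, c}"
        proof -
          have "card (U - {f, g, c}) \<ge> card U - card {f, g, c}" by (rule diff_card_le_card_Diff) simp
          moreover have "card {f, g, c} \<le> 3" by (simp add: card_insert_if)
          ultimately have "card (U - {f, g, c}) \<ge> 1" using U(2) by linarith
          then have "U - {f, g, c} \<noteq> {}" by force
          then show ?thesis using that by blast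
        qed
        have "card (x - {g}) \<ge> 2"
          by (rule card2[of _ c c']) (use True c c' xU in auto)
        then have "x - {g} \<in> T" using xU g by (intro big) auto
        then show ?thesis by (rule remove[OF g])
      next
        case nU: False
        show ?thesis
        proof (cases "x = {}")
          case False
          then obtain h where "h \<in> x" by blast
          then have "card (insert f x) \<ge> 2" using f xU by (intro card2[of _ f h]) auto
          then have "insert f x \<in> T" using nU f xU by (intro big) auto
          then show ?thesis by (rule add[OF f])
        next
          case True
          show ?thesis
          proof (cases "{f} \<in> T")
            case True then show ?thesis using add[OF f] \<open>x = {}\<close> by simp
          next
            case False
            then have "y \<noteq> {f}" using y by blast
            then obtain g where g: "g \<in> y" "g \<noteq> f" using f by blast
            then have "{g} \<in> T" using single[of f g] x True False f xU by blast
            then show ?thesis using add[of g] g True by simp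
          qed
        qed
      qed
    qed
  qed
  show "\<not> ag_family T"
  proof
    assume ag: "ag_family T"
    define D where "D = U - {e}"
    obtain g where g: "g \<in> U" "g \<noteq> e" using three by blast
    obtain h where h: "h \<in> U" "h \<noteq> e" "h \<noteq> g" using three by blast
    have u: "{e, g} \<in> T"
      using e g h by (intro big card2[of _ e g]) auto
    have t: "D \<in> T"
      using e g h by (intro big card2[of _ g h]) (auto simp: D_def)
    have "({e, g} - D) \<union> (D \<inter> D) \<in> T"
    proof (rule ag_familyD[OF ag u t])
      fix x assume x: "x \<in> T" "x - D = {e, g} - D"
      have ex: "e \<in> x" "x \<subseteq> U" using eqset_imp_iff[OF x(2), of e] x(1) T by (auto simp: D_def)
      have "x \<noteq> U" "x \<noteq> {e}" using x(1) T e by auto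
      then obtain a b where ab: "a \<in> U" "a \<notin> x" "b \<in> x" "b \<noteq> e" using ex by blast
      have eq: "sym_diff x D = insert e (U - x)" using ex by (auto simp: D_def)
      show "sym_diff x D \<in> T"
        unfolding eq
      proof (rule big)
        show "insert e (U - x) \<noteq> U" using ab ex by blast
        show "card (insert e (U - x)) \<ge> 2" by (rule card2[of _ e a]) (use ab ex in auto)
      qed (use e in auto)
    qed
    moreover have "({e, g} - D) \<union> (D \<inter> D) = U" using e g by (auto simp: D_def)
    ultimately show False using T(2) by simp
  qed
qed

text \<open>Translation by \<open>v\<close> moves the deleted antipode to the full set, the position
  required by \<open>Qminus_family\<close>.\<close>

lemma Qminus_rep:
  assumes "in_Qminus Q"
  obtains T :: "nat set set" and \<phi> where "cube_rep Q T \<phi>" "\<not> ag_family T"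
proof -
  have "\<exists>n v R T. n \<ge> 4 \<and> v \<subseteq> {0..<n} \<and> Q = induced (hypercube n) (Pow {0..<n} - R) \<and>
    T = {B. B \<subseteq> {0..<n} \<and> sym_diff B v \<notin> R} \<and> cubical T \<and> \<not> ag_family T"
  proof -
    obtain n v where n: "n \<ge> 4" and v: "v \<subseteq> {0..<n}" and
      Q: "(\<exists>i<n. Q = induced (hypercube n) (Pow {0..<n} - {{0..<n} - v, sym_diff v {i}}))
     \<or> (\<exists>M\<subseteq>{0..<n}. 1 \<le> card M \<and>
         Q = induced (hypercube n) (Pow {0..<n} - {{0..<n} - v, v} - (\<lambda>i. sym_diff v {i}) ` M))"
      using assms unfolding in_Qminus_def Let_def by (elim exE conjE)
    let ?U = "{0..<n}"
    have shift: "sym_diff B v = sym_diff v A \<longleftrightarrow> B = A" for A B :: "nat set"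
    proof
      assume eq: "sym_diff B v = sym_diff v A"
      show "B = A"
      proof (rule set_eqI)
        fix h show "h \<in> B \<longleftrightarrow> h \<in> A" using eqset_imp_iff[OF eq, of h] by auto
      qed
    qed auto
    have "?U - v = sym_diff v ?U" using v by auto
    then have a: "sym_diff B v = ?U - v \<longleftrightarrow> B = ?U" for B using shift[of B ?U] by (simp only:)
    have U: "finite ?U" "card ?U \<ge> 4" using n by simp_all
    from Q show ?thesis
    proof
      assume "\<exists>i<n. Q = induced (hypercube n) (Pow ?U - {?U - v, sym_diff v {i}})"
      then obtain i where i: "i < n" "Q = induced (hypercube n) (Pow ?U - {?U - v, sym_diff v {i}})"
        by (elim exE conjE)
      define T where "T = {B. B \<subseteq> ?U \<and> sym_diff B v \<notin> {?U - v, sym_diff v {i}}}"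
      have T: "B \<in> T \<longleftrightarrow> B \<subseteq> ?U \<and> B \<noteq> ?U \<and> B \<noteq> {i}" for B
        unfolding T_def using shift[of B "{i}"] a[of B] by simp
      have p0: "T \<subseteq> Pow ?U" unfolding T_def by (rule subsetI, drule CollectD) simp
      have p: "?U \<notin> T" "i \<in> ?U" "{i} \<notin> T" using T i(1) by simp_all
      have big: "B \<in> T" if "B \<subseteq> ?U" "B \<noteq> ?U" "card B \<ge> 2" for B
        using that T[of B] by auto
      have single: "{k} \<in> T \<or> {j} \<in> T" if "k \<in> ?U" "j \<in> ?U" "k \<noteq> j" for k j
      proof -
        have "{j} \<noteq> ?U" "{k} \<noteq> ?U" using U(2) card_1_singleton_iff[of "?U"] by auto
        then show ?thesis using that T[of "{k}"] T[of "{j}"] by auto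
      qed
      note q = Qminus_family[OF U p0 p(1) big single p(2,3)]
      have "cubical T" "\<not> ag_family T" by (rule q; assumption)+
      then show ?thesis using n v i(2) T_def by (intro exI conjI)
    next
      assume "\<exists>M\<subseteq>?U. 1 \<le> card M \<and>
         Q = induced (hypercube n) (Pow ?U - {?U - v, v} - (\<lambda>i. sym_diff v {i}) ` M)"
      then obtain M where M': "M \<subseteq> ?U" "1 \<le> card M"
        "Q = induced (hypercube n) (Pow ?U - {?U - v, v} - (\<lambda>i. sym_diff v {i}) ` M)"
        by (elim exE conjE)
      have "Pow ?U - {?U - v, v} - (\<lambda>i. sym_diff v {i}) ` M =
        Pow ?U - ({?U - v, v} \<union> (\<lambda>i. sym_diff v {i}) ` M)" by (simp only: Diff_eq Compl_Un Int_assoc)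
      with M' have M: "M \<subseteq> ?U" "1 \<le> card M"
        "Q = induced (hypercube n) (Pow ?U - ({?U - v, v} \<union> (\<lambda>i. sym_diff v {i}) ` M))" by simp_all
      obtain i where i: "i \<in> M" using M(2) by fastforce
      define T where "T = {B. B \<subseteq> ?U \<and> sym_diff B v \<notin> {?U - v, v} \<union> (\<lambda>i. sym_diff v {i}) ` M}"
      have "sym_diff B v = v \<longleftrightarrow> B = {}" for B using shift[of B "{}"] by simp
      then have T: "B \<in> T \<longleftrightarrow> B \<subseteq> ?U \<and> B \<noteq> ?U \<and> B \<noteq> {} \<and> B \<notin> (\<lambda>i. {i}) ` M" for B
        unfolding T_def mem_Collect_eq Un_iff insert_iff empty_iff image_iff shift a by simp
      have p0: "T \<subseteq> Pow ?U" unfolding T_def by (rule subsetI, drule CollectD) simp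
      have p: "?U \<notin> T" "i \<in> ?U" "{i} \<notin> T" "{} \<notin> T"
        using T[of ?U] T[of "{i}"] T[of "{}"] i subsetD[OF M(1) i] by simp_all
      have big: "B \<in> T" if "B \<subseteq> ?U" "B \<noteq> ?U" "card B \<ge> 2" for B
      proof -
        have "B \<noteq> {}" "B \<notin> (\<lambda>i. {i}) ` M" using that(3) by auto
        then show ?thesis using that T[of B] by simp
      qed
      have single: "{k} \<in> T \<or> {j} \<in> T" if "{} \<in> T" for k j using that p(4) by simp
      note q = Qminus_family[OF U p0 p(1) big single p(2,3)]
      have "cubical T" "\<not> ag_family T" by (rule q; assumption)+
      then show ?thesis using n v M(3) T_def by (intro exI conjI)
    qed
  qed
  then obtain n v R T where n: "n \<ge> 4" "v \<subseteq> {0..<n}" "Q = induced (hypercube n) (Pow {0..<n} - R)"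
    and T: "T = {B. B \<subseteq> {0..<n} \<and> sym_diff B v \<notin> R}" "cubical T" "\<not> ag_family T"
    by (elim exE conjE)
  have V: "fst Q = Pow {0..<n} - R" by (auto simp: n(3) induced_def hypercube_def)
  have "cube_rep Q T (\<lambda>x. sym_diff x v)"
  proof
    show "is_graph Q" unfolding n(3) by (rule is_graph_induced[OF is_graph_hypercube])
    show "bij_betw (\<lambda>x. sym_diff x v) (fst Q) T"
    proof (rule bij_betw_byWitness[where f' = "\<lambda>x. sym_diff x v"])
      have "sym_diff x v \<subseteq> {0..<n}" if "x \<subseteq> {0..<n}" for x using that n(2) by auto
      then show "(\<lambda>x. sym_diff x v) ` fst Q \<subseteq> T" "(\<lambda>x. sym_diff x v) ` T \<subseteq> fst Q"
        unfolding V T(1) by (auto simp only: image_subset_iff mem_Collect_eq Diff_iff Pow_iff sym_diff_cancel)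
    qed simp_all
    fix x y assume xy: "x \<in> fst Q" "y \<in> fst Q"
    have "sym_diff (sym_diff x v) (sym_diff y v) = sym_diff x y" by auto
    then show "(x, y) \<in> snd Q \<longleftrightarrow> card (sym_diff (sym_diff x v) (sym_diff y v)) = 1"
      using xy unfolding V by (simp add: n(3) induced_def hypercube_def)
  qed (rule T(2))
  then show ?thesis using that T(3) by blast
qed

lemma pc_minor_AG:
  fixes T0 :: "nat set set"
  assumes "cube_rep G T0 \<phi>0" "ag_family T0" "H \<in> pc_minors G"
  shows "is_graph H \<and> AG H"
proof -
  have "\<exists>T \<phi>. disjoint_cube_rep H T \<phi> \<and> ag_family (T :: nat set set)"
    by (rule pc_minor_rep[where P = ag_family, OF assms(1,2) _ _ assms(3)])
      (blast intro: ag_family_Int, rule ag_family_contraction)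
  then obtain T :: "nat set set" and \<phi> where T: "disjoint_cube_rep H T \<phi>" "ag_family T" by blast
  then interpret disjoint_cube_rep H T \<phi> by simp
  show ?thesis using graph AG_iff[OF cube_rep_axioms] T(2) by simp
qed

lemma AG_F_Qminus:
  assumes G: "is_graph G" and AG: "AG G"
  shows "F_Qminus G"
  unfolding F_Qminus_def
proof
  show pc: "partial_cube G" using AG by (simp add: AG_def)
  obtain T0 :: "nat set set" and \<phi>0 where rep: "cube_rep G T0 \<phi>0" using partial_cube_rep[OF G pc] .
  then have T0: "ag_family T0" using AG AG_iff by blast
  show "\<not> (\<exists>H\<in>pc_minors G. \<exists>Q. in_Qminus Q \<and> iso H Q)"
  proof (intro notI, elim bexE exE conjE)
    fix H Q assume H: "H \<in> pc_minors G" and Q: "in_Qminus Q" and HQ: "iso H Q"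
    obtain T :: "nat set set" and \<phi> where T: "cube_rep Q T \<phi>" "\<not> ag_family T" using Qminus_rep[OF Q] .
    have H': "is_graph H" "AG H" using pc_minor_AG[OF rep T0 H] by simp_all
    obtain f where "bij_betw f (fst H) (fst Q)"
      "\<forall>x\<in>fst H. \<forall>y\<in>fst H. (x, y) \<in> snd H \<longleftrightarrow> (f x, f y) \<in> snd Q"
      using HQ unfolding iso_def by (elim exE conjE)
    then have "cube_rep H T (\<phi> \<circ> f)" by (intro cube_rep_iso[OF H'(1) T(1)]) simp_all
    then show False using AG_iff T(2) H'(2) by blast
  qed
qed

section \<open>From a minimal bad minor to a member of the excluded family\<close>

lemma in_Qminus_single:
  assumes "n \<ge> 4" "i < n"
  shows "in_Qminus (induced (hypercube n) (Pow {0..<n} - {{0..<n}, {i}}))"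
  unfolding in_Qminus_def Let_def
  by (intro exI[of _ n] conjI exI[of _ "{}"] disjI1 exI[of _ i]) (use assms in simp_all)

lemma in_Qminus_many:
  assumes "n \<ge> 4" "M \<subseteq> {0..<n}" "M \<noteq> {}"
  shows "in_Qminus (induced (hypercube n) (Pow {0..<n} - {{0..<n}, {}} - (\<lambda>i. {i}) ` M))"
proof -
  have "finite M" using assms(2) finite_subset by blast
  then have "1 \<le> card M" using assms(3) by (simp add: Suc_le_eq card_gt_0_iff)
  then show ?thesis
    unfolding in_Qminus_def Let_def
    by (intro exI[of _ n] conjI exI[of _ "{}"] disjI2 exI[of _ M]) (use assms in simp_all)
qed

lemma image_bij_Pow:
  assumes "bij_betw \<beta> U U'"
  shows "bij_betw (image \<beta>) (Pow U) (Pow U')" "inj_on (image \<beta>) (Pow U)"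
    "A \<subseteq> U \<Longrightarrow> B \<subseteq> U \<Longrightarrow> sym_diff (\<beta> ` A) (\<beta> ` B) = \<beta> ` sym_diff A B"
    "A \<subseteq> U \<Longrightarrow> card (\<beta> ` A) = card A"
proof -
  have inj: "inj_on \<beta> U" using assms by (simp add: bij_betw_def)
  show "bij_betw (image \<beta>) (Pow U) (Pow U')" using assms by (rule bij_betw_Pow)
  then show "inj_on (image \<beta>) (Pow U)" by (simp add: bij_betw_def)
  show "sym_diff (\<beta> ` A) (\<beta> ` B) = \<beta> ` sym_diff A B" if "A \<subseteq> U" "B \<subseteq> U"
  proof -
    have "\<beta> ` (A - B) = \<beta> ` A - \<beta> ` B" "\<beta> ` (B - A) = \<beta> ` B - \<beta> ` A"
      by (rule inj_on_image_set_diff[OF inj]; use that in blast)+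
    then show ?thesis by (simp add: image_Un)
  qed
  show "card (\<beta> ` A) = card A" if "A \<subseteq> U" using inj that card_image inj_on_subset by blast
qed

text \<open>Translating by \<open>v\<close> and numbering the coordinates of \<open>U\<close> turns
  the family from \<open>minimal_non_ag\<close> into a literal member of the excluded list, with the
  empty set as base vertex.\<close>

lemma minimal_non_ag_minor_Qminus:
  assumes rep: "cube_rep H T \<phi>" and nag: "\<not> ag_family T"
    and restr: "\<And>e s. \<exists>x\<in>T. e \<in> x \<Longrightarrow> \<exists>x\<in>T. e \<notin> x \<Longrightarrow> ag_family {t \<in> T. (e \<in> t) = s}"
    and contr: "\<And>e. \<exists>x\<in>T. e \<in> x \<Longrightarrow> \<exists>x\<in>T. e \<notin> x \<Longrightarrow> ag_family ((\<lambda>t. t - {e}) ` T)"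
  shows "\<exists>Q. in_Qminus Q \<and> iso H Q"
proof -
  interpret cube_rep H T \<phi> by (rule rep)
  obtain U v where U: "finite U" "card U \<ge> 4" and spread: "\<And>x. x \<in> T \<Longrightarrow> sym_diff x v \<subseteq> U"
    and Y: "(\<exists>e\<in>U. {B. B \<subseteq> U \<and> sym_diff v B \<in> T} = Pow U - {U, {e}}) \<or>
     (\<exists>M\<subseteq>U. M \<noteq> {} \<and> {B. B \<subseteq> U \<and> sym_diff v B \<in> T} = Pow U - {U, {}} - (\<lambda>i. {i}) ` M)"
    by (rule minimal_non_ag[OF cub nag restr contr]) (assumption+, rule that, assumption+)
  define n where "n = card U"
  obtain \<beta> where \<beta>: "bij_betw \<beta> U {0..<n}" unfolding n_def using ex_bij_betw_finite_nat[OF U(1)] by blast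
  note \<beta>' = image_bij_Pow[OF \<beta>]
  have \<beta>U: "\<beta> ` U = {0..<n}" using \<beta> by (simp add: bij_betw_def)
  define Y where "Y = {B. B \<subseteq> U \<and> sym_diff v B \<in> T}"
  have YU: "Y \<subseteq> Pow U" by (auto simp: Y_def)
  have bijY: "bij_betw (\<lambda>x. sym_diff x v) T Y"
  proof (rule bij_betw_byWitness[where f' = "\<lambda>x. sym_diff v x"])
    have inv: "sym_diff v (sym_diff x v) = x" for x by auto
    then show "\<forall>x\<in>T. sym_diff v (sym_diff x v) = x" by simp
    have "sym_diff (sym_diff v x) v = x" for x by auto
    then show "\<forall>x\<in>Y. sym_diff (sym_diff v x) v = x" by simp
    show "(\<lambda>x. sym_diff x v) ` T \<subseteq> Y" unfolding image_subset_iff Y_def mem_Collect_eq inv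
      using spread by simp
    show "(\<lambda>x. sym_diff v x) ` Y \<subseteq> T" unfolding image_subset_iff Y_def by simp
  qed
  define f where "f x = \<beta> ` sym_diff x v" for x
  have f: "bij_betw f T (image \<beta> ` Y)"
  proof -
    have "bij_betw (image \<beta>) Y (image \<beta> ` Y)"
      using inj_on_subset[OF \<beta>'(2) YU] by (simp add: bij_betw_def)
    then have "bij_betw (image \<beta> \<circ> (\<lambda>x. sym_diff x v)) T (image \<beta> ` Y)" by (rule bij_betw_trans[OF bijY])
    moreover have "image \<beta> \<circ> (\<lambda>x. sym_diff x v) = f" by (auto simp: f_def fun_eq_iff)
    ultimately show ?thesis by simp
  qed
  have card_f: "card (sym_diff (f s) (f t)) = card (sym_diff s t)" if "s \<in> T" "t \<in> T" for s t
  proof -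
    have "sym_diff (sym_diff s v) (sym_diff t v) = sym_diff s t" by auto
    then have "sym_diff (f s) (f t) = \<beta> ` sym_diff s t"
      unfolding f_def using \<beta>'(3)[OF spread[OF that(1)] spread[OF that(2)]] by simp
    moreover have "sym_diff s t \<subseteq> U" using spread[OF that(1)] spread[OF that(2)] by auto
    ultimately show ?thesis using \<beta>'(4) by simp
  qed
  have img: "image \<beta> ` Y \<subseteq> Pow {0..<n}" using YU \<beta>U by auto
  have iso: "iso H (induced (hypercube n) (image \<beta> ` Y))"
  proof (rule isoI)
    have V: "fst (induced (hypercube n) (image \<beta> ` Y)) = image \<beta> ` Y"
      using img by (auto simp: induced_def hypercube_def)
    show "bij_betw f T (fst (induced (hypercube n) (image \<beta> ` Y)))" unfolding V by (rule f)
    fix s t assume st: "s \<in> T" "t \<in> T"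
    have fst': "f s \<in> image \<beta> ` Y" "f t \<in> image \<beta> ` Y" using f st by (auto simp: bij_betw_def)
    then have "f s \<subseteq> {0..<n}" "f t \<subseteq> {0..<n}" using img by auto
    then show "card (sym_diff s t) = 1 \<longleftrightarrow> (f s, f t) \<in> snd (induced (hypercube n) (image \<beta> ` Y))"
      using fst' card_f[OF st] by (simp add: induced_def hypercube_def)
  qed
  have diff: "image \<beta> ` (Pow U - R) = Pow {0..<n} - image \<beta> ` R" if "R \<subseteq> Pow U" for R
  proof -
    have "image \<beta> ` (Pow U - R) = image \<beta> ` Pow U - image \<beta> ` R"
      by (rule inj_on_image_set_diff[OF \<beta>'(2)]) (use that in auto)
    then show ?thesis using \<beta>'(1) by (simp add: bij_betw_def)
  qed
  have n4: "n \<ge> 4" using U by (simp add: n_def)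
  have "in_Qminus (induced (hypercube n) (image \<beta> ` Y))"
    using Y[folded Y_def]
  proof
    assume "\<exists>e\<in>U. Y = Pow U - {U, {e}}"
    then obtain e where e: "e \<in> U" "Y = Pow U - {U, {e}}" by (elim bexE)
    have "image \<beta> ` Y = Pow {0..<n} - {{0..<n}, {\<beta> e}}"
      unfolding e(2) using diff[of "{U, {e}}"] e(1) \<beta>U by simp
    moreover have "\<beta> e < n" using e(1) \<beta>U by auto
    ultimately show ?thesis using in_Qminus_single[OF n4] by simp
  next
    assume "\<exists>M\<subseteq>U. M \<noteq> {} \<and> Y = Pow U - {U, {}} - (\<lambda>i. {i}) ` M"
    then obtain M where M: "M \<subseteq> U" "M \<noteq> {}" "Y = Pow U - {U, {}} - (\<lambda>i. {i}) ` M" by (elim exE conjE)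
    have R: "{U, {}} \<union> (\<lambda>i. {i}) ` M \<subseteq> Pow U" using M(1) by auto
    have Y': "Y = Pow U - ({U, {}} \<union> (\<lambda>i. {i}) ` M)" unfolding M(3) by blast
    have "image \<beta> ` Y = Pow {0..<n} - image \<beta> ` ({U, {}} \<union> (\<lambda>i. {i}) ` M)"
      unfolding Y' by (rule diff[OF R])
    also have "image \<beta> ` ({U, {}} \<union> (\<lambda>i. {i}) ` M) = {{0..<n}, {}} \<union> (\<lambda>i. {i}) ` \<beta> ` M"
      using \<beta>U by (simp add: image_image image_Un)
    finally have eq: "image \<beta> ` Y = Pow {0..<n} - {{0..<n}, {}} - (\<lambda>i. {i}) ` \<beta> ` M"
      by (simp only: Diff_eq Compl_Un Int_assoc)
    have "\<beta> ` M \<subseteq> {0..<n}" using image_mono[OF M(1), of \<beta>] \<beta>U by simp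
    moreover have "\<beta> ` M \<noteq> {}" using M(2) by simp
    ultimately show ?thesis unfolding eq by (rule in_Qminus_many[OF n4])
  qed
  then show ?thesis using iso by blast
qed

text \<open>Take a minor with fewest vertices among those with a family violating
  \<open>ag_family\<close>. Restricting to a side of a nonconstant coordinate, or contracting it,
  loses a vertex and is again a minor of \<open>G\<close>, so the result satisfies
  \<open>ag_family\<close>.\<close>

lemma F_Qminus_AG:
  assumes G: "is_graph G" and F: "F_Qminus G"
  shows "AG G"
proof (rule ccontr)
  assume nAG: "\<not> AG G"
  obtain T0 :: "nat set set" and \<phi>0 where rep: "cube_rep G T0 \<phi>0"
    using partial_cube_rep[OF G] F by (auto simp: F_Qminus_def)
  have nag: "\<not> ag_family T0" using nAG AG_iff[OF rep] by simp
  define bad where "bad H \<longleftrightarrow> H \<in> pc_minors G \<and>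
    (\<exists>(T :: nat set set) \<phi>. disjoint_cube_rep H T \<phi> \<and> \<not> ag_family T)" for H
  have "bad (lift G)" unfolding bad_def using lift_rep[OF rep] nag pc_minors.base by blast
  then obtain H where H: "bad H" and min: "\<And>K. bad K \<Longrightarrow> card (fst H) \<le> card (fst K)"
    using ex_has_least_nat[of bad "lift G" "\<lambda>H. card (fst H)"] by blast
  obtain T :: "nat set set" and \<phi> where T: "disjoint_cube_rep H T \<phi>" "\<not> ag_family T"
    and Hm: "H \<in> pc_minors G" using H unfolding bad_def by (elim exE conjE)
  interpret disjoint_cube_rep H T \<phi> by (rule T(1))
  have card_rep: "card (fst K) = card S" if "disjoint_cube_rep K S \<psi>" for K and S :: "nat set set" and \<psi>
  proof -
    interpret K: disjoint_cube_rep K S \<psi> by (rule that)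
    show ?thesis by (rule bij_betw_same_card[OF K.bij])
  qed
  have smaller: "ag_family S" if "K \<in> pc_minors G" "disjoint_cube_rep K S \<psi>" "card S < card T"
    for K and S :: "nat set set" and \<psi>
  proof (rule ccontr)
    assume "\<not> ag_family S"
    then have "bad K" unfolding bad_def using that(1,2) by blast
    then show False using min card_rep[OF that(2)] card_rep[OF T(1)] that(3) by fastforce
  qed
  have finT: "finite T" by (rule cubicalD(1)[OF cub])
  have restr: "ag_family {t \<in> T. (e \<in> t) = s}" if e: "\<exists>x\<in>T. e \<in> x" "\<exists>x\<in>T. e \<notin> x" for e s
  proof -
    define h where "h = {y \<in> fst H. (e \<in> \<phi> y) = s}"
    obtain t where t: "t \<in> T" "(e \<in> t) = s" using e by (cases s) auto
    obtain x where x: "x \<in> fst H" "t = \<phi> x" using phi_obtain[OF t(1)] .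
    have "theta_class H (coord_class e)" using e theta_class_iff by (auto simp: nonconstant_def)
    moreover have "halfspace H (coord_class e) h"
      unfolding halfspace_iff h_def using x t(2) by (intro bexI[of _ x]) simp_all
    ultimately have "\<forall>C\<in>{coord_class e}. theta_class H C \<and> halfspace H C h" by simp
    from pc_minors.restr[OF Hm this]
    have m: "induced H (fst H \<inter> \<Inter> ((\<lambda>_. h) ` {coord_class e})) \<in> pc_minors G" .
    have "disjoint_cube_rep (induced H (fst H \<inter> \<Inter> ((\<lambda>_. h) ` {coord_class e}))) (T \<inter> {t. (e \<in> t) = s}) \<phi>"
      by (rule induced_disjoint_rep) (auto simp: between_def h_def)
    moreover have "card (T \<inter> {t. (e \<in> t) = s}) < card T"
    proof (rule psubset_card_mono[OF finT])
      show "T \<inter> {t. (e \<in> t) = s} \<subset> T" using e by (cases s) auto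
    qed
    ultimately have "ag_family (T \<inter> {t. (e \<in> t) = s})" by (rule smaller[OF m])
    then show ?thesis by (simp add: Int_def)
  qed
  have contr: "ag_family ((\<lambda>t. t - {e}) ` T)" if e: "\<exists>x\<in>T. e \<in> x" "\<exists>x\<in>T. e \<notin> x" for e
  proof -
    have "theta_class H (coord_class e)" using e theta_class_iff by (auto simp: nonconstant_def)
    then have m: "contract H (coord_class e) \<in> pc_minors G" by (rule pc_minors.contr[OF Hm])
    obtain \<psi> where \<psi>: "disjoint_cube_rep (contract H (coord_class e)) ((\<lambda>t. t - {e}) ` T) \<psi>"
      using contract_rep by blast
    obtain x y where xy: "x \<in> T" "y \<in> T" "e \<in> x" "e \<notin> y" using e by blast
    then obtain v where v: "v \<in> T" "sym_diff v {e} \<in> T"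
      using cubical_edge_between[OF cub xy(1,2), of e] by blast
    \<comment> \<open>Isometry supplies an edge in direction \<open>e\<close>, and its two ends are
      identified.\<close>
    have "\<not> inj_on (\<lambda>t. t - {e}) T"
    proof
      assume inj: "inj_on (\<lambda>t. t - {e}) T"
      have "v - {e} = sym_diff v {e} - {e}" by auto
      then have eq: "v = sym_diff v {e}" using inj_onD[OF inj _ v] by blast
      from eqset_imp_iff[OF eq, of e] show False by auto
    qed
    then have "card ((\<lambda>t. t - {e}) ` T) < card T"
      using card_image_le[OF finT, of "\<lambda>t. t - {e}"] inj_on_iff_eq_card[OF finT] by (metis le_neq_implies_less)
    then show ?thesis by (rule smaller[OF m \<psi>])
  qed
  have "\<exists>Q. in_Qminus Q \<and> iso H Q"
    by (rule minimal_non_ag_minor_Qminus[OF cube_rep_axioms T(2) restr contr])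
  then show False using F Hm unfolding F_Qminus_def by blast
qed

theorem mainTheorem1:
  fixes G :: "'a graph"
  assumes "is_graph G" and "fst G \<noteq> {}"
  shows "(G_COM G \<longleftrightarrow> AG G) \<and> (AG G \<longleftrightarrow> F_Qminus G)"
proof (intro conjI iffI)
  assume "G_COM G"
  then obtain T :: "nat set set" and \<phi> where "cube_rep G T \<phi>" "ag_family T"
    using G_COM_rep[OF assms(1)] by blast
  then show "AG G" using AG_iff by blast
next
  assume AG: "AG G"
  then obtain T :: "nat set set" and \<phi> where T: "cube_rep G T \<phi>"
    using partial_cube_rep[OF assms(1)] by (auto simp: AG_def)
  moreover have "T \<noteq> {}"
    using cube_rep.bij[OF T] assms(2) by (auto simp: bij_betw_def)
  ultimately show "G_COM G" using AG AG_iff ag_family_G_COM by blast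
next
  show "AG G \<Longrightarrow> F_Qminus G" by (rule AG_F_Qminus[OF assms(1)])
  show "F_Qminus G \<Longrightarrow> AG G" by (rule F_Qminus_AG[OF assms(1)])
qed

end
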